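(* Let $n\ge1$. Assume that $\Omega\subset\mathbb{R}^{n+1}$ is a bounded domain with Lipschitz boundary and that $\beta$ satisfies $0\le\beta\le\frac{2(n+1)}{n-1}$ if $n\ge2$, or $\beta\ge0$ if $n=1$. Then $$0<\mu_{n+1,\beta}(\Omega)\le\mu^*_{n+1,\beta}.$$
   Context: For a domain $\Omega\subset\mathbb{R}^{n+1}$ let $\delta_\Omega(x)=\operatorname{dist}(x,\partial\Omega)$, and define $$J_{n+1,\beta,\Omega}[u]=\frac{\int_\Omega|\nabla u|^2\,dx}{\Big(\int_\Omega\delta_\Omega^{-2+\frac{n-1}{n+1}\beta}|u|^{2+\frac{2\beta}{n+1}}\,dx\Big)^{\frac{n+1}{n+\beta+1}}},\qquad \mu_{n+1,\beta}(\Omega)=\inf_{u\in C_0^\infty(\Omega)\setminus\{0\}}J_{n+1,\beta,\Omega}[u].$$ $\mu^*_{n+1,\beta}=\mu_{n+1,\beta}(\mathbb{R}^{n+1}_+)$, where $\mathbb{R}^{n+1}_+=\{(y,t):y\in\mathbb{R}^n,\ t>0\}$ (so $\delta_{\mathbb{R}^{n+1}_+}(y,t)=t$). *)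

theory Defs
  imports "HOL-Analysis.Analysis"
begin

text \<open>
  The space \<open>\<real>\<^sup>n\<^sup>+\<^sup>1\<close> is rendered as the Euclidean space \<open>(real ^ 'n) \<times> real\<close> with \<open>n = CARD('n)\<close>,
  so that points are written \<open>(y, t)\<close>; the norm on the product type is the Euclidean one.
\<close>

definition upper_half_space :: "((real ^ 'n) \<times> real) set" where
  "upper_half_space = {(y, t). t > 0}"

definition is_domain :: "'a::topological_space set \<Rightarrow> bool" where
  "is_domain \<Omega> \<longleftrightarrow> open \<Omega> \<and> connected \<Omega> \<and> \<Omega> \<noteq> {}"

text \<open>
  Near each boundary point, after an orthogonal change of coordinates, \<open>\<Omega>\<close> is the strict
  epigraph of a Lipschitz function. Translations are absorbed into \<open>\<phi>\<close>.
\<close>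

definition lipschitz_boundary :: "((real ^ 'n) \<times> real) set \<Rightarrow> bool" where
  "lipschitz_boundary \<Omega> \<longleftrightarrow>
     (\<forall>p\<in>frontier \<Omega>. \<exists>r>0. \<exists>T :: (real ^ 'n) \<times> real \<Rightarrow> (real ^ 'n) \<times> real.
        \<exists>\<phi> :: real ^ 'n \<Rightarrow> real. \<exists>L.
          orthogonal_transformation T \<and> L-lipschitz_on UNIV \<phi> \<and>
          \<Omega> \<inter> ball p r = {x \<in> ball p r. snd (T x) > \<phi> (fst (T x))})"

text \<open>\<open>C\<^sup>k\<close> on the whole space, by recursion over the partial derivatives.\<close>

primrec Ck :: "nat \<Rightarrow> ('a::euclidean_space \<Rightarrow> real) \<Rightarrow> bool" where
  "Ck 0 f \<longleftrightarrow> continuous_on UNIV f"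
| "Ck (Suc k) f \<longleftrightarrow> (\<forall>x. f differentiable (at x)) \<and>
     (\<forall>b\<in>Basis. Ck k (\<lambda>x. frechet_derivative f (at x) b))"

text \<open>Elements of \<open>C\<^sub>0\<^sup>\<infinity>(\<Omega>)\<close> are regarded as functions on the whole space, extended by zero.\<close>

definition test_functions :: "'a::euclidean_space set \<Rightarrow> ('a \<Rightarrow> real) set" where
  "test_functions \<Omega> =
     {u. (\<forall>k. Ck k u) \<and> compact (closure {x. u x \<noteq> 0}) \<and> closure {x. u x \<noteq> 0} \<subseteq> \<Omega>}"

definition grad :: "('a::euclidean_space \<Rightarrow> real) \<Rightarrow> 'a \<Rightarrow> 'a" where
  "grad u x = (\<Sum>b\<in>Basis. frechet_derivative u (at x) b *\<^sub>R b)"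

definition bdist :: "'a::metric_space set \<Rightarrow> 'a \<Rightarrow> real" where
  "bdist \<Omega> x = infdist x (frontier \<Omega>)"

text \<open>Inside an open \<open>\<Omega>\<close> with nonempty boundary \<open>bdist\<close> is positive, so the possibly negative power is
  the usual one; the convention \<open>0 powr a = 0\<close> is used only for \<open>u x = 0\<close>, with positive exponent.\<close>

definition J :: "real \<Rightarrow> ((real ^ 'n) \<times> real) set \<Rightarrow> ((real ^ 'n) \<times> real \<Rightarrow> real) \<Rightarrow> real" where
  "J \<beta> \<Omega> u =
     (let n = real CARD('n) in
       (LINT x:\<Omega>|lborel. (norm (grad u x))\<^sup>2) /
       (LINT x:\<Omega>|lborel. bdist \<Omega> x powr (-2 + (n - 1) / (n + 1) * \<beta>) *
            \<bar>u x\<bar> powr (2 + 2 * \<beta> / (n + 1)))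
         powr ((n + 1) / (n + \<beta> + 1)))"

definition \<mu> :: "real \<Rightarrow> ((real ^ 'n) \<times> real) set \<Rightarrow> real" where
  "\<mu> \<beta> \<Omega> = (INF u \<in> test_functions \<Omega> - {\<lambda>x. 0}. J \<beta> \<Omega> u)"

text \<open>
  The constant \<open>\<mu>\<^sup>*\<close> depends on \<open>n\<close> only through the type index, which therefore has to be
  passed explicitly.
\<close>

definition \<mu>_star :: "'n::finite itself \<Rightarrow> real \<Rightarrow> real" where
  "\<mu>_star _ \<beta> = \<mu> \<beta> (upper_half_space :: ((real ^ 'n) \<times> real) set)"

end

(*
  Lower bound. Hardy's inequality on a bounded Lipschitz domain follows by integrating the derivative
  of psi^2 u^2 / h in the direction e, where near a boundary point h is the height above the graph
  in the direction e: this derivative contains the term - psi^2 u^2 / h^2, the other terms are absorbed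
  into it, h is comparable to the distance to the boundary, and finitely many such patches together
  with the Poincare inequality cover the domain.
  The L1 Sobolev inequality of Gagliardo and Nirenberg, applied to |u|^(2(N-1)/(N-2)), gives the
  critical Sobolev inequality for N = n + 1 >= 3. For N = 2 it is applied to |u|^(m+1) / delta, and
  induction on m bounds the integrals of |u|^(2m) / delta^2, starting from Hardy's inequality.
  All intermediate exponents follow from Hoelder's inequality.

  Upper bound. J is invariant under similarities, so it suffices to find places where the boundary is
  arbitrarily flat relative to the scale. Instead of Rademacher's theorem one uses a pair of points at
  which the difference quotient of the Lipschitz graph is almost maximal: around the midpoint of
  such a (short) segment the function is nearly affine. A test function of the half space is moved
  there by a similarity; as the exponent of delta is not positive, only an upper bound for
  delta is needed.
*)
theory Submission
  imports Defs
begin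

section \<open>Compactly supported functions and directional derivatives\<close>

text \<open>The weight exponent a = -2 + (n-1) beta/(n+1) grows linearly from Hardy's -2 to 0, the
  critical Sobolev case, at the largest beta allowed for n >= 2; in between, the integrand of the
  denominator is a geometric mean of the two extreme integrands. For n = 1 the weight is delta^(-2)
  for every beta and there is no last exponent, so the second end point has to be an arbitrarily
  high even power with that weight. The induction closes because N/(N-1) = 2: the square of
  |u|^(m+1)/delta carries delta^(-2) again, and differentiating 1/delta costs at most delta^(-2).
  Neither h nor delta need be differentiable, hence the derivatives are taken in a single direction
  (for h) or of a smooth substitute (for delta). In the upper bound no limit domain is formed. A
  fixed u on the half space and a fixed epsilon determine the flatness that is required: the
  deviation of the boundary from a plane must be small against the least height of the support of u,
  in the scale set by the radius of that support. The competitor then costs a factor that tends to 1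
  with epsilon.\<close>

lemma continuous_on_zero_extension:
  fixes f :: "'a::t2_space \<Rightarrow> 'b::{topological_space, zero}"
  assumes "open U" "continuous_on U f" "compact S" "S \<subseteq> U" "\<And>x. x \<notin> S \<Longrightarrow> f x = 0"
  shows "continuous_on UNIV f"
proof -
  have "open (- S)" using assms by (simp add: compact_imp_closed open_Compl)
  moreover have "continuous_on (- S) f"
    by (rule continuous_on_eq[OF continuous_on_const[of _ 0]]) (use assms in auto)
  ultimately have "continuous_on (U \<union> - S) f" using assms by (intro continuous_on_open_Un)
  moreover have "U \<union> - S = UNIV" using assms by auto
  ultimately show ?thesis by simp
qed

lemma integrable_compact_support:
  fixes f :: "'a::euclidean_space \<Rightarrow> real"
  assumes "continuous_on UNIV f" "compact S" "\<And>x. x \<notin> S \<Longrightarrow> f x = 0"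
  shows "integrable lborel f"
proof -
  have "integrable lborel (\<lambda>x. indicator S x *\<^sub>R f x)"
    by (rule borel_integrable_compact) (use assms continuous_on_subset in blast)+
  moreover have "(\<lambda>x. indicator S x *\<^sub>R f x) = f"
    using assms(3) by (intro ext) (auto simp: indicator_def)
  ultimately show ?thesis by simp
qed

lemma lborel_integral_translate:
  fixes f :: "'a::euclidean_space \<Rightarrow> real"
  assumes [measurable]: "f \<in> borel_measurable borel"
  shows "integral\<^sup>L lborel (\<lambda>x. f (x + c)) = integral\<^sup>L lborel f"
proof -
  have "integral\<^sup>L (distr lborel borel ((+) c)) f = integral\<^sup>L lborel (\<lambda>x. f (c + x))"
    by (rule integral_distr) auto
  then show ?thesis by (simp add: lborel_distr_plus add.commute)
qed

lemma line_derivative_at: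
  fixes f g :: "'a::real_normed_vector \<Rightarrow> real"
  assumes d: "\<And>x. ((\<lambda>s. f (x + s *\<^sub>R e)) has_real_derivative g x) (at 0)"
  shows "((\<lambda>s. f (x + s *\<^sub>R e)) has_real_derivative g (x + s *\<^sub>R e)) (at s)"
proof -
  have "((\<lambda>h. f ((x + s *\<^sub>R e) + h *\<^sub>R e)) has_real_derivative g (x + s *\<^sub>R e)) (at 0)" by (rule d)
  then have "((\<lambda>h. f (x + (h + s) *\<^sub>R e)) has_real_derivative g (x + s *\<^sub>R e)) (at 0)"
    by (simp add: algebra_simps)
  then have "((\<lambda>s. f (x + s *\<^sub>R e)) has_real_derivative g (x + s *\<^sub>R e)) (at (0 + s))"
    by (rule DERIV_shift[THEN iffD2])
  then show ?thesis by (simp only: add_0_left)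
qed

text \<open>For small s the point stays in the open complement of S. This supplies the derivative at
  points where a quotient formula has no meaning.\<close>

lemma line_derivative_outside:
  fixes f :: "'a::real_normed_vector \<Rightarrow> real"
  assumes "closed S" "\<And>x. x \<notin> S \<Longrightarrow> f x = 0" "x \<notin> S"
  shows "((\<lambda>s. f (x + s *\<^sub>R e)) has_real_derivative 0) (at 0)"
proof -
  let ?V = "(\<lambda>s. x + s *\<^sub>R e) -` (- S)"
  have "open ?V" using assms(1) by (intro open_vimage continuous_intros) (auto simp: open_Compl)
  moreover have "((\<lambda>_. 0::real) has_real_derivative 0) (at 0)" by simp
  ultimately show ?thesis
    by (elim has_field_derivative_transform_within_open[rotated]) (use assms in auto)
qed

text \<open>The difference quotients of f in direction e have integral zero by translation
  invariance, and dominated convergence carries this over to g; the mean value theorem bounds them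
  by the maximum of |g|. Only one directional derivative has to exist, which is what a quotient by a
  merely Lipschitz height offers.\<close>

lemma integral_directional_derivative_zero:
  fixes f g :: "'a::euclidean_space \<Rightarrow> real"
  assumes f: "continuous_on UNIV f" and g: "continuous_on UNIV g"
    and S: "compact S" "\<And>x. x \<notin> S \<Longrightarrow> f x = 0" "\<And>x. x \<notin> S \<Longrightarrow> g x = 0"
    and d: "\<And>x. ((\<lambda>s. f (x + s *\<^sub>R e)) has_real_derivative g x) (at 0)"
  shows "integral\<^sup>L lborel g = 0"
proof -
  have [measurable]: "f \<in> borel_measurable borel" "g \<in> borel_measurable borel"
    using f g by (auto intro: borel_measurable_continuous_onI)
  have deriv: "((\<lambda>s. f (x + s *\<^sub>R e)) has_real_derivative g (x + s *\<^sub>R e)) (at s)" for x s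
    by (rule line_derivative_at[of f e g, OF d])
  obtain R where R: "\<And>x. x \<in> S \<Longrightarrow> norm x \<le> R" using compact_imp_bounded[OF S(1)] by (auto simp: bounded_iff)
  obtain M where M: "\<And>x. \<bar>g x\<bar> \<le> M" "0 \<le> M"
  proof -
    have "bounded (g ` S)" using g S(1) continuous_on_subset
      by (blast intro: compact_imp_bounded compact_continuous_image)
    then obtain M where "\<And>x. x \<in> S \<Longrightarrow> \<bar>g x\<bar> \<le> M" by (auto simp: bounded_iff)
    then have "\<bar>g x\<bar> \<le> max 0 M" for x using S(3)[of x] by (cases "x \<in> S") force+
    then show ?thesis using that[of "max 0 M"] by simp
  qed
  define q where "q n x = real (Suc n) * (f (x + (1 / Suc n) *\<^sub>R e) - f x)" for n x
  \<comment> \<open>The increments 1/(n+1) are at most 1, so all difference quotients vanish outside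
    this ball.\<close>
  let ?K = "cball 0 (R + norm e) :: 'a set"
  have intf: "integrable lborel f" by (rule integrable_compact_support[OF f S(1,2)])
  have intf': "integrable lborel (\<lambda>x. f (x + c))" for c
  proof (rule integrable_compact_support)
    show "continuous_on UNIV (\<lambda>x. f (x + c))"
      by (intro continuous_on_compose2[OF f] continuous_intros) auto
    show "compact ((\<lambda>x. x - c) ` S)" using S by (intro compact_continuous_image continuous_intros)
    show "f (x + c) = 0" if "x \<notin> (\<lambda>x. x - c) ` S" for x
      using that by (intro S(2)) (metis add_diff_cancel image_eqI)
  qed
  have zero: "integral\<^sup>L lborel (q n) = 0" for n
    unfolding q_def by (simp add: intf intf' lborel_integral_translate)
  have "(\<lambda>n. integral\<^sup>L lborel (q n)) \<longlonglongrightarrow> integral\<^sup>L lborel g"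
  proof (rule integral_dominated_convergence[where w="\<lambda>x. M * indicator ?K x"])
    show "g \<in> borel_measurable lborel" "q n \<in> borel_measurable lborel" for n unfolding q_def by measurable
    show "integrable lborel (\<lambda>x. M * indicator ?K x)"
      by (intro integrable_mult_right integrable_real_indicator) (use emeasure_lborel_cball_finite in auto)
    show "AE x in lborel. (\<lambda>n. q n x) \<longlonglongrightarrow> g x"
    proof (rule AE_I2)
      fix x
      have "(\<lambda>h. (f (x + h *\<^sub>R e) - f (x + 0 *\<^sub>R e)) / h) \<midarrow>0\<rightarrow> g x"
        using d[of x] unfolding DERIV_def by simp
      moreover have "filterlim (\<lambda>n. 1 / real (Suc n)) (at 0) sequentially"
        unfolding filterlim_at using lim_1_over_n[THEN LIMSEQ_Suc] by auto
      ultimately have "(\<lambda>n. (f (x + (1 / real (Suc n)) *\<^sub>R e) - f (x + 0 *\<^sub>R e)) / (1 / real (Suc n))) \<longlonglongrightarrow> g x"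
        by (rule filterlim_compose)
      then show "(\<lambda>n. q n x) \<longlonglongrightarrow> g x" by (simp add: q_def mult.commute)
    qed
    show "AE x in lborel. norm (q n x) \<le> M * indicator ?K x" for n
    proof (rule AE_I2)
      fix x
      let ?h = "1 / real (Suc n)"
      show "norm (q n x) \<le> M * indicator ?K x"
      proof (cases "x \<in> ?K")
        case True
        have "\<exists>z>0. z < ?h \<and> f (x + ?h *\<^sub>R e) - f (x + 0 *\<^sub>R e) = (?h - 0) * g (x + z *\<^sub>R e)"
          by (rule MVT2) (use deriv in auto)
        then obtain z where "f (x + ?h *\<^sub>R e) - f x = ?h * g (x + z *\<^sub>R e)" by auto
        then have "q n x = g (x + z *\<^sub>R e)" by (simp add: q_def)
        then show ?thesis using M True by simp
      next
        case False
        have "norm (?h *\<^sub>R e) \<le> norm e" by (simp add: divide_le_eq mult_le_cancel_left1)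
        moreover have "norm x \<le> norm (x + ?h *\<^sub>R e) + norm (?h *\<^sub>R e)"
          by (metis add_diff_cancel norm_triangle_ineq4)
        ultimately have "norm (x + ?h *\<^sub>R e) > R" using False by simp
        moreover have "norm x > R" using False by (smt (verit) mem_cball_0 norm_ge_zero)
        ultimately have "f (x + ?h *\<^sub>R e) = 0" "f x = 0" using R S(2) by (metis linorder_not_less)+
        then show ?thesis using M by (simp add: q_def)
      qed
    qed
  qed
  then show ?thesis by (simp add: zero LIMSEQ_const_iff)
qed

section \<open>Test functions, their gradients and the Poincare inequality\<close>

definition support :: "('a::topological_space \<Rightarrow> real) \<Rightarrow> 'a set" where
  "support u = closure {x. u x \<noteq> 0}"

lemma zero_outside_support: "x \<notin> support u \<Longrightarrow> u x = 0"
  using closure_subset[of "{x. u x \<noteq> 0}"] unfolding support_def by blast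

lemma has_derivative_grad:
  fixes u :: "'a::euclidean_space \<Rightarrow> real"
  assumes "u differentiable (at x)"
  shows "(u has_derivative (\<lambda>h. grad u x \<bullet> h)) (at x)"
proof -
  have d: "(u has_derivative frechet_derivative u (at x)) (at x)"
    using assms frechet_derivative_works by blast
  then have lin: "linear (frechet_derivative u (at x))"
    by (rule has_derivative_linear)
  have "frechet_derivative u (at x) h = grad u x \<bullet> h" for h
  proof -
    have "frechet_derivative u (at x) h = frechet_derivative u (at x) (\<Sum>b\<in>Basis. (h \<bullet> b) *\<^sub>R b)"
      by (simp add: euclidean_representation)
    also have "\<dots> = (\<Sum>b\<in>Basis. (h \<bullet> b) * frechet_derivative u (at x) b)"
      using lin by (simp add: linear_sum linear_scale)
    also have "\<dots> = grad u x \<bullet> h"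
      by (simp add: grad_def inner_sum_right inner_commute mult.commute)
    finally show ?thesis .
  qed
  then have "frechet_derivative u (at x) = (\<lambda>h. grad u x \<bullet> h)" by auto
  with d show ?thesis by simp
qed

lemma grad_eqI:
  assumes "(u has_derivative (\<lambda>h. v \<bullet> h)) (at x)"
  shows "grad u x = v"
proof -
  have "frechet_derivative u (at x) = (\<lambda>h. v \<bullet> h)"
    using frechet_derivative_at[OF assms] by simp
  then show ?thesis by (simp add: grad_def euclidean_representation)
qed

context
  fixes u :: "'a::euclidean_space \<Rightarrow> real" and \<Omega>
  assumes u: "u \<in> test_functions \<Omega>"
begin

lemma test_function_has_derivative: "(u has_derivative (\<lambda>h. grad u x \<bullet> h)) (at x)"
proof (rule has_derivative_grad)
  have "Ck (Suc 0) u" using u unfolding test_functions_def by blast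
  then show "u differentiable (at x)" by simp
qed

lemma continuous_test_function: "continuous_on S u"
proof -
  have "Ck 0 u" using u unfolding test_functions_def by blast
  then show ?thesis using continuous_on_subset by auto
qed

lemma continuous_grad: "continuous_on S (grad u)"
proof -
  have "Ck (Suc 0) u" using u unfolding test_functions_def by blast
  then have "continuous_on UNIV (grad u)" unfolding grad_def
    by (auto intro!: continuous_intros)
  then show ?thesis using continuous_on_subset by auto
qed

lemma compact_support: "compact (support u)"
  and support_subset: "support u \<subseteq> \<Omega>"
  using u unfolding test_functions_def support_def by auto

lemma grad_zero_outside_support:
  assumes "x \<notin> support u"
  shows "grad u x = 0"
proof (rule grad_eqI)
  show "(u has_derivative (\<lambda>h. 0 \<bullet> h)) (at x)"
  proof (rule has_derivative_transform_within_open)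
    show "((\<lambda>_. 0) has_derivative (\<lambda>h. 0 \<bullet> h)) (at x)" by simp
    show "open (- support u)" using compact_support compact_imp_closed open_Compl by blast
  qed (use assms zero_outside_support[of _ u] in auto)
qed

lemma test_function_line_derivative:
  "((\<lambda>s. u (x + s *\<^sub>R e)) has_real_derivative grad u (x + s *\<^sub>R e) \<bullet> e) (at s)"
proof -
  have "((\<lambda>s. u (x + s *\<^sub>R e)) has_derivative (\<lambda>t. grad u (x + s *\<^sub>R e) \<bullet> (t *\<^sub>R e))) (at s)"
  proof (rule has_derivative_compose[where f="\<lambda>s. x + s *\<^sub>R e" and g=u])
    show "((\<lambda>s. x + s *\<^sub>R e) has_derivative (\<lambda>t. t *\<^sub>R e)) (at s)"
      by (auto intro!: derivative_eq_intros)
  qed (rule test_function_has_derivative)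
  then have "((\<lambda>s. u (x + s *\<^sub>R e)) has_derivative (\<lambda>t. (grad u (x + s *\<^sub>R e) \<bullet> e) * t)) (at s)"
    by (simp add: mult.commute)
  then show ?thesis by (simp add: has_field_derivative_def)
qed

lemma integrable_on_support:
  assumes "open U" "support u \<subseteq> U" "continuous_on U f" "\<And>x. x \<notin> support u \<Longrightarrow> f x = 0"
  shows "continuous_on UNIV f" "integrable lborel (f :: 'a \<Rightarrow> real)"
proof -
  show "continuous_on UNIV f"
    using assms by (intro continuous_on_zero_extension[OF _ _ compact_support, of U])
  then show "integrable lborel f"
    by (rule integrable_compact_support) (use compact_support assms in auto)
qed

lemma integrable_square: "integrable lborel (\<lambda>x. (u x)\<^sup>2)"
proof (rule integrable_on_support(2)[of UNIV "\<lambda>x. (u x)\<^sup>2"])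
  show "continuous_on UNIV (\<lambda>x. (u x)\<^sup>2)"
    by (intro continuous_on_power continuous_test_function)
qed (use zero_outside_support[of _ u] in simp_all)

lemma integrable_grad_square: "integrable lborel (\<lambda>x. (norm (grad u x))\<^sup>2)"
proof (rule integrable_on_support(2)[of UNIV "\<lambda>x. (norm (grad u x))\<^sup>2"])
  show "continuous_on UNIV (\<lambda>x. (norm (grad u x))\<^sup>2)"
    by (intro continuous_on_power continuous_on_norm continuous_grad)
qed (use grad_zero_outside_support in simp_all)

text \<open>The derivative of (x . e) u^2 in a coordinate direction e integrates to zero. It
  consists of u^2 and a cross term with |x . e| <= R; completing the square (u + 2 (x . e)(grad u .
  e))^2 gives the constant 4 R^2.\<close>

lemma poincare:
  assumes R: "\<Omega> \<subseteq> cball 0 R"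
  shows "(LINT x|lborel. (u x)\<^sup>2) \<le> 4 * R\<^sup>2 * (LINT x|lborel. (norm (grad u x))\<^sup>2)"
proof -
  obtain e :: 'a where e: "e \<in> Basis" using nonempty_Basis by blast
  define f where "f x = (x \<bullet> e) * (u x)\<^sup>2" for x
  define g where "g x = (u x)\<^sup>2 + 2 * (x \<bullet> e) * u x * (grad u x \<bullet> e)" for x
  have cg: "continuous_on UNIV g" and cf: "continuous_on UNIV f"
    unfolding f_def g_def by (intro continuous_intros continuous_test_function continuous_grad)+
  have 0: "integral\<^sup>L lborel g = 0"
  proof (rule integral_directional_derivative_zero[OF cf cg compact_support])
    show "f x = 0" "g x = 0" if "x \<notin> support u" for x
      using that by (auto simp: f_def g_def zero_outside_support[of _ u])
    have "((\<lambda>s. ((x + s *\<^sub>R e) \<bullet> e) * (u (x + s *\<^sub>R e))\<^sup>2) has_real_derivative g x) (at 0)" for x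
      using e test_function_line_derivative[of x e 0]
      by (auto intro!: derivative_eq_intros simp: inner_add_left g_def algebra_simps)
    then show "((\<lambda>s. f (x + s *\<^sub>R e)) has_real_derivative g x) (at 0)" for x
      by (simp add: f_def)
  qed
  have ig: "integrable lborel g"
    by (rule integrable_on_support(2)[of UNIV]) (use cg zero_outside_support[of _ u] in \<open>auto simp: g_def\<close>)
  have pt: "(u x)\<^sup>2 \<le> 2 * g x + 4 * R\<^sup>2 * (norm (grad u x))\<^sup>2" for x
  proof (cases "x \<in> support u")
    case True
    then have "norm x \<le> R" using support_subset R by auto
    moreover have "\<bar>x \<bullet> e\<bar> \<le> norm x" "\<bar>grad u x \<bullet> e\<bar> \<le> norm (grad u x)"
      using e by (auto intro: Basis_le_norm)
    ultimately have "\<bar>(x \<bullet> e) * (grad u x \<bullet> e)\<bar> \<le> R * norm (grad u x)"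
      unfolding abs_mult by (intro mult_mono) auto
    then have "((x \<bullet> e) * (grad u x \<bullet> e))\<^sup>2 \<le> (R * norm (grad u x))\<^sup>2"
      by (metis abs_ge_zero power2_abs power_mono)
    moreover have "0 \<le> (u x + 2 * ((x \<bullet> e) * (grad u x \<bullet> e)))\<^sup>2" by simp
    ultimately show ?thesis by (simp add: g_def power2_eq_square algebra_simps)
  qed (simp add: zero_outside_support[of _ u] g_def)
  have "(LINT x|lborel. (u x)\<^sup>2) \<le> (LINT x|lborel. 2 * g x + 4 * R\<^sup>2 * (norm (grad u x))\<^sup>2)"
    by (intro integral_mono pt integrable_square Bochner_Integration.integrable_add integrable_mult_right ig integrable_grad_square)
  also have "\<dots> = 4 * R\<^sup>2 * (LINT x|lborel. (norm (grad u x))\<^sup>2)"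
    using 0 ig integrable_grad_square by simp
  finally show ?thesis .
qed

end

text \<open>The directional derivative of \<open>\<psi>\<^sup>2 u\<^sup>2 / h\<close> along \<open>e\<close> integrates to zero and contains
  \<open>- \<psi>\<^sup>2 u\<^sup>2 / h\<^sup>2\<close>.\<close>

lemma local_hardy:
  fixes u h :: "'a::euclidean_space \<Rightarrow> real"
  assumes u: "u \<in> test_functions \<Omega>"
    and h: "continuous_on UNIV h" "\<And>x s. h (x + s *\<^sub>R e) = h x + s" and e: "norm e = 1"
    and pos: "\<And>x. x \<in> \<Omega> \<Longrightarrow> dist p x \<le> \<rho> \<Longrightarrow> 0 < h x"
  defines "\<psi> \<equiv> \<lambda>x. max 0 (\<rho>\<^sup>2 - (norm (x - p))\<^sup>2)"
  assumes "0 < \<rho>"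
  shows "integrable lborel (\<lambda>x. (\<psi> x * u x / h x)\<^sup>2)"
    and "(LINT x|lborel. (\<psi> x * u x / h x)\<^sup>2) \<le>
      32 * \<rho>\<^sup>2 * (LINT x|lborel. (u x)\<^sup>2) + 8 * \<rho>^4 * (LINT x|lborel. (norm (grad u x))\<^sup>2)"
proof -
  define K where "K = support u \<inter> cball p \<rho>"
  define \<psi>' where "\<psi>' x = - 2 * ((x - p) \<bullet> e)" for x
  define f where "f x = (\<psi> x)\<^sup>2 * (u x)\<^sup>2 / h x" for x
  define g where "g x = 2 * \<psi> x * \<psi>' x * (u x)\<^sup>2 / h x + 2 * (\<psi> x)\<^sup>2 * u x * (grad u x \<bullet> e) / h x - (\<psi> x * u x / h x)\<^sup>2" for x
  have K: "compact K" by (simp add: K_def compact_support[OF u] compact_Int)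
  \<comment> \<open>The compact set K lies in this open set, where quotients by h are continuous, so
    they extend by zero to continuous functions.\<close>
  have "open {x. h x > 0}" using h(1) by (simp add: open_Collect_less)
  have KU: "K \<subseteq> {x. h x > 0}" using pos support_subset[OF u] by (auto simp: K_def)
  have c\<psi>: "continuous_on U \<psi>" for U unfolding \<psi>_def by (intro continuous_intros)
  have c\<psi>': "continuous_on U \<psi>'" for U unfolding \<psi>'_def by (intro continuous_intros)
  have \<psi>0: "\<psi> x = 0" if "x \<notin> cball p \<rho>" for x
  proof -
    have "\<rho> \<le> norm (x - p)" using that by (simp add: dist_norm norm_minus_commute)
    then have "\<rho>\<^sup>2 \<le> (norm (x - p))\<^sup>2" using \<open>0 < \<rho>\<close> by (intro power_mono) auto
    then show ?thesis by (simp add: \<psi>_def)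
  qed
  have z: "\<psi> x * u x = 0" if "x \<notin> K" for x
    using that zero_outside_support[of x u] \<psi>0 by (auto simp: K_def)
  then have z2: "\<psi> x = 0 \<or> u x = 0" if "x \<notin> K" for x using that by auto
  have f0: "f x = 0" and g0: "g x = 0" and X0: "(\<psi> x * u x / h x)\<^sup>2 = 0" if "x \<notin> K" for x
    using z2[OF that] by (auto simp: f_def g_def)
  have hU: "continuous_on {x. h x > 0} h" using h continuous_on_subset by blast
  have cont: "continuous_on UNIV f" "continuous_on UNIV g" "continuous_on UNIV (\<lambda>x. (\<psi> x * u x / h x)\<^sup>2)"
    by (rule continuous_on_zero_extension[OF _ _ K KU]; 
        use \<open>open {x. h x > 0}\<close> f0 g0 X0 in \<open>auto simp: f_def g_def intro!: continuous_intros c\<psi> c\<psi>' continuous_test_function[OF u] continuous_grad[OF u] hU\<close>)+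
  have int: "integrable lborel f" "integrable lborel g" "integrable lborel (\<lambda>x. (\<psi> x * u x / h x)\<^sup>2)"
    using cont f0 g0 X0 by (auto intro: integrable_compact_support[OF _ K])
  show "integrable lborel (\<lambda>x. (\<psi> x * u x / h x)\<^sup>2)" by fact
  \<comment> \<open>The cut-off \<open>\<psi>\<close> has a kink on the sphere of radius \<rho>, but
    its square is continuously differentiable; therefore only the square enters f.\<close>
  have possq: "((\<lambda>y. (max 0 y)\<^sup>2) has_real_derivative 2 * max 0 y) (at y)" for y :: real
  proof -
    consider "y < 0" | "y = 0" | "y > 0" by linarith
    then show ?thesis
    proof cases
      case 1
      then have "((\<lambda>_. 0) has_real_derivative 2 * max 0 y) (at y)" by simp
      then show ?thesis
        by (rule has_field_derivative_transform_within_open[where S="{..<0}"]) (use 1 in auto)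
    next
      case 2
      have "((\<lambda>h. (max 0 h)\<^sup>2 / h) \<longlongrightarrow> 0) (at (0::real))"
      proof (rule Lim_null_comparison)
        show "eventually (\<lambda>h. norm ((max 0 h)\<^sup>2 / h) \<le> \<bar>h\<bar>) (at (0::real))"
          by (rule always_eventually) (auto simp: max_def power2_eq_square)
        show "((\<lambda>h. \<bar>h\<bar>) \<longlongrightarrow> 0) (at (0::real))"
          by (intro tendsto_eq_intros) auto
      qed
      then show ?thesis using 2 by (simp add: DERIV_def)
    next
      case 3
      have "((\<lambda>y. y\<^sup>2) has_real_derivative 2 * max 0 y) (at y)"
        using 3 by (auto intro!: derivative_eq_intros)
      then show ?thesis
        by (rule has_field_derivative_transform_within_open[where S="{0<..}"]) (use 3 in auto)
    qed
  qed
  have d\<psi>: "((\<lambda>s. (\<psi> (x + s *\<^sub>R e))\<^sup>2) has_real_derivative 2 * \<psi> x * \<psi>' x) (at 0)" for x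
  proof -
    have eq: "\<rho>\<^sup>2 - (norm (x + s *\<^sub>R e - p))\<^sup>2 = \<rho>\<^sup>2 - ((norm (x - p))\<^sup>2 + 2 * s * ((x - p) \<bullet> e) + s\<^sup>2)" for s
    proof -
      have "(norm (x - p + s *\<^sub>R e))\<^sup>2 = (norm (x - p))\<^sup>2 + 2 * ((x - p) \<bullet> (s *\<^sub>R e)) + (norm (s *\<^sub>R e))\<^sup>2"
        by (simp only: power2_norm_eq_inner inner_add_left inner_add_right inner_commute)
      moreover have eq: "x + s *\<^sub>R e - p = x - p + s *\<^sub>R e" by simp
      ultimately show ?thesis using e unfolding eq by (simp add: power_mult_distrib)
    qed
    have "((\<lambda>s. \<rho>\<^sup>2 - (norm (x + s *\<^sub>R e - p))\<^sup>2) has_real_derivative \<psi>' x) (at 0)"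
      unfolding eq \<psi>'_def by (auto intro!: derivative_eq_intros)
    from DERIV_chain2[OF possq this]
    show ?thesis by (simp add: \<psi>_def)
  qed
  have "integral\<^sup>L lborel g = 0"
  proof (rule integral_directional_derivative_zero[OF cont(1,2) K f0 g0])
    fix x
    show "((\<lambda>s. f (x + s *\<^sub>R e)) has_real_derivative g x) (at 0)"
    proof (cases "x \<in> K")
      case True
      then have hx: "h x > 0" using KU by auto
      have du: "((\<lambda>s. (u (x + s *\<^sub>R e))\<^sup>2) has_real_derivative 2 * u x * (grad u x \<bullet> e)) (at 0)"
        using test_function_line_derivative[OF u, of x e 0] by (auto intro!: derivative_eq_intros)
      have dh: "((\<lambda>s. h x + s) has_real_derivative 1) (at 0)" by (auto intro!: derivative_eq_intros)
      have "((\<lambda>s. (\<psi> (x + s *\<^sub>R e))\<^sup>2 * (u (x + s *\<^sub>R e))\<^sup>2 / (h x + s)) has_real_derivative g x) (at 0)"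
        by (rule DERIV_cong[OF DERIV_divide[OF DERIV_mult[OF d\<psi> du] dh]])
          (use hx in \<open>auto simp: g_def power2_eq_square field_simps\<close>)
      then show ?thesis by (simp add: f_def h)
    next
      case False
      have "((\<lambda>s. f (x + s *\<^sub>R e)) has_real_derivative 0) (at 0)"
        by (rule line_derivative_outside[of K]) (use K f0 False compact_imp_closed in auto)
      then show ?thesis using g0[OF False] by simp
    qed
  qed
  have pt: "(\<psi> x * u x / h x)\<^sup>2 \<le> 32 * \<rho>\<^sup>2 * (u x)\<^sup>2 + 8 * \<rho>^4 * (norm (grad u x))\<^sup>2 - 2 * g x" for x
  proof (cases "x \<in> K")
    case True
    define X where "X = \<psi> x * u x / h x"
    define U where "U = \<psi>' x * u x"
    define V where "V = \<psi> x * (grad u x \<bullet> e)"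
    have nx: "norm (x - p) \<le> \<rho>" using True by (simp add: K_def dist_norm norm_minus_commute)
    have gX: "g x = 2 * U * X + 2 * V * X - X\<^sup>2"
      by (simp add: g_def X_def U_def V_def power2_eq_square mult_ac)
    \<comment> \<open>Each of the two cross terms costs a quarter of X^2, so half of it survives.
      Together with |\<psi>'| <= 2 \<rho> and \<psi> <= \<rho>^2 this produces the constants 32
      \<rho>^2 and 8 \<rho>^4.\<close>
    have "0 \<le> (X / 2 - 2 * U)\<^sup>2" "0 \<le> (X / 2 - 2 * V)\<^sup>2" by simp_all
    then have 1: "X\<^sup>2 \<le> 8 * U\<^sup>2 + 8 * V\<^sup>2 - 2 * g x"
      unfolding gX by (simp add: power2_eq_square algebra_simps)
    have "\<bar>\<psi>' x\<bar> \<le> 2 * \<rho>"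
      using Cauchy_Schwarz_ineq2[of "x - p" e] nx e by (simp add: \<psi>'_def)
    then have "(\<psi>' x)\<^sup>2 \<le> (2 * \<rho>)\<^sup>2" using power_mono[of "\<bar>\<psi>' x\<bar>" "2 * \<rho>" 2] by simp
    then have 2: "U\<^sup>2 \<le> 4 * \<rho>\<^sup>2 * (u x)\<^sup>2"
      unfolding U_def power_mult_distrib by (intro mult_right_mono) auto
    have "0 \<le> \<psi> x" "\<psi> x \<le> \<rho>\<^sup>2" by (auto simp: \<psi>_def)
    moreover have "\<bar>grad u x \<bullet> e\<bar> \<le> norm (grad u x)"
      using Cauchy_Schwarz_ineq2[of "grad u x" e] e by simp
    ultimately have "\<bar>V\<bar> \<le> \<rho>\<^sup>2 * norm (grad u x)"
      unfolding V_def abs_mult by (intro mult_mono) auto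
    then have "V\<^sup>2 \<le> (\<rho>\<^sup>2 * norm (grad u x))\<^sup>2" using power_mono[of "\<bar>V\<bar>" _ 2] by fastforce
    then have "V\<^sup>2 \<le> \<rho>^4 * (norm (grad u x))\<^sup>2" by (simp add: power_mult_distrib power_mult[symmetric])
    with 1 2 show ?thesis unfolding X_def by linarith
  next
    case False
    show ?thesis unfolding X0[OF False] g0[OF False] by simp
  qed
  have "(LINT x|lborel. (\<psi> x * u x / h x)\<^sup>2) \<le>
      (LINT x|lborel. 32 * \<rho>\<^sup>2 * (u x)\<^sup>2 + 8 * \<rho>^4 * (norm (grad u x))\<^sup>2 - 2 * g x)"
    by (intro integral_mono pt int Bochner_Integration.integrable_add Bochner_Integration.integrable_diff integrable_mult_right integrable_square[OF u] integrable_grad_square[OF u])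
  also have "\<dots> = 32 * \<rho>\<^sup>2 * (LINT x|lborel. (u x)\<^sup>2) + 8 * \<rho>^4 * (LINT x|lborel. (norm (grad u x))\<^sup>2)"
    using int integrable_square[OF u] integrable_grad_square[OF u] \<open>integral\<^sup>L lborel g = 0\<close> by simp
  finally show "(LINT x|lborel. (\<psi> x * u x / h x)\<^sup>2) \<le>
      32 * \<rho>\<^sup>2 * (LINT x|lborel. (u x)\<^sup>2) + 8 * \<rho>^4 * (LINT x|lborel. (norm (grad u x))\<^sup>2)" .
qed

section \<open>Hardy's inequality on Lipschitz domains\<close>

lemma infdist_frontier_pos:
  fixes \<Omega> :: "'a::metric_space set"
  assumes "open \<Omega>" "frontier \<Omega> \<noteq> {}" "x \<in> \<Omega>"
  shows "0 < bdist \<Omega> x"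
  unfolding bdist_def
  using assms frontier_disjoint_eq[of \<Omega>] by (intro infdist_pos_not_in_closed) auto

lemma bounded_domain_frontier:
  fixes \<Omega> :: "'a::euclidean_space set"
  assumes "is_domain \<Omega>" "bounded \<Omega>"
  shows "open \<Omega>" "frontier \<Omega> \<noteq> {}" "compact (frontier \<Omega>)"
proof -
  have "\<Omega> \<noteq> UNIV" using assms(2) not_bounded_UNIV by auto
  then show "open \<Omega>" "frontier \<Omega> \<noteq> {}" "compact (frontier \<Omega>)"
    using assms frontier_not_empty[of \<Omega>] by (auto simp: is_domain_def)
qed

lemma continuous_on_bdist: "continuous_on S (bdist \<Omega>)"
  unfolding bdist_def[abs_def] by (intro continuous_intros)

text \<open>The height h above the graph grows with unit speed along the preimage e of the vertical
  vector, so \<open>local_hardy\<close> applies to it, and \<open>poincare\<close> removes the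
  remaining u^2 term. The estimate is phrased through a globally integrable majorant X instead of an
  integral over the ball, so that finitely many of them can be added pointwise over a cover.\<close>

lemma hardy_near_boundary_point:
  fixes \<Omega> :: "((real ^ 'n) \<times> real) set"
  assumes dom: "is_domain \<Omega>" "bounded \<Omega>" and lip: "lipschitz_boundary \<Omega>" and p: "p \<in> frontier \<Omega>"
  shows "\<exists>s>0. \<exists>C. \<forall>u\<in>test_functions \<Omega>. \<exists>X. integrable lborel X \<and> (\<forall>x. 0 \<le> X x) \<and>
    (\<forall>x\<in>ball p s. (u x / bdist \<Omega> x)\<^sup>2 \<le> X x) \<and>
    (LINT x|lborel. X x) \<le> C * (LINT x|lborel. (norm (grad u x))\<^sup>2)"
proof -
  note fr = bounded_domain_frontier[OF dom]
  obtain r T \<phi> L where r: "r > 0" and T: "orthogonal_transformation T"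
    and \<phi>: "L-lipschitz_on UNIV (\<phi> :: real ^ 'n \<Rightarrow> real)"
    and \<Omega>: "\<Omega> \<inter> ball p r = {x \<in> ball p r. snd (T x) > \<phi> (fst (T x))}"
    using lip p unfolding lipschitz_boundary_def by blast
  have L: "L \<ge> 0" using \<phi> by (rule lipschitz_on_nonneg)
  have lT: "linear T" using T by (rule orthogonal_transformation_linear)
  then have cT: "continuous_on UNIV T" by (simp add: linear_continuous_on linear_linear)
  obtain e where e: "T e = (0, 1)" using orthogonal_transformation_surj[OF T] by (metis surjD)
  have ne: "norm e = 1" using orthogonal_transformation_norm[OF T, of e] e by (simp add: norm_Pair)
  define h where "h x = snd (T x) - \<phi> (fst (T x))" for x
  have ch: "continuous_on UNIV h" unfolding h_def
    by (intro continuous_intros cT continuous_on_compose2[OF lipschitz_on_continuous_on[OF \<phi>]]) auto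
  have he: "h (x + s *\<^sub>R e) = h x + s" for x s
    using lT e by (simp add: h_def linear_add linear_scale)
  have pos: "0 < h x" if "x \<in> \<Omega>" "dist p x \<le> r / 2" for x
  proof -
    have "x \<in> \<Omega> \<inter> ball p r" using that r by auto
    then show ?thesis unfolding \<Omega> by (simp add: h_def)
  qed
  \<comment> \<open>The boundary point z nearest to x is still in the ball around p, since |x - z|
    <= |x - p| < r/4. There h is at most 0, and h has Lipschitz constant 1 + L.\<close>
  have h_le: "h x \<le> (1 + L) * bdist \<Omega> x" if "x \<in> \<Omega>" "dist p x < r / 4" for x
  proof -
    obtain z where z: "z \<in> frontier \<Omega>" "infdist x (frontier \<Omega>) = dist x z"
      using infdist_attains_inf[OF frontier_closed fr(2), of x] by blast
    have "dist x z \<le> dist x p" using infdist_le[OF p, of x] z by simp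
    then have "z \<in> ball p r" using that r dist_triangle[of p z x] by (simp add: dist_commute)
    moreover have "z \<notin> \<Omega>" using z fr(1) frontier_disjoint_eq[of \<Omega>] by auto
    moreover have "z \<in> \<Omega>" if "h z > 0" "z \<in> ball p r"
    proof -
      have "z \<in> \<Omega> \<inter> ball p r" unfolding \<Omega> using that by (simp add: h_def)
      then show ?thesis by simp
    qed
    ultimately have "h z \<le> 0" by fastforce
    then have "h x \<le> (snd (T x) - snd (T z)) + (\<phi> (fst (T z)) - \<phi> (fst (T x)))" by (simp add: h_def)
    also have "\<dots> \<le> dist (T x) (T z) + L * dist (T x) (T z)"
    proof (intro add_mono)
      show "snd (T x) - snd (T z) \<le> dist (T x) (T z)"
        using dist_snd_le[of "T x" "T z"] by (simp add: dist_real_def)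
      have "\<phi> (fst (T z)) - \<phi> (fst (T x)) \<le> L * dist (fst (T x)) (fst (T z))"
        using lipschitz_onD[OF \<phi>, of "fst (T x)" "fst (T z)"] by (simp add: dist_real_def)
      also have "\<dots> \<le> L * dist (T x) (T z)" using L by (intro mult_left_mono dist_fst_le)
      finally show "\<phi> (fst (T z)) - \<phi> (fst (T x)) \<le> L * dist (T x) (T z)" .
    qed
    also have "dist (T x) (T z) = dist x z"
      using orthogonal_transformation_norm[OF T, of "x - z"] lT by (simp add: dist_norm linear_diff)
    finally show ?thesis using z by (simp add: bdist_def algebra_simps)
  qed
  obtain R where "\<forall>x\<in>\<Omega>. norm x \<le> R" using dom(2) unfolding bounded_iff by blast
  then have R: "\<Omega> \<subseteq> cball 0 R" by auto
  define \<rho> where "\<rho> = r / 2"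
  define \<psi> where "\<psi> x = max 0 (\<rho>\<^sup>2 - (norm (x - p))\<^sup>2)" for x
  \<comment> \<open>On the ball of radius r/4 the cut-off is at least r^2/4 - r^2/16 = 3 r^2/16; the
    constant c divides by this and pays for replacing 1/h by 1/delta.\<close>
  define c where "c = ((1 + L) * (16 / (3 * r\<^sup>2)))\<^sup>2"
  have c0: "c \<ge> 0" by (simp add: c_def)
  define C where "C = c * (32 * \<rho>\<^sup>2 * (4 * R\<^sup>2) + 8 * \<rho>^4)"
  show ?thesis
  proof (rule exI[of _ "r / 4"], intro conjI exI[of _ C] ballI)
    show "r / 4 > 0" using r by simp
    fix u assume u: "u \<in> test_functions \<Omega>"
    define X where "X x = (\<psi> x * u x / h x)\<^sup>2" for x
    have 1: "integrable lborel X" "(LINT x|lborel. X x) \<le>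
        32 * \<rho>\<^sup>2 * (LINT x|lborel. (u x)\<^sup>2) + 8 * \<rho>^4 * (LINT x|lborel. (norm (grad u x))\<^sup>2)"
      using local_hardy[OF u ch he ne, of p \<rho>] pos r unfolding X_def \<psi>_def \<rho>_def by auto
    have "(LINT x|lborel. X x) \<le> 32 * \<rho>\<^sup>2 * (4 * R\<^sup>2 * (LINT x|lborel. (norm (grad u x))\<^sup>2))
        + 8 * \<rho>^4 * (LINT x|lborel. (norm (grad u x))\<^sup>2)"
      using poincare[OF u R] by (intro order_trans[OF 1(2)] add_right_mono mult_left_mono) auto
    then have "c * (LINT x|lborel. X x) \<le> c * (32 * \<rho>\<^sup>2 * (4 * R\<^sup>2 * (LINT x|lborel. (norm (grad u x))\<^sup>2))
        + 8 * \<rho>^4 * (LINT x|lborel. (norm (grad u x))\<^sup>2))" using c0 by (rule mult_left_mono)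
    then have 2: "(LINT x|lborel. c * X x) \<le> C * (LINT x|lborel. (norm (grad u x))\<^sup>2)"
      by (simp add: C_def algebra_simps)
    have 3: "(u x / bdist \<Omega> x)\<^sup>2 \<le> c * X x" if "x \<in> ball p (r / 4)" for x
    proof (cases "x \<in> \<Omega>")
      case True
      have \<delta>: "bdist \<Omega> x > 0" by (rule infdist_frontier_pos[OF fr(1,2) True])
      have hx: "0 < h x" "h x \<le> (1 + L) * bdist \<Omega> x" using True that pos[of x] h_le[of x] r by auto
      have "norm (x - p) \<le> r / 4" using that by (simp add: dist_norm norm_minus_commute)
      then have "(norm (x - p))\<^sup>2 \<le> (r / 4)\<^sup>2" by (intro power_mono) auto
      then have "3 * r\<^sup>2 / 16 \<le> \<rho>\<^sup>2 - (norm (x - p))\<^sup>2" by (simp add: \<rho>_def power_divide)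
      then have "3 * r\<^sup>2 / 16 \<le> \<psi> x" by (simp add: \<psi>_def le_max_iff_disj)
      then have "1 \<le> 16 / (3 * r\<^sup>2) * \<psi> x" using r by (simp add: field_simps)
      moreover have "1 / bdist \<Omega> x \<le> (1 + L) / h x" using hx \<delta> by (simp add: field_simps)
      ultimately have "1 * (1 / bdist \<Omega> x) \<le> (16 / (3 * r\<^sup>2) * \<psi> x) * ((1 + L) / h x)"
        using \<delta> by (intro mult_mono) auto
      then have "\<bar>u x\<bar> * (1 / bdist \<Omega> x) \<le> \<bar>u x\<bar> * ((16 / (3 * r\<^sup>2) * \<psi> x) * ((1 + L) / h x))"
        by (intro mult_left_mono) auto
      then have "(\<bar>u x\<bar> * (1 / bdist \<Omega> x))\<^sup>2 \<le> (\<bar>u x\<bar> * ((16 / (3 * r\<^sup>2) * \<psi> x) * ((1 + L) / h x)))\<^sup>2"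
        using \<delta> by (intro power_mono) auto
      moreover have "(\<bar>a\<bar> * ((A * b) * (M / y)))\<^sup>2 = (M * A)\<^sup>2 * (b * a / y)\<^sup>2" for a A b M y :: real
        by (simp add: power_mult_distrib power_divide)
      moreover have "(\<bar>a\<bar> * (1 / y))\<^sup>2 = (a / y)\<^sup>2" for a y :: real
        by (simp add: power_divide)
      ultimately show ?thesis unfolding X_def c_def by metis
    next
      case False
      then have "u x = 0" using zero_outside_support[of x u] support_subset[OF u] by auto
      then show ?thesis using c0 by (simp add: X_def)
    qed
    have i: "integrable lborel (\<lambda>x. c * X x)" using 1(1) by simp
    have n: "\<forall>x. 0 \<le> c * X x" using c0 by (simp add: X_def)
    have b: "\<forall>x\<in>ball p (r / 4). (u x / bdist \<Omega> x)\<^sup>2 \<le> c * X x" using 3 by blast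
    show "\<exists>X. integrable lborel X \<and> (\<forall>x. 0 \<le> X x) \<and> (\<forall>x\<in>ball p (r / 4). (u x / bdist \<Omega> x)\<^sup>2 \<le> X x) \<and>
        (LINT x|lborel. X x) \<le> C * (LINT x|lborel. (norm (grad u x))\<^sup>2)"
      by (intro exI[of _ "\<lambda>x. c * X x"] conjI i n b 2)
  qed
qed

lemma integrable_power_quotient:
  fixes \<Omega> :: "'a::euclidean_space set"
  assumes u: "u \<in> test_functions \<Omega>" and \<Omega>: "open \<Omega>" "frontier \<Omega> \<noteq> {}" and k: "k > 0"
  shows "integrable lborel (\<lambda>x. \<bar>u x\<bar> ^ k / bdist \<Omega> x ^ j)"
    and "continuous_on UNIV (\<lambda>x. \<bar>u x\<bar> ^ k / bdist \<Omega> x ^ j)"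
proof -
  have "bdist \<Omega> x ^ j \<noteq> 0" if "x \<in> \<Omega>" for x
    using infdist_frontier_pos[OF \<Omega> that] by simp
  then have c: "continuous_on \<Omega> (\<lambda>x. \<bar>u x\<bar> ^ k / bdist \<Omega> x ^ j)"
    by (intro continuous_intros continuous_test_function[OF u] continuous_on_bdist) blast
  have z: "\<bar>u x\<bar> ^ k / bdist \<Omega> x ^ j = 0" if "x \<notin> support u" for x
    using zero_outside_support[OF that] k by simp
  show "integrable lborel (\<lambda>x. \<bar>u x\<bar> ^ k / bdist \<Omega> x ^ j)" "continuous_on UNIV (\<lambda>x. \<bar>u x\<bar> ^ k / bdist \<Omega> x ^ j)"
    using integrable_on_support[OF u \<Omega>(1) support_subset[OF u] c z] by blast+
qed

theorem hardy:
  fixes \<Omega> :: "((real ^ 'n) \<times> real) set"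
  assumes dom: "is_domain \<Omega>" "bounded \<Omega>" and lip: "lipschitz_boundary \<Omega>"
  obtains C where "C > 0" "\<And>u. u \<in> test_functions \<Omega> \<Longrightarrow>
    (LINT x|lborel. (u x)\<^sup>2 / (bdist \<Omega> x)\<^sup>2) \<le> C * (LINT x|lborel. (norm (grad u x))\<^sup>2)"
proof -
  note fr = bounded_domain_frontier[OF dom]
  define good where "good p s C \<longleftrightarrow> (\<forall>u\<in>test_functions \<Omega>. \<exists>X. integrable lborel X \<and> (\<forall>x. 0 \<le> X x) \<and>
    (\<forall>x\<in>ball p s. (u x / bdist \<Omega> x)\<^sup>2 \<le> X x) \<and>
    (LINT x|lborel. X x) \<le> C * (LINT x|lborel. (norm (grad u x))\<^sup>2))" for p s C
  have "\<forall>p\<in>frontier \<Omega>. \<exists>s C. s > 0 \<and> good p s C"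
    using hardy_near_boundary_point[OF dom lip, folded good_def] by blast
  then obtain s C where sC: "\<And>p. p \<in> frontier \<Omega> \<Longrightarrow> s p > 0" "\<And>p. p \<in> frontier \<Omega> \<Longrightarrow> good p (s p) (C p)"
    by metis
  obtain F where F: "F \<subseteq> frontier \<Omega>" "finite F" "frontier \<Omega> \<subseteq> (\<Union>p\<in>F. ball p (s p))"
  proof (rule compactE_image[OF fr(3), of "frontier \<Omega>" "\<lambda>p. ball p (s p)"])
    show "frontier \<Omega> \<subseteq> (\<Union>p\<in>frontier \<Omega>. ball p (s p))" using sC(1) by force
  qed auto
  \<comment> \<open>What the finitely many balls leave over is compact and free of boundary points.
    There delta is bounded below and the Poincare inequality suffices.\<close>
  define K where "K = closure \<Omega> - (\<Union>p\<in>F. ball p (s p))"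
  have K: "compact K" unfolding K_def using dom(2)
    by (intro compact_diff open_UN) (auto simp: compact_closure)
  obtain d where d: "d > 0" "\<And>x. x \<in> K \<Longrightarrow> d \<le> bdist \<Omega> x"
  proof (cases "K = {}")
    case False
    obtain y where y: "y \<in> K" "\<And>x. x \<in> K \<Longrightarrow> bdist \<Omega> y \<le> bdist \<Omega> x"
      using continuous_attains_inf[OF K False continuous_on_bdist[of K \<Omega>]] by blast
    have "y \<notin> frontier \<Omega>" using y(1) F(3) unfolding K_def by auto
    then have "bdist \<Omega> y > 0" unfolding bdist_def using fr by (intro infdist_pos_not_in_closed) auto
    then show ?thesis using y that by blast
  qed (use that[of 1] in auto)
  obtain R where "\<forall>x\<in>\<Omega>. norm x \<le> R" using dom(2) unfolding bounded_iff by blast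
  then have R: "\<Omega> \<subseteq> cball 0 R" by auto
  define C' where "C' = (\<Sum>p\<in>F. C p) + 4 * R\<^sup>2 / d\<^sup>2"
  have main: "(LINT x|lborel. (u x)\<^sup>2 / (bdist \<Omega> x)\<^sup>2) \<le> C' * (LINT x|lborel. (norm (grad u x))\<^sup>2)"
    if u: "u \<in> test_functions \<Omega>" for u
  proof -
    have g: "good p (s p) (C p)" if "p \<in> F" for p using sC(2) that F(1) by blast
    have "\<forall>p\<in>F. \<exists>X. integrable lborel X \<and> (\<forall>x. 0 \<le> X x) \<and>
        (\<forall>x\<in>ball p (s p). (u x / bdist \<Omega> x)\<^sup>2 \<le> X x) \<and>
        (LINT x|lborel. X x) \<le> C p * (LINT x|lborel. (norm (grad u x))\<^sup>2)"
      using g[unfolded good_def, rule_format, OF _ u] by simp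
    from bchoice[OF this] obtain X where X: "\<And>p. p \<in> F \<Longrightarrow> integrable lborel (X p)" "\<And>p x. p \<in> F \<Longrightarrow> 0 \<le> X p x"
      "\<And>p x. p \<in> F \<Longrightarrow> x \<in> ball p (s p) \<Longrightarrow> (u x / bdist \<Omega> x)\<^sup>2 \<le> X p x"
      "\<And>p. p \<in> F \<Longrightarrow> (LINT x|lborel. X p x) \<le> C p * (LINT x|lborel. (norm (grad u x))\<^sup>2)"
      by blast
    have pt: "(u x)\<^sup>2 / (bdist \<Omega> x)\<^sup>2 \<le> (\<Sum>p\<in>F. X p x) + (u x)\<^sup>2 / d\<^sup>2" for x
    proof (cases "x \<in> \<Omega>")
      case True
      show ?thesis
      proof (cases "x \<in> (\<Union>p\<in>F. ball p (s p))")
        case True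
        then obtain p where p: "p \<in> F" "x \<in> ball p (s p)" by auto
        have "X p x \<le> (\<Sum>p\<in>F. X p x)"
          by (rule member_le_sum) (use X(2) F(2) p in auto)
        with X(3)[OF p] have "(u x / bdist \<Omega> x)\<^sup>2 \<le> (\<Sum>p\<in>F. X p x)" by linarith
        then show ?thesis by (simp add: power_divide add_increasing2)
      next
        case False
        with \<open>x \<in> \<Omega>\<close> have "x \<in> K" using closure_subset by (auto simp: K_def)
        then have "d\<^sup>2 \<le> (bdist \<Omega> x)\<^sup>2" using d by (intro power_mono) auto
        then have "(u x)\<^sup>2 / (bdist \<Omega> x)\<^sup>2 \<le> (u x)\<^sup>2 / d\<^sup>2" using d by (intro divide_left_mono) (auto intro!: mult_pos_pos)
        moreover have "0 \<le> (\<Sum>p\<in>F. X p x)" by (intro sum_nonneg X(2))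
        ultimately show ?thesis by linarith
      qed
    next
      case False
      then have "u x = 0" using zero_outside_support[of x u] support_subset[OF u] by auto
      then show ?thesis by (simp add: X(2) sum_nonneg)
    qed
    have i1: "integrable lborel (\<lambda>x. (u x)\<^sup>2 / (bdist \<Omega> x)\<^sup>2)"
      using integrable_power_quotient(1)[OF u fr(1,2), of 2 2] by simp
    have "(LINT x|lborel. (u x)\<^sup>2 / (bdist \<Omega> x)\<^sup>2) \<le> (LINT x|lborel. (\<Sum>p\<in>F. X p x) + (u x)\<^sup>2 / d\<^sup>2)"
      by (intro integral_mono pt i1 Bochner_Integration.integrable_add Bochner_Integration.integrable_sum X integrable_divide integrable_square[OF u])
    also have "\<dots> = (\<Sum>p\<in>F. LINT x|lborel. X p x) + (LINT x|lborel. (u x)\<^sup>2) / d\<^sup>2"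
      using X(1) integrable_square[OF u] by (simp add: Bochner_Integration.integral_sum)
    also have "\<dots> \<le> (\<Sum>p\<in>F. C p * (LINT x|lborel. (norm (grad u x))\<^sup>2)) + 4 * R\<^sup>2 * (LINT x|lborel. (norm (grad u x))\<^sup>2) / d\<^sup>2"
      by (intro add_mono sum_mono X(4) divide_right_mono poincare[OF u R]) auto
    also have "\<dots> = C' * (LINT x|lborel. (norm (grad u x))\<^sup>2)"
      by (simp add: C'_def sum_distrib_right algebra_simps)
    finally show ?thesis .
  qed
  show ?thesis
  proof (rule that[of "max 1 C'"])
    fix u assume u: "u \<in> test_functions \<Omega>"
    have "0 \<le> (LINT x|lborel. (norm (grad u x))\<^sup>2)" by simp
    then show "(LINT x|lborel. (u x)\<^sup>2 / (bdist \<Omega> x)\<^sup>2) \<le> max 1 C' * (LINT x|lborel. (norm (grad u x))\<^sup>2)"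
      by (intro order_trans[OF main[OF u]] mult_right_mono) auto
  qed simp
qed

section \<open>The Gagliardo-Nirenberg inequality\<close>

lemma young_powr:
  fixes a b \<theta> :: real
  assumes "0 \<le> a" "0 \<le> b" "0 < \<theta>" "\<theta> < 1"
  shows "a powr \<theta> * b powr (1 - \<theta>) \<le> \<theta> * a + (1 - \<theta>) * b"
proof (cases "a = 0 \<or> b = 0")
  case False
  then show ?thesis using Youngs_inequality_0[of \<theta> "1-\<theta>" a b] assms by auto
qed (use assms in auto)

text \<open>Young's inequality is applied to f/A and g/B. Upper bounds A and B stand in place of the
  integrals themselves, so that estimates can be inserted directly and no finiteness has to be
  argued; if a bound is 0, the corresponding function vanishes almost everywhere.\<close>

lemma nn_integral_Holder:
  fixes f g :: "'a \<Rightarrow> real"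
  assumes [measurable]: "f \<in> borel_measurable M" "g \<in> borel_measurable M"
    and nonneg: "\<And>x. 0 \<le> f x" "\<And>x. 0 \<le> g x" and \<theta>: "0 < \<theta>" "\<theta> < 1"
    and A: "(\<integral>\<^sup>+x. f x \<partial>M) \<le> ennreal A" "0 \<le> A"
    and B: "(\<integral>\<^sup>+x. g x \<partial>M) \<le> ennreal B" "0 \<le> B"
  shows "(\<integral>\<^sup>+x. f x powr \<theta> * g x powr (1 - \<theta>) \<partial>M) \<le> ennreal (A powr \<theta> * B powr (1 - \<theta>))"
proof (cases "A = 0 \<or> B = 0")
  case True
  moreover have z: "ennreal (f x) = 0 \<longleftrightarrow> f x = 0" "ennreal (g x) = 0 \<longleftrightarrow> g x = 0" for x
    using nonneg[of x] by auto
  ultimately have "(AE x in M. f x = 0) \<or> (AE x in M. g x = 0)"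
  proof (elim disjE)
    assume "A = 0"
    then have "(\<integral>\<^sup>+x. f x \<partial>M) = 0" using A by simp
    then have "AE x in M. ennreal (f x) = 0" by (subst (asm) nn_integral_0_iff_AE) auto
    then show ?thesis by (simp add: z)
  next
    assume "B = 0"
    then have "(\<integral>\<^sup>+x. g x \<partial>M) = 0" using B by simp
    then have "AE x in M. ennreal (g x) = 0" by (subst (asm) nn_integral_0_iff_AE) auto
    then show ?thesis by (simp add: z)
  qed
  then have "AE x in M. ennreal (f x powr \<theta> * g x powr (1 - \<theta>)) = 0"
    by (auto elim!: eventually_mono)
  then have "(\<integral>\<^sup>+x. f x powr \<theta> * g x powr (1 - \<theta>) \<partial>M) = 0"
    by (subst nn_integral_0_iff_AE) auto
  then show ?thesis by simp
next
  case False
  then have AB: "A > 0" "B > 0" using A B by auto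
  let ?C = "A powr \<theta> * B powr (1 - \<theta>)"
  have pt: "f x powr \<theta> * g x powr (1 - \<theta>) \<le> ?C * (\<theta> / A) * f x + ?C * ((1 - \<theta>) / B) * g x" for x
  proof -
    have "f x powr \<theta> * g x powr (1 - \<theta>) = ?C * ((f x / A) powr \<theta> * (g x / B) powr (1 - \<theta>))"
      using AB nonneg by (simp add: powr_divide)
    also have "\<dots> \<le> ?C * (\<theta> * (f x / A) + (1 - \<theta>) * (g x / B))"
      using AB nonneg \<theta> by (intro mult_left_mono young_powr) auto
    finally show ?thesis by (simp add: algebra_simps)
  qed
  have c: "0 \<le> ?C * (\<theta> / A)" "0 \<le> ?C * ((1 - \<theta>) / B)" using AB \<theta> by auto
  have pt': "ennreal (f x powr \<theta> * g x powr (1 - \<theta>))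
      \<le> ennreal (?C * (\<theta> / A)) * f x + ennreal (?C * ((1 - \<theta>) / B)) * g x" for x
    using ennreal_leI[OF pt[of x]] c nonneg[of x]
    by (subst (asm) ennreal_plus) (auto simp: ennreal_mult simp del: times_divide_eq_right times_divide_eq_left)
  have "(\<integral>\<^sup>+x. f x powr \<theta> * g x powr (1 - \<theta>) \<partial>M)
      \<le> (\<integral>\<^sup>+x. ennreal (?C * (\<theta> / A)) * f x + ennreal (?C * ((1 - \<theta>) / B)) * g x \<partial>M)"
    by (intro nn_integral_mono pt')
  also have "\<dots> = ennreal (?C * (\<theta> / A)) * (\<integral>\<^sup>+x. f x \<partial>M) + ennreal (?C * ((1 - \<theta>) / B)) * (\<integral>\<^sup>+x. g x \<partial>M)"
    by (subst nn_integral_add) (auto simp: nn_integral_cmult)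
  also have "\<dots> \<le> ennreal (?C * (\<theta> / A)) * ennreal A + ennreal (?C * ((1 - \<theta>) / B)) * ennreal B"
    using A B by (intro add_mono mult_left_mono) auto
  also have "\<dots> = ennreal (?C * (\<theta> / A) * A + ?C * ((1 - \<theta>) / B) * B)"
    unfolding ennreal_plus[OF mult_nonneg_nonneg[OF c(1) A(2)] mult_nonneg_nonneg[OF c(2) B(2)]]
      ennreal_mult[OF c(1) A(2)] ennreal_mult[OF c(2) B(2)] ..
  also have "?C * (\<theta> / A) * A + ?C * ((1 - \<theta>) / B) * B = ?C" using AB by (simp add: field_simps)
  finally show ?thesis .
qed

section \<open>Slicing argument for the L1 Sobolev inequality\<close>

abbreviation lborel_PiM :: "'i set \<Rightarrow> ('i \<Rightarrow> real) measure" where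
  "lborel_PiM I \<equiv> Pi\<^sub>M I (\<lambda>_. lborel)"

text \<open>Here w plays the part of |W| and g that of |grad W| for a compactly supported W: the
  value at a point is at most the integral of the derivative along each coordinate line through it.
  No derivative is mentioned, so the property passes to slices as it stands.\<close>

definition line_dominated :: "'i set \<Rightarrow> (('i \<Rightarrow> real) \<Rightarrow> real) \<Rightarrow> (('i \<Rightarrow> real) \<Rightarrow> real) \<Rightarrow> bool" where
  "line_dominated I w g \<longleftrightarrow> w \<in> borel_measurable (lborel_PiM I) \<and> g \<in> borel_measurable (lborel_PiM I) \<and>
     (\<forall>x. 0 \<le> w x) \<and> (\<forall>x. 0 \<le> g x) \<and>
     (\<forall>x\<in>space (lborel_PiM I). \<forall>i\<in>I. ennreal (w x) \<le> (\<integral>\<^sup>+s. g (x(i := s)) \<partial>lborel))"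

interpretation prod_lborel: product_sigma_finite "\<lambda>_. lborel :: real measure"
  by standard

lemma line_dominated_slice:
  assumes "line_dominated (insert i I) w g" "i \<notin> I"
  shows "line_dominated I (\<lambda>x. w (x(i := t))) (\<lambda>x. g (x(i := t)))"
proof -
  have m: "(\<lambda>x. x(i := t)) \<in> lborel_PiM I \<rightarrow>\<^sub>M lborel_PiM (insert i I)"
    by (rule measurable_fun_upd[where J=I]) auto
  have "ennreal (w (x(i := t))) \<le> (\<integral>\<^sup>+s. g (x(j := s, i := t)) \<partial>lborel)"
    if "x \<in> space (lborel_PiM I)" "j \<in> I" for x j
  proof -
    have "x(i := t) \<in> space (lborel_PiM (insert i I))"
      using that by (auto simp: space_PiM PiE_def extensional_def)
    then have "ennreal (w (x(i := t))) \<le> (\<integral>\<^sup>+s. g ((x(i := t))(j := s)) \<partial>lborel)"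
      using assms that unfolding line_dominated_def by blast
    moreover have "j \<noteq> i" using that assms by auto
    ultimately show ?thesis by (simp add: fun_upd_twist)
  qed
  moreover have "(\<lambda>x. w (x(i := t))) \<in> borel_measurable (lborel_PiM I)" "(\<lambda>x. g (x(i := t))) \<in> borel_measurable (lborel_PiM I)"
    using assms m unfolding line_dominated_def by (auto intro: measurable_compose[OF m])
  ultimately show ?thesis using assms unfolding line_dominated_def by blast
qed

text \<open>An intermediate inequality between the \<open>L\<^sup>1\<close> norm and the Sobolev norm, chosen because it is
  also meaningful for one variable, where the Sobolev exponent is infinite: this starts the induction
  on the number of variables.\<close>

definition slice_ineq :: "'i set \<Rightarrow> bool" where
  "slice_ineq I \<longleftrightarrow> (\<forall>w g A B. line_dominated I w g \<longrightarrow> 0 \<le> A \<longrightarrow> 0 \<le> B \<longrightarrow>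
     (\<integral>\<^sup>+x. w x \<partial>lborel_PiM I) \<le> ennreal A \<longrightarrow> (\<integral>\<^sup>+x. g x \<partial>lborel_PiM I) \<le> ennreal B \<longrightarrow>
     (\<integral>\<^sup>+x. w x powr (1 + 1 / card I) \<partial>lborel_PiM I) \<le> ennreal (A powr (1 / card I) * B))"

text \<open>Slice at x_i = t. The domination along the i-th direction, integrated over the slice,
  bounds the L1 norm of w on every slice by B. \<open>slice_ineq\<close> then bounds the integral
  over the slice by B^(1/N) times the integral b t of g over that slice, and integrating in t turns
  b t into another factor B.\<close>

lemma sobolev_step:
  assumes P: "slice_ineq I" and I: "finite I" "i \<notin> I" "I \<noteq> {}"
    and wg: "line_dominated (insert i I) w g" and B: "0 \<le> B" "(\<integral>\<^sup>+x. g x \<partial>lborel_PiM (insert i I)) \<le> ennreal B"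
  shows "(\<integral>\<^sup>+x. w x powr (1 + 1 / card I) \<partial>lborel_PiM (insert i I)) \<le> ennreal (B powr (1 + 1 / card I))"
proof -
  let ?N = "card I"
  have N: "?N > 0" using I by (simp add: card_gt_0_iff)
  have [measurable]: "w \<in> borel_measurable (lborel_PiM (insert i I))" "g \<in> borel_measurable (lborel_PiM (insert i I))"
    and pos: "\<And>x. 0 \<le> w x" "\<And>x. 0 \<le> g x"
    using wg by (auto simp: line_dominated_def)
  define b where "b t = (\<integral>\<^sup>+x. g (x(i := t)) \<partial>lborel_PiM I)" for t
  have sl: "line_dominated I (\<lambda>x. w (x(i := t))) (\<lambda>x. g (x(i := t)))" for t
    using line_dominated_slice[OF wg] I by auto
  have sm: "(\<lambda>x. w (x(i := t))) \<in> borel_measurable (lborel_PiM I)" "(\<lambda>x. g (x(i := t))) \<in> borel_measurable (lborel_PiM I)" for t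
    using sl[of t] by (auto simp: line_dominated_def)
  have gB: "(\<integral>\<^sup>+x. \<integral>\<^sup>+s. g (x(i := s)) \<partial>lborel \<partial>lborel_PiM I) \<le> ennreal B"
    using B(2) I by (subst (asm) prod_lborel.product_nn_integral_insert) auto
  have bB: "(\<integral>\<^sup>+t. b t \<partial>lborel) \<le> ennreal B"
    using B(2) I unfolding b_def by (subst (asm) prod_lborel.product_nn_integral_insert_rev) auto
  have wA: "(\<integral>\<^sup>+x. w (x(i := t)) \<partial>lborel_PiM I) \<le> ennreal B" for t
  proof -
    have "ennreal (w (x(i := t))) \<le> (\<integral>\<^sup>+s. g (x(i := s)) \<partial>lborel)" if "x \<in> space (lborel_PiM I)" for x
    proof -
      have "x(i := t) \<in> space (lborel_PiM (insert i I))"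
        using that by (auto simp: space_PiM PiE_def extensional_def)
      then have "ennreal (w (x(i := t))) \<le> (\<integral>\<^sup>+s. g ((x(i := t))(i := s)) \<partial>lborel)"
        using wg unfolding line_dominated_def by blast
      then show ?thesis by simp
    qed
    then have "(\<integral>\<^sup>+x. w (x(i := t)) \<partial>lborel_PiM I) \<le> (\<integral>\<^sup>+x. \<integral>\<^sup>+s. g (x(i := s)) \<partial>lborel \<partial>lborel_PiM I)"
      by (intro nn_integral_mono) auto
    with gB show ?thesis by (rule order_trans[rotated])
  qed
  have [measurable]: "b \<in> borel_measurable lborel"
    unfolding b_def 
    by (intro sigma_finite_measure.borel_measurable_nn_integral prod_lborel.sigma_finite I)
       (use I measurable_compose[OF measurable_add_dim[of i I "\<lambda>_. lborel"]] in \<open>auto simp: case_prod_beta'\<close>)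
  \<comment> \<open>\<open>slice_ineq\<close> takes real bounds, whereas b t may be infinite on a
    null set of t.\<close>
  have fin: "AE t in lborel. b t \<noteq> \<infinity>"
    using bB by (intro nn_integral_noteq_infinite) (auto simp: top_unique)
  have "(\<integral>\<^sup>+x. w x powr (1 + 1 / ?N) \<partial>lborel_PiM (insert i I)) = 
        (\<integral>\<^sup>+t. \<integral>\<^sup>+x. w (x(i := t)) powr (1 + 1 / ?N) \<partial>lborel_PiM I \<partial>lborel)"
    using I by (subst prod_lborel.product_nn_integral_insert_rev) auto
  also have "\<dots> \<le> (\<integral>\<^sup>+t. ennreal (B powr (1 / ?N)) * b t \<partial>lborel)"
  proof (rule nn_integral_mono_AE, use fin in eventually_elim)
    fix t assume "b t \<noteq> \<infinity>"
    then obtain c where c: "b t = ennreal c" "0 \<le> c" by (cases "b t") auto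
    then have "(\<integral>\<^sup>+x. w (x(i := t)) powr (1 + 1 / ?N) \<partial>lborel_PiM I) \<le> ennreal (B powr (1 / ?N) * c)"
      using P[unfolded slice_ineq_def, rule_format, OF sl B(1) c(2) wA] by (auto simp: b_def)
    then show "(\<integral>\<^sup>+x. w (x(i := t)) powr (1 + 1 / ?N) \<partial>lborel_PiM I) \<le> ennreal (B powr (1 / ?N)) * b t"
      using c by (simp add: ennreal_mult')
  qed
  also have "\<dots> = ennreal (B powr (1 / ?N)) * (\<integral>\<^sup>+t. b t \<partial>lborel)"
    by (rule nn_integral_cmult) simp
  also have "\<dots> \<le> ennreal (B powr (1 / ?N)) * ennreal B"
    using bB by (intro mult_left_mono) auto
  also have "\<dots> = ennreal (B powr (1 + 1 / ?N))"
    using B by (cases "B = 0") (auto simp: ennreal_mult'[symmetric] powr_add mult.commute)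
  finally show ?thesis .
qed

text \<open>For one variable, domination bounds w pointwise by B, so w^2 <= B w. For a further
  variable, \<open>sobolev_step\<close> yields the inequality of Sobolev type, and Hoelder's
  inequality interpolates it with the L1 bound.\<close>

lemma slice_ineq: "finite I \<Longrightarrow> I \<noteq> {} \<Longrightarrow> slice_ineq I"
proof (induction I rule: finite_ne_induct)
  case (singleton i)
  show ?case unfolding slice_ineq_def
  proof (intro allI impI)
    fix w g :: "('a \<Rightarrow> real) \<Rightarrow> real" and A B :: real
    assume wg: "line_dominated {i} w g" and "0 \<le> A" "0 \<le> B"
      and A: "(\<integral>\<^sup>+x. w x \<partial>lborel_PiM {i}) \<le> ennreal A" and B: "(\<integral>\<^sup>+x. g x \<partial>lborel_PiM {i}) \<le> ennreal B"
    have [measurable]: "w \<in> borel_measurable (lborel_PiM {i})" "g \<in> borel_measurable (lborel_PiM {i})"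
      and pos: "\<And>x. 0 \<le> w x" "\<And>x. 0 \<le> g x"
      using wg by (auto simp: line_dominated_def)
    have gi: "(\<integral>\<^sup>+s. g (x(i := s)) \<partial>lborel) \<le> ennreal B" if "x \<in> space (lborel_PiM {i})" for x
    proof -
      \<comment> \<open>Elements of the product over {i} are \<open>undefined\<close> off i, so
        after the update nothing of x is left.\<close>
      have e: "x(i := s) = (\<lambda>_. undefined)(i := s)" for s
        using that by (auto simp: space_PiM PiE_def extensional_def fun_eq_iff)
      have "(\<integral>\<^sup>+x. g x \<partial>lborel_PiM (insert i {})) = (\<integral>\<^sup>+s. g ((\<lambda>_. undefined)(i := s)) \<partial>lborel)"
        by (subst prod_lborel.product_nn_integral_insert) (auto simp: PiM_empty nn_integral_count_space_finite fun_upd_def)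
      then show ?thesis unfolding e using B by simp
    qed
    have wB: "w x \<le> B" if "x \<in> space (lborel_PiM {i})" for x
    proof -
      have "ennreal (w x) \<le> (\<integral>\<^sup>+s. g (x(i := s)) \<partial>lborel)"
        using wg that by (auto simp: line_dominated_def)
      with gi[OF that] have "ennreal (w x) \<le> ennreal B" by (rule order_trans[rotated])
      then show ?thesis using \<open>0 \<le> B\<close> by simp
    qed
    have "(\<integral>\<^sup>+x. w x powr (1 + 1 / card {i}) \<partial>lborel_PiM {i}) \<le> (\<integral>\<^sup>+x. ennreal B * w x \<partial>lborel_PiM {i})"
      using wB pos \<open>0 \<le> B\<close>
      by (intro nn_integral_mono) (auto simp: ennreal_mult'[symmetric] power2_eq_square intro!: ennreal_leI mult_right_mono)
    also have "\<dots> = ennreal B * (\<integral>\<^sup>+x. w x \<partial>lborel_PiM {i})"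
      by (rule nn_integral_cmult) simp
    also have "\<dots> \<le> ennreal B * ennreal A"
      using A by (intro mult_left_mono) auto
    finally show "(\<integral>\<^sup>+x. w x powr (1 + 1 / card {i}) \<partial>lborel_PiM {i}) \<le> ennreal (A powr (1 / card {i}) * B)"
      using \<open>0 \<le> A\<close> \<open>0 \<le> B\<close> by (simp add: ennreal_mult' mult.commute)
  qed
next
  case (insert i I)
  let ?N = "card I"
  have N: "real ?N > 0" using insert by (simp add: card_gt_0_iff)
  show ?case unfolding slice_ineq_def
  proof (intro allI impI)
    fix w g :: "('a \<Rightarrow> real) \<Rightarrow> real" and A B :: real
    assume wg: "line_dominated (insert i I) w g" and "0 \<le> A" "0 \<le> B"
      and A: "(\<integral>\<^sup>+x. w x \<partial>lborel_PiM (insert i I)) \<le> ennreal A" and B: "(\<integral>\<^sup>+x. g x \<partial>lborel_PiM (insert i I)) \<le> ennreal B"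
    have [measurable]: "w \<in> borel_measurable (lborel_PiM (insert i I))" "g \<in> borel_measurable (lborel_PiM (insert i I))"
      and pos: "\<And>x. 0 \<le> w x" "\<And>x. 0 \<le> g x"
      using wg by (auto simp: line_dominated_def)
    \<comment> \<open>With N variables before the step, \<theta> = 1/(N+1) satisfies (1 + 1/N)(1 -
      \<theta>) = 1. Hence the interpolated power of w is 1 + \<theta> and B enters with power
      exactly 1.\<close>
    define \<theta> where "\<theta> = 1 / real (card (insert i I))"
    have \<theta>: "0 < \<theta>" "\<theta> < 1" using N insert by (auto simp: \<theta>_def)
    have e: "(1 + 1 / ?N) * (1 - \<theta>) = 1" using N insert by (simp add: \<theta>_def field_simps add_nonneg_eq_0_iff)
    have "(\<integral>\<^sup>+x. w x powr (1 + 1 / ?N) \<partial>lborel_PiM (insert i I)) \<le> ennreal (B powr (1 + 1 / ?N))"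
      using sobolev_step[OF insert.IH insert(1) insert(3) insert(2) wg \<open>0 \<le> B\<close> B] .
    from nn_integral_Holder[OF _ _ _ _ \<theta> A \<open>0 \<le> A\<close> this]
    have "(\<integral>\<^sup>+x. w x powr \<theta> * (w x powr (1 + 1 / ?N)) powr (1 - \<theta>) \<partial>lborel_PiM (insert i I))
        \<le> ennreal (A powr \<theta> * (B powr (1 + 1 / ?N)) powr (1 - \<theta>))"
      using pos by simp
    moreover have "w x powr \<theta> * (w x powr (1 + 1 / ?N)) powr (1 - \<theta>) = w x powr (1 + \<theta>)" for x
      unfolding powr_powr e using pos(1)[of x] by (cases "w x = 0") (auto simp: powr_add mult.commute)
    moreover have "(B powr (1 + 1 / ?N)) powr (1 - \<theta>) = B"
      unfolding powr_powr e using \<open>0 \<le> B\<close> by simp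
    ultimately show "(\<integral>\<^sup>+x. w x powr (1 + 1 / card (insert i I)) \<partial>lborel_PiM (insert i I))
        \<le> ennreal (A powr (1 / card (insert i I)) * B)"
      by (simp add: \<theta>_def)
  qed
qed

text \<open>In coordinates Lebesgue measure is the product measure, and one basis vector is split
  off. The hypothesis speaks of line integrals of a majorant g, not of a gradient of w: this leaves
  room for proving the line bound at each x with a different auxiliary function, as is done with
  weights that are powers of the distance.\<close>

theorem gagliardo_nirenberg_lines:
  fixes w g :: "'a::euclidean_space \<Rightarrow> real"
  assumes [measurable]: "w \<in> borel_measurable borel" "g \<in> borel_measurable borel"
    and pos: "\<And>x. 0 \<le> w x" "\<And>x. 0 \<le> g x"
    and line: "\<And>x b. b \<in> Basis \<Longrightarrow> ennreal (w x) \<le> (\<integral>\<^sup>+s. g (x + s *\<^sub>R b) \<partial>lborel)"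
    and dim: "DIM('a) \<ge> 2" and B: "0 \<le> B" "(\<integral>\<^sup>+x. g x \<partial>lborel) \<le> ennreal B"
  shows "(\<integral>\<^sup>+x. w x powr (DIM('a) / (DIM('a) - 1)) \<partial>lborel) \<le> ennreal (B powr (DIM('a) / (DIM('a) - 1)))"
proof -
  obtain i :: 'a where i: "i \<in> Basis" using nonempty_Basis by blast
  define I where "I = Basis - {i}"
  have I: "insert i I = Basis" "finite I" "i \<notin> I" "card I = DIM('a) - 1"
    using i by (auto simp: I_def)
  then have "I \<noteq> {}" using dim by auto
  let ?S = "\<lambda>f. \<Sum>b\<in>Basis. f b *\<^sub>R (b::'a)"
  have lb: "lborel = distr (lborel_PiM Basis) borel ?S" by (rule lborel_eq)
  have [measurable]: "?S \<in> lborel_PiM Basis \<rightarrow>\<^sub>M borel" by measurable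
  have tr: "(\<integral>\<^sup>+x. f x \<partial>lborel) = (\<integral>\<^sup>+x. f (?S x) \<partial>lborel_PiM Basis)" if [measurable]: "f \<in> borel_measurable borel" for f :: "'a \<Rightarrow> ennreal"
    by (subst lb) (simp add: nn_integral_distr)
  have ld: "line_dominated Basis (\<lambda>x. w (?S x)) (\<lambda>x. g (?S x))"
    unfolding line_dominated_def
  proof (intro conjI ballI)
    fix x and b :: 'a assume b: "b \<in> Basis"
    have e: "?S (x(b := s)) = ?S x + (- x b + 1 * s) *\<^sub>R b" for s
    proof -
      have "?S (x(b := s)) = s *\<^sub>R b + (\<Sum>c\<in>Basis - {b}. x c *\<^sub>R c)"
        using b by (subst sum.remove[OF _ b]) (auto intro!: sum.cong)
      moreover have "?S x = x b *\<^sub>R b + (\<Sum>c\<in>Basis - {b}. x c *\<^sub>R c)"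
        using b by (subst sum.remove[OF _ b]) auto
      ultimately show ?thesis by (simp add: algebra_simps)
    qed
    have "ennreal (w (?S x)) \<le> (\<integral>\<^sup>+s. g (?S x + s *\<^sub>R b) \<partial>lborel)" by (rule line[OF b])
    also have "\<dots> = (\<integral>\<^sup>+s. g (?S x + (- x b + 1 * s) *\<^sub>R b) \<partial>lborel)"
      by (subst nn_integral_real_affine[where c=1 and t="- x b"]) auto
    finally show "ennreal (w (?S x)) \<le> (\<integral>\<^sup>+s. g (?S (x(b := s))) \<partial>lborel)" unfolding e .
  qed (use pos in auto)
  have "(\<integral>\<^sup>+x. w (?S x) powr (1 + 1 / card I) \<partial>lborel_PiM (insert i I)) \<le> ennreal (B powr (1 + 1 / card I))"
    by (rule sobolev_step[OF slice_ineq]) (use I \<open>I \<noteq> {}\<close> ld B tr in auto)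
  moreover have "1 + 1 / card I = DIM('a) / (DIM('a) - 1)"
    using dim I by (simp add: field_simps of_nat_diff)
  ultimately show ?thesis using I by (simp add: tr)
qed

text \<open>W vanishes at x - A e for large A, so W x is the integral of its derivative over the
  segment from there to x; the majorant g is then integrated over the whole line.\<close>

lemma line_bound:
  fixes W G g :: "'a::euclidean_space \<Rightarrow> real"
  assumes S: "compact S" "\<And>x. x \<notin> S \<Longrightarrow> W x = 0" "\<And>x. x \<notin> S \<Longrightarrow> g x = 0"
    and d: "\<And>x. ((\<lambda>s. W (x + s *\<^sub>R e)) has_real_derivative G x) (at 0)"
    and g: "continuous_on UNIV g" "\<And>x. \<bar>G x\<bar> \<le> g x" and e: "e \<noteq> 0"
  shows "ennreal \<bar>W x\<bar> \<le> (\<integral>\<^sup>+s. g (x + s *\<^sub>R e) \<partial>lborel)"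
proof -
  obtain R where R: "\<And>x. x \<in> S \<Longrightarrow> norm x \<le> R" using compact_imp_bounded[OF S(1)] by (auto simp: bounded_iff)
  define A where "A = (\<bar>R\<bar> + norm x + 1) / norm e"
  have A: "A > 0" using e by (simp add: A_def add_nonneg_pos)
  have out: "x + s *\<^sub>R e \<notin> S" if "A \<le> \<bar>s\<bar>" for s
  proof
    assume "x + s *\<^sub>R e \<in> S"
    then have "norm (x + s *\<^sub>R e) \<le> R" by (rule R)
    moreover have "\<bar>s\<bar> * norm e \<le> norm (x + s *\<^sub>R e) + norm x"
      using norm_triangle_ineq4[of "x + s *\<^sub>R e" x] by simp
    moreover have "A * norm e \<le> \<bar>s\<bar> * norm e" using that by (intro mult_right_mono) auto
    moreover have "A * norm e = \<bar>R\<bar> + norm x + 1" using e by (simp add: A_def)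
    ultimately show False by linarith
  qed
  define k where "k s = g (x + s *\<^sub>R e)" for s
  have g0: "0 \<le> g y" for y using g(2)[of y] by linarith
  have ck: "continuous_on UNIV k" unfolding k_def
    by (rule continuous_on_compose2[OF g(1)]) (auto intro!: continuous_intros)
  have k0: "k s = 0" if "s \<notin> {-A..A}" for s
    unfolding k_def by (rule S(3), rule out) (use that in auto)
  have ik: "integrable lborel k" by (rule integrable_compact_support[OF ck _ k0]) auto
  have ikA: "k integrable_on {-A..0}"
    by (rule integrable_continuous_real) (use ck continuous_on_subset in blast)
  have iA: "integrable lborel (\<lambda>s. indicator {-A..0} s *\<^sub>R k s)"
    by (rule integrable_mult_indicator) (use ik in auto)
  have ft: "((\<lambda>s. G (x + s *\<^sub>R e)) has_integral (W (x + 0 *\<^sub>R e) - W (x + (-A) *\<^sub>R e))) {-A..0}"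
    using A line_derivative_at[of W e G, OF d]
    by (intro fundamental_theorem_of_calculus)
       (auto simp: has_real_derivative_iff_has_vector_derivative[symmetric] intro: has_field_derivative_at_within)
  have "W (x + (-A) *\<^sub>R e) = 0" by (rule S(2), rule out) simp
  with ft have ft': "((\<lambda>s. G (x + s *\<^sub>R e)) has_integral W x) {-A..0}" by simp
  have "\<bar>W x\<bar> = norm (integral {-A..0} (\<lambda>s. G (x + s *\<^sub>R e)))"
    using ft' by (simp add: integral_unique)
  also have "\<dots> \<le> integral {-A..0} k"
    by (rule integral_norm_bound_integral) (use ft' ikA g(2) in \<open>auto simp: k_def\<close>)
  also have "\<dots> = (LINT s:{-A..0}|lborel. k s)"
    by (rule set_borel_integral_eq_integral(2)[symmetric]) (unfold set_integrable_def, rule iA)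
  also have "\<dots> \<le> (LINT s|lborel. k s)"
    unfolding set_lebesgue_integral_def
    by (rule integral_mono[OF iA ik]) (use g0 in \<open>auto simp: indicator_def k_def\<close>)
  finally have "ennreal \<bar>W x\<bar> \<le> ennreal (LINT s|lborel. k s)" by (rule ennreal_leI)
  also have "\<dots> = (\<integral>\<^sup>+s. k s \<partial>lborel)"
    by (rule nn_integral_eq_integral[OF ik, symmetric]) (use g0 in \<open>auto simp: k_def\<close>)
  finally show ?thesis unfolding k_def .
qed

lemma integral_Holder:
  fixes f g :: "'a \<Rightarrow> real"
  assumes f: "integrable M f" "\<And>x. 0 \<le> f x" and g: "integrable M g" "\<And>x. 0 \<le> g x"
    and \<theta>: "0 < \<theta>" "\<theta> < 1"
  shows "(LINT x|M. f x powr \<theta> * g x powr (1 - \<theta>)) \<le> (LINT x|M. f x) powr \<theta> * (LINT x|M. g x) powr (1 - \<theta>)"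
proof (rule integral_real_bounded)
  have [measurable]: "f \<in> borel_measurable M" "g \<in> borel_measurable M" using f g by auto
  have "(\<integral>\<^sup>+x. f x \<partial>M) \<le> ennreal (LINT x|M. f x)" "(\<integral>\<^sup>+x. g x \<partial>M) \<le> ennreal (LINT x|M. g x)"
    using f g by (simp_all add: nn_integral_eq_integral)
  then show "(\<integral>\<^sup>+x. f x powr \<theta> * g x powr (1 - \<theta>) \<partial>M) \<le> ennreal ((LINT x|M. f x) powr \<theta> * (LINT x|M. g x) powr (1 - \<theta>))"
    using f g \<theta> by (intro nn_integral_Holder) auto
qed simp

lemma integral_Cauchy_Schwarz:
  fixes f g :: "'a \<Rightarrow> real"
  assumes "integrable M (\<lambda>x. (f x)\<^sup>2)" "integrable M (\<lambda>x. (g x)\<^sup>2)" "\<And>x. 0 \<le> f x" "\<And>x. 0 \<le> g x"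
  shows "(LINT x|M. f x * g x) \<le> sqrt (LINT x|M. (f x)\<^sup>2) * sqrt (LINT x|M. (g x)\<^sup>2)"
proof -
  have "(LINT x|M. (f x)\<^sup>2 powr (1/2) * (g x)\<^sup>2 powr (1 - 1/2)) \<le>
      (LINT x|M. (f x)\<^sup>2) powr (1/2) * (LINT x|M. (g x)\<^sup>2) powr (1 - 1/2)"
    by (rule integral_Holder) (use assms in auto)
  then show ?thesis using assms(3,4) by (simp add: powr_half_sqrt)
qed

lemma sobolev_L1:
  fixes w g :: "'a::euclidean_space \<Rightarrow> real"
  assumes S: "compact S" "\<And>x. x \<notin> S \<Longrightarrow> w x = 0" "\<And>x. x \<notin> S \<Longrightarrow> g x = 0"
    and w: "continuous_on UNIV w" "\<And>x. 0 \<le> w x" and g: "continuous_on UNIV g" "\<And>x. 0 \<le> g x"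
    and line: "\<And>x b. b \<in> Basis \<Longrightarrow> ennreal (w x) \<le> (\<integral>\<^sup>+s. g (x + s *\<^sub>R b) \<partial>lborel)"
    and dim: "DIM('a) \<ge> 2"
  defines "p \<equiv> real DIM('a) / (real DIM('a) - 1)"
  shows "(LINT x|lborel. w x powr p) \<le> (LINT x|lborel. g x) powr p"
proof -
  have p: "p > 0" using dim by (simp add: p_def)
  have p': "real DIM('a) / real (DIM('a) - 1) = p" using dim by (simp add: p_def of_nat_diff)
  have ig: "integrable lborel g" by (rule integrable_compact_support[OF g(1) S(1,3)])
  have "(\<integral>\<^sup>+x. w x powr p \<partial>lborel) \<le> ennreal ((LINT x|lborel. g x) powr p)"
    unfolding p'[symmetric]
  proof (rule gagliardo_nirenberg_lines)
    show "w \<in> borel_measurable borel" "g \<in> borel_measurable borel"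
      using w g by (auto intro: borel_measurable_continuous_onI)
    show "(\<integral>\<^sup>+x. g x \<partial>lborel) \<le> ennreal (LINT x|lborel. g x)"
      using ig g by (simp add: nn_integral_eq_integral)
    show "0 \<le> (LINT x|lborel. g x)" using g by simp
  qed (use w g line dim in auto)
  then show ?thesis by (intro integral_real_bounded) auto
qed

lemma norm_line_derivative:
  fixes y z b :: "'a::real_inner"
  assumes "y \<noteq> z"
  shows "((\<lambda>s. norm (y + s *\<^sub>R b - z)) has_real_derivative (b \<bullet> sgn (y - z))) (at 0)"
proof -
  have "((\<lambda>s. norm (y + s *\<^sub>R b - z)) has_derivative (\<lambda>t. (t *\<^sub>R b) \<bullet> sgn (y + 0 *\<^sub>R b - z))) (at 0)"
  proof (rule has_derivative_compose[where g=norm and f="\<lambda>s. y + s *\<^sub>R b - z"])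
    show "((\<lambda>s. y + s *\<^sub>R b - z) has_derivative (\<lambda>t. t *\<^sub>R b)) (at 0)"
      by (auto intro!: derivative_eq_intros)
  qed (use assms in \<open>auto intro!: has_derivative_norm\<close>)
  then show ?thesis by (simp add: has_field_derivative_def mult.commute[of _ "b \<bullet> sgn (y - z)"])
qed

text \<open>The distance to the boundary is not differentiable. But \<open>1 / bdist \<Omega> x\<close> is the maximum of
  \<open>1 / norm (x - z)\<close> over boundary points \<open>z\<close>, so for each \<open>x\<close> the distance may be replaced by the
  smooth function \<open>norm (y - z)\<close> with \<open>z\<close> nearest to \<open>x\<close>.\<close>

lemma planar_step:
  fixes \<Omega> :: "'a::euclidean_space set"
  assumes u: "u \<in> test_functions \<Omega>" and \<Omega>: "open \<Omega>" "frontier \<Omega> \<noteq> {}" and dim: "DIM('a) = 2"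
    and m: "m \<ge> 1"
  defines "Q \<equiv> \<lambda>k. LINT x|lborel. \<bar>u x\<bar> ^ (2 * k) / (bdist \<Omega> x)\<^sup>2"
  defines "D \<equiv> LINT x|lborel. (norm (grad u x))\<^sup>2"
  shows "Q (Suc m) \<le> ((real (Suc m) * sqrt D + sqrt (Q 1)) * sqrt (Q m))\<^sup>2"
proof -
  let ?d = "bdist \<Omega>"
  define S where "S = support u"
  have S: "compact S" "S \<subseteq> \<Omega>" unfolding S_def using compact_support[OF u] support_subset[OF u] by auto
  have u0: "u x = 0" if "x \<notin> S" for x using zero_outside_support that unfolding S_def by blast
  have dpos: "?d x > 0" if "x \<in> \<Omega>" for x using infdist_frontier_pos[OF \<Omega> that] .
  have dnn: "?d x \<ge> 0" for x by (simp add: bdist_def infdist_nonneg)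
  define w where "w x = \<bar>u x\<bar> ^ Suc m / ?d x" for x
  define g1 where "g1 x = (\<bar>u x\<bar> ^ m / ?d x) * norm (grad u x)" for x
  define g2 where "g2 x = \<bar>u x\<bar> ^ Suc m / (?d x)\<^sup>2" for x
  define g where "g x = real (Suc m) * g1 x + g2 x" for x
  have cw: "continuous_on UNIV w"
    using integrable_power_quotient(2)[OF u \<Omega>, of "Suc m" 1] unfolding w_def by simp
  have cg1: "continuous_on UNIV g1"
    using continuous_on_mult[OF integrable_power_quotient(2)[OF u \<Omega>, of m 1] continuous_on_norm[OF continuous_grad[OF u]]] m
    unfolding g1_def by simp
  have cg2: "continuous_on UNIV g2"
    using integrable_power_quotient(2)[OF u \<Omega>, of "Suc m" 2] unfolding g2_def by simp
  have cg: "continuous_on UNIV g" unfolding g_def by (intro continuous_intros cg1 cg2)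
  have 0: "w x = 0" "g1 x = 0" "g2 x = 0" "g x = 0" if "x \<notin> S" for x
    using u0[OF that] m by (auto simp: w_def g1_def g2_def g_def)
  have nn: "0 \<le> w x" "0 \<le> g1 x" "0 \<le> g2 x" "0 \<le> g x" for x
    using dnn[of x] by (auto simp: w_def g1_def g2_def g_def)
  have line: "ennreal (w x) \<le> (\<integral>\<^sup>+s. g (x + s *\<^sub>R b) \<partial>lborel)" if b: "b \<in> Basis" for x b
  proof -
    obtain z where z: "z \<in> frontier \<Omega>" "?d x = dist x z"
      using infdist_attains_inf[OF frontier_closed \<Omega>(2), of x] unfolding bdist_def by blast
    have yz: "y \<noteq> z" "?d y \<le> norm (y - z)" if "y \<in> \<Omega>" for y
    proof -
      show "y \<noteq> z" using z(1) that frontier_disjoint_eq[of \<Omega>] \<Omega>(1) by blast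
      show "?d y \<le> norm (y - z)" unfolding bdist_def using infdist_le[OF z(1), of y] by (simp add: dist_norm)
    qed
    \<comment> \<open>W depends on x through z, and |W x| = w x because z is nearest to x. The
      majorant g of its derivative does not depend on z, since norm (y - z) is at least delta at
      every y in \<Omega>.\<close>
    define W where "W y = u y ^ Suc m / norm (y - z)" for y
    define G where "G y = real (Suc m) * u y ^ m * (grad u y \<bullet> b) / norm (y - z)
        - u y ^ Suc m * (b \<bullet> sgn (y - z)) / (norm (y - z))\<^sup>2" for y
    have W0: "W y = 0" "G y = 0" if "y \<notin> S" for y using u0[OF that] m by (auto simp: W_def G_def)
    have nb: "norm b = 1" using b by simp
    have der: "((\<lambda>s. W (y + s *\<^sub>R b)) has_real_derivative G y) (at 0)" for y
    proof (cases "y \<in> S")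
      case True
      then have ne: "norm (y - z) \<noteq> 0" "y \<noteq> z" using yz S by auto
      have du: "((\<lambda>s. u (y + s *\<^sub>R b) ^ Suc m) has_real_derivative real (Suc m) * u y ^ m * (grad u y \<bullet> b)) (at 0)"
        using DERIV_power[OF test_function_line_derivative[OF u, of y b 0], of "Suc m"]
        by (simp add: mult_ac)
      show ?thesis unfolding W_def
        by (rule DERIV_cong[OF DERIV_divide[OF du norm_line_derivative[OF ne(2)]]])
          (use ne in \<open>auto simp: G_def power2_eq_square field_simps\<close>)
    next
      case False
      have "((\<lambda>s. W (y + s *\<^sub>R b)) has_real_derivative 0) (at 0)"
        by (rule line_derivative_outside[of S]) (use S W0 False compact_imp_closed in auto)
      then show ?thesis using W0(2)[OF False] by simp
    qed
    have Gg: "\<bar>G y\<bar> \<le> g y" for y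
    proof (cases "y \<in> S")
      case True
      then have y: "y \<in> \<Omega>" using S by auto
      note d = dpos[OF y] yz[OF y]
      have i1: "1 / norm (y - z) \<le> 1 / ?d y" using d by (intro divide_left_mono) auto
      then have "(1 / norm (y - z))\<^sup>2 \<le> (1 / ?d y)\<^sup>2" using d by (intro power_mono) auto
      then have i2: "1 / (norm (y - z))\<^sup>2 \<le> 1 / (?d y)\<^sup>2" by (simp add: power_divide)
      have a: "\<bar>grad u y \<bullet> b\<bar> \<le> norm (grad u y)" "\<bar>b \<bullet> sgn (y - z)\<bar> \<le> 1"
        using Cauchy_Schwarz_ineq2[of "grad u y" b] Cauchy_Schwarz_ineq2[of b "sgn (y - z)"] nb
        by (auto simp: norm_sgn split: if_splits)
      have "\<bar>G y\<bar> \<le> \<bar>real (Suc m) * u y ^ m * (grad u y \<bullet> b) / norm (y - z)\<bar>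
          + \<bar>u y ^ Suc m * (b \<bullet> sgn (y - z)) / (norm (y - z))\<^sup>2\<bar>"
        unfolding G_def by (rule abs_triangle_ineq4)
      also have "\<dots> = (real (Suc m) * \<bar>u y\<bar> ^ m) * (\<bar>grad u y \<bullet> b\<bar> * (1 / norm (y - z)))
          + \<bar>u y\<bar> ^ Suc m * (\<bar>b \<bullet> sgn (y - z)\<bar> * (1 / (norm (y - z))\<^sup>2))"
        by (simp only: abs_mult abs_divide power_abs abs_norm_cancel) simp
      also have "\<dots> \<le> (real (Suc m) * \<bar>u y\<bar> ^ m) * (norm (grad u y) * (1 / ?d y))
          + \<bar>u y\<bar> ^ Suc m * (1 * (1 / (?d y)\<^sup>2))"
        using a i1 i2 d by (intro add_mono mult_left_mono mult_mono) auto
      also have "\<dots> = g y" by (simp add: g_def g1_def g2_def)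
      finally show ?thesis .
    qed (use W0 0 in auto)
    have "ennreal \<bar>W x\<bar> \<le> (\<integral>\<^sup>+s. g (x + s *\<^sub>R b) \<partial>lborel)"
      by (rule line_bound[OF S(1) W0(1) 0(4) der cg Gg]) (use b in auto)
    moreover have "\<bar>W x\<bar> = w x" using z(2) by (simp add: W_def w_def abs_mult power_abs dist_norm)
    ultimately show ?thesis by simp
  qed
  \<comment> \<open>In two dimensions the exponent is 2, and w^2 = |u|^(2m+2)/delta^2 is the
    integrand of Q (m + 1).\<close>
  have "(LINT x|lborel. w x powr (real DIM('a) / (real DIM('a) - 1))) \<le> (LINT x|lborel. g x) powr (real DIM('a) / (real DIM('a) - 1))"
    by (rule sobolev_L1[OF S(1) 0(1) 0(4) cw nn(1) cg nn(4) line]) (use dim in auto)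
  then have "(LINT x|lborel. w x powr 2) \<le> (LINT x|lborel. g x) powr 2" by (simp add: dim)
  moreover have "w x powr 2 = \<bar>u x\<bar> ^ (2 * Suc m) / (?d x)\<^sup>2" for x
  proof -
    have "w x powr 2 = (w x)\<^sup>2" using nn(1)[of x] by (cases "w x = 0") auto
    also have "\<dots> = (\<bar>u x\<bar> ^ Suc m)\<^sup>2 / (?d x)\<^sup>2" unfolding w_def by (rule power_divide)
    also have "(\<bar>u x\<bar> ^ Suc m)\<^sup>2 = \<bar>u x\<bar> ^ (2 * Suc m)" by (simp only: power_mult[symmetric] mult.commute)
    finally show ?thesis .
  qed
  moreover have "(LINT x|lborel. g x) powr 2 = (LINT x|lborel. g x)\<^sup>2"
  proof -
    have "0 \<le> (LINT x|lborel. g x)" by (intro integral_nonneg_AE) (use nn in auto)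
    then show ?thesis by (cases "(LINT x|lborel. g x) = 0") auto
  qed
  ultimately have main: "Q (Suc m) \<le> (LINT x|lborel. g x)\<^sup>2" by (simp add: Q_def)
  have i1: "integrable lborel g1" and i2: "integrable lborel g2"
    using integrable_compact_support[OF cg1 S(1) 0(2)] integrable_compact_support[OF cg2 S(1) 0(3)] by auto
  have sq: "(\<bar>u x\<bar> ^ k / ?d x)\<^sup>2 = \<bar>u x\<bar> ^ (2 * k) / (?d x)\<^sup>2" for x k
    by (simp add: power_divide power_mult[symmetric] mult.commute)
  have iQ: "integrable lborel (\<lambda>x. (\<bar>u x\<bar> ^ k / ?d x)\<^sup>2)" if "k \<ge> 1" for k
    unfolding sq using integrable_power_quotient(1)[OF u \<Omega>, of "2 * k" 2] that by simp
  \<comment> \<open>Both parts of g contain the factor |u|^m/delta, whose square integrates to Q m: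
    g1 pairs it with |grad u|, and g2 with |u|/delta.\<close>
  have "(LINT x|lborel. g1 x) \<le> sqrt (LINT x|lborel. (\<bar>u x\<bar> ^ m / ?d x)\<^sup>2) * sqrt D"
    unfolding g1_def D_def
    by (rule integral_Cauchy_Schwarz) (use iQ m integrable_grad_square[OF u] dnn in auto)
  then have b1: "(LINT x|lborel. g1 x) \<le> sqrt (Q m) * sqrt D" by (simp add: sq Q_def)
  have "(LINT x|lborel. (\<bar>u x\<bar> ^ 1 / ?d x) * (\<bar>u x\<bar> ^ m / ?d x))
      \<le> sqrt (LINT x|lborel. (\<bar>u x\<bar> ^ 1 / ?d x)\<^sup>2) * sqrt (LINT x|lborel. (\<bar>u x\<bar> ^ m / ?d x)\<^sup>2)"
    by (rule integral_Cauchy_Schwarz) (use iQ[OF order_refl] iQ[OF m] dnn in auto)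
  then have b2: "(LINT x|lborel. g2 x) \<le> sqrt (Q 1) * sqrt (Q m)"
    unfolding sq by (simp add: Q_def g2_def power2_eq_square)
  have "(LINT x|lborel. g x) = real (Suc m) * (LINT x|lborel. g1 x) + (LINT x|lborel. g2 x)"
    unfolding g_def using i1 i2 by simp
  also have "\<dots> \<le> real (Suc m) * (sqrt (Q m) * sqrt D) + sqrt (Q 1) * sqrt (Q m)"
    using b1 b2 by (intro add_mono mult_left_mono) auto
  also have "\<dots> = (real (Suc m) * sqrt D + sqrt (Q 1)) * sqrt (Q m)" by (simp add: algebra_simps)
  finally have "(LINT x|lborel. g x)\<^sup>2 \<le> ((real (Suc m) * sqrt D + sqrt (Q 1)) * sqrt (Q m))\<^sup>2"
    by (rule power_mono) (use nn in \<open>auto intro!: integral_nonneg_AE\<close>)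
  with main show ?thesis by simp
qed

text \<open>Hardy's inequality bounds Q 1 by C D, so each use of \<open>planar_step\<close> gains
  one power of D at the price of the factor (m + 1 + sqrt C)^2.\<close>

lemma planar_powers:
  fixes \<Omega> :: "'a::euclidean_space set"
  assumes \<Omega>: "open \<Omega>" "frontier \<Omega> \<noteq> {}" and dim: "DIM('a) = 2" and C: "C > 0"
    and hardy: "\<And>u. u \<in> test_functions \<Omega> \<Longrightarrow>
      (LINT x|lborel. (u x)\<^sup>2 / (bdist \<Omega> x)\<^sup>2) \<le> C * (LINT x|lborel. (norm (grad u x))\<^sup>2)"
    and k: "k \<ge> 1"
  shows "\<exists>K>0. \<forall>u\<in>test_functions \<Omega>. (LINT x|lborel. \<bar>u x\<bar> ^ (2 * k) / (bdist \<Omega> x)\<^sup>2) \<le>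
      K * (LINT x|lborel. (norm (grad u x))\<^sup>2) ^ k"
  using k
proof (induction k rule: dec_induct)
  case base
  show ?case using hardy C by (intro exI[of _ C]) auto
next
  case (step m)
  then obtain K where K: "K > 0" "\<And>u. u \<in> test_functions \<Omega> \<Longrightarrow>
    (LINT x|lborel. \<bar>u x\<bar> ^ (2 * m) / (bdist \<Omega> x)\<^sup>2) \<le> K * (LINT x|lborel. (norm (grad u x))\<^sup>2) ^ m" by auto
  show ?case
  proof (intro exI[of _ "(real (Suc m) + sqrt C)\<^sup>2 * K"] conjI ballI)
    have "real (Suc m) + sqrt C > 0" using C by (intro add_pos_pos) auto
    then show "(real (Suc m) + sqrt C)\<^sup>2 * K > 0" using K by simp
    fix u assume u: "u \<in> test_functions \<Omega>"
    define Q where "Q k = (LINT x|lborel. \<bar>u x\<bar> ^ (2 * k) / (bdist \<Omega> x)\<^sup>2)" for k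
    define D where "D = (LINT x|lborel. (norm (grad u x))\<^sup>2)"
    have D: "D \<ge> 0" by (simp add: D_def)
    have Qnn: "Q k \<ge> 0" for k unfolding Q_def by (rule integral_nonneg_AE) simp
    have "Q 1 \<le> C * D" using hardy[OF u] by (simp add: Q_def D_def)
    then have "sqrt (Q 1) \<le> sqrt C * sqrt D" by (metis real_sqrt_le_mono real_sqrt_mult)
    have "Q (Suc m) \<le> ((real (Suc m) * sqrt D + sqrt (Q 1)) * sqrt (Q m))\<^sup>2"
      unfolding Q_def D_def by (rule planar_step[OF u \<Omega> dim step.hyps(1)])
    also have "\<dots> = (real (Suc m) * sqrt D + sqrt (Q 1))\<^sup>2 * Q m"
      using Qnn by (simp add: power_mult_distrib)
    also have "\<dots> \<le> ((real (Suc m) + sqrt C) * sqrt D)\<^sup>2 * (K * D ^ m)"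
    proof (intro mult_mono power_mono)
      show "real (Suc m) * sqrt D + sqrt (Q 1) \<le> (real (Suc m) + sqrt C) * sqrt D"
        using \<open>sqrt (Q 1) \<le> sqrt C * sqrt D\<close> by (simp add: algebra_simps)
      show "Q m \<le> K * D ^ m" using K(2)[OF u] by (simp add: Q_def D_def)
    qed (use D Qnn in auto)
    also have "\<dots> = (real (Suc m) + sqrt C)\<^sup>2 * K * D ^ Suc m"
      using D by (simp add: power_mult_distrib)
    finally show "(LINT x|lborel. \<bar>u x\<bar> ^ (2 * Suc m) / (bdist \<Omega> x)\<^sup>2) \<le>
      (real (Suc m) + sqrt C)\<^sup>2 * K * (LINT x|lborel. (norm (grad u x))\<^sup>2) ^ Suc m"
      by (simp only: Q_def D_def)
  qed
qed

section \<open>The Hardy-Sobolev inequality\<close>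

lemma continuous_abs_powr:
  assumes "continuous_on S f" "a > 0"
  shows "continuous_on S (\<lambda>x. \<bar>f x :: real\<bar> powr a)"
  by (rule continuous_on_powr') (use assms in \<open>auto intro!: continuous_intros\<close>)

lemma abs_powr_derivative:
  fixes y m :: real
  assumes "m > 1"
  shows "((\<lambda>y. \<bar>y\<bar> powr m) has_real_derivative m * \<bar>y\<bar> powr (m - 1) * sgn y) (at y)"
proof -
  consider "y < 0" | "y = 0" | "y > 0" by linarith
  then show ?thesis
  proof cases
    case 1
    have "((\<lambda>y. (- y) powr m) has_real_derivative m * \<bar>y\<bar> powr (m - 1) * sgn y) (at y)"
      using 1 by (auto intro!: derivative_eq_intros)
    then show ?thesis
      by (rule has_field_derivative_transform_within_open[where S="{..<0}"]) (use 1 in auto)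
  next
    case 2
    have "((\<lambda>h. \<bar>h\<bar> powr m / h) \<longlongrightarrow> 0) (at (0::real))"
    proof (rule Lim_null_comparison)
      have "norm (\<bar>h\<bar> powr m / h) \<le> \<bar>h\<bar> powr (m - 1)" if "h \<noteq> 0" for h :: real
        using that by (simp add: powr_diff)
      then show "eventually (\<lambda>h. norm (\<bar>h\<bar> powr m / h) \<le> \<bar>h\<bar> powr (m - 1)) (at (0::real))"
        by (auto simp: eventually_at intro!: exI[of _ 1])
      have "isCont (\<lambda>h::real. \<bar>h\<bar> powr (m - 1)) 0"
        using continuous_abs_powr[OF continuous_on_id[of UNIV], of "m - 1"] assms
        by (simp add: continuous_on_eq_continuous_at)
      then show "((\<lambda>h. \<bar>h\<bar> powr (m - 1)) \<longlongrightarrow> 0) (at (0::real))"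
        using assms by (simp add: isCont_def)
    qed
    then show ?thesis using 2 by (simp add: DERIV_def)
  next
    case 3
    have "((\<lambda>y. y powr m) has_real_derivative m * \<bar>y\<bar> powr (m - 1) * sgn y) (at y)"
      using 3 by (auto intro!: derivative_eq_intros)
    then show ?thesis
      by (rule has_field_derivative_transform_within_open[where S="{0<..}"]) (use 3 in auto)
  qed
qed

text \<open>The power m is chosen so that m p = q and 2 (m - 1) = q. After Cauchy-Schwarz the same
  integral B of |u|^q then stands on both sides, B <= (m sqrt B sqrt D)^p, and since p/2 < 1 this
  can be solved for B.\<close>

theorem sobolev:
  fixes \<Omega> :: "'a::euclidean_space set"
  assumes u: "u \<in> test_functions \<Omega>" and dim: "DIM('a) \<ge> 3"
  defines "N \<equiv> real DIM('a)"
  defines "D \<equiv> LINT x|lborel. (norm (grad u x))\<^sup>2"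
  shows "(LINT x|lborel. \<bar>u x\<bar> powr (2 * N / (N - 2))) \<le>
    (2 * (N - 1) / (N - 2)) powr (2 * N / (N - 2)) * D powr (N / (N - 2))"
proof -
  define m where "m = 2 * (N - 1) / (N - 2)"
  define q where "q = 2 * N / (N - 2)"
  define p where "p = N / (N - 1)"
  have N: "N \<ge> 3" using dim by (simp add: N_def)
  have "N - 1 \<noteq> 0" "N - 2 \<noteq> 0" using N by auto
  then have mp: "m * (N - 2) = 2 * (N - 1)" "(N - 1) * p = N" by (simp_all add: m_def p_def)
  have "(m * p) * (N - 2) = (m * (N - 2)) * p" by (simp only: mult_ac)
  also have "\<dots> = 2 * N" unfolding mp(1) using mp(2) by (simp only: mult.assoc)
  finally have "m * p = q" using \<open>N - 2 \<noteq> 0\<close> by (simp add: q_def eq_divide_eq)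
  then have m: "m > 1" "m - 1 = q / 2" "m * p = q" and q: "q > 0" and p: "p > 0"
    using N by (auto simp: m_def q_def p_def field_simps)
  define S where "S = support u"
  have S: "compact S" unfolding S_def using compact_support[OF u] by auto
  have u0: "u x = 0" if "x \<notin> S" for x using zero_outside_support that unfolding S_def by blast
  define w where "w x = \<bar>u x\<bar> powr m" for x
  define g where "g x = m * (\<bar>u x\<bar> powr (m - 1) * norm (grad u x))" for x
  define W where "W x = m * \<bar>u x\<bar> powr (m - 1) * sgn (u x)" for x
  define B where "B = (LINT x|lborel. \<bar>u x\<bar> powr q)"
  have D: "0 \<le> D" by (simp add: D_def)
  have B: "0 \<le> B" by (simp add: B_def)
  have cw: "continuous_on UNIV w" unfolding w_def
    using m by (intro continuous_abs_powr continuous_test_function[OF u]) auto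
  have cg: "continuous_on UNIV g" unfolding g_def
    using m by (intro continuous_intros continuous_abs_powr continuous_test_function[OF u] continuous_grad[OF u]) auto
  have 0: "w x = 0" "g x = 0" if "x \<notin> S" for x using u0[OF that] by (auto simp: w_def g_def)
  have nn: "0 \<le> w x" "0 \<le> g x" for x using m by (auto simp: w_def g_def)
  have line: "ennreal (w x) \<le> (\<integral>\<^sup>+s. g (x + s *\<^sub>R b) \<partial>lborel)" if b: "b \<in> Basis" for x b
  proof -
    have der: "((\<lambda>s. w (y + s *\<^sub>R b)) has_real_derivative W y * (grad u y \<bullet> b)) (at 0)" for y
      using DERIV_chain2[OF abs_powr_derivative[OF m(1)] test_function_line_derivative[OF u, of y b 0]]
      by (simp add: w_def W_def)
    have le: "\<bar>W y * (grad u y \<bullet> b)\<bar> \<le> g y" for y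
    proof -
      have "\<bar>grad u y \<bullet> b\<bar> \<le> norm (grad u y)"
        using Cauchy_Schwarz_ineq2[of "grad u y" b] b by simp
      moreover have "\<bar>W y\<bar> \<le> m * \<bar>u y\<bar> powr (m - 1)"
        using m(1) by (auto simp: W_def abs_mult abs_sgn_eq)
      ultimately have "\<bar>W y\<bar> * \<bar>grad u y \<bullet> b\<bar> \<le> (m * \<bar>u y\<bar> powr (m - 1)) * norm (grad u y)"
        using m(1) by (intro mult_mono) auto
      then show ?thesis by (simp add: g_def abs_mult)
    qed
    have "ennreal \<bar>w x\<bar> \<le> (\<integral>\<^sup>+s. g (x + s *\<^sub>R b) \<partial>lborel)"
      by (rule line_bound[OF S 0 der cg le]) (use b in auto)
    then show ?thesis using nn by simp
  qed
  have "(LINT x|lborel. w x powr p) \<le> (LINT x|lborel. g x) powr p"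
    unfolding p_def N_def
    by (rule sobolev_L1[OF S 0 cw nn(1) cg nn(2) line]) (use dim in auto)
  then have main: "B \<le> (LINT x|lborel. g x) powr p"
    by (simp add: w_def B_def powr_powr m)
  have sq: "(\<bar>a\<bar> powr (m - 1))\<^sup>2 = \<bar>a\<bar> powr q" for a
    using m(2) by (cases "a = 0") (auto simp: power2_eq_square powr_add[symmetric] mult.commute)
  have iB: "integrable lborel (\<lambda>x. \<bar>u x\<bar> powr q)"
    by (rule integrable_compact_support[OF _ S])
       (use u0 q in \<open>auto intro!: continuous_abs_powr continuous_test_function[OF u]\<close>)
  have "(LINT x|lborel. \<bar>u x\<bar> powr (m - 1) * norm (grad u x)) \<le> sqrt (LINT x|lborel. (\<bar>u x\<bar> powr (m - 1))\<^sup>2) * sqrt D"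
    unfolding D_def
    by (rule integral_Cauchy_Schwarz) (use iB integrable_grad_square[OF u] in \<open>auto simp: sq\<close>)
  then have "(LINT x|lborel. g x) \<le> m * (sqrt B * sqrt D)"
    unfolding g_def sq using m(1) by (simp add: B_def)
  then have "(LINT x|lborel. g x) powr p \<le> (m * (sqrt B * sqrt D)) powr p"
    using p nn by (intro powr_mono2 integral_nonneg_AE) auto
  with main have Bp: "B \<le> (m * (sqrt B * sqrt D)) powr p" by linarith
  have "B \<le> m powr q * D powr (N / (N - 2))"
  proof (cases "B = 0")
    case False
    then have Bpos: "B > 0" using B by simp
    with Bp have "D \<noteq> 0" using p by auto
    then have Dpos: "D > 0" using D by simp
    have "ln B \<le> ln ((m * (sqrt B * sqrt D)) powr p)"
      using Bp Bpos by (subst ln_le_cancel_iff) auto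
    also have "\<dots> = p * (ln m + ln B / 2 + ln D / 2)"
      using Bpos Dpos m by (simp add: ln_powr ln_mult ln_sqrt)
    finally have "ln B * (1 - p / 2) \<le> p * (ln m + ln D / 2)" by (simp add: algebra_simps)
    \<comment> \<open>This number is 1/m, so multiplying by m isolates ln B.\<close>
    moreover have "1 - p / 2 = (N - 2) / (2 * (N - 1))" using N by (simp add: p_def field_simps)
    ultimately have "ln B * ((N - 2) / (2 * (N - 1))) * m \<le> p * (ln m + ln D / 2) * m"
      using m by (intro mult_right_mono) auto
    moreover have "ln B * ((N - 2) / (2 * (N - 1))) * m = ln B"
      using N by (simp add: m_def)
    ultimately have "ln B \<le> (m * p) * (ln m + ln D / 2)" by (simp add: mult_ac)
    also have "\<dots> = q * ln m + N / (N - 2) * ln D" by (simp add: m(3) algebra_simps add_divide_distrib q_def)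
    also have "\<dots> = ln (m powr q * D powr (N / (N - 2)))"
      using Dpos m by (simp add: ln_powr ln_mult)
    finally show ?thesis using Bpos Dpos m by (subst (asm) ln_le_cancel_iff) auto
  qed simp
  then show ?thesis by (simp add: B_def q_def m_def)
qed

lemma interpolation_bound:
  fixes A B D F G H \<theta> r :: real
  assumes "F \<le> A * D" "G \<le> B * D powr r" "H \<le> F powr \<theta> * G powr (1 - \<theta>)"
    and "0 \<le> F" "0 \<le> G" "0 \<le> A" "0 \<le> B" "0 \<le> D" "0 < \<theta>" "\<theta> < 1"
  shows "H \<le> (A powr \<theta> * B powr (1 - \<theta>)) * D powr (\<theta> + r * (1 - \<theta>))"
proof -
  have "F powr \<theta> * G powr (1 - \<theta>) \<le> (A * D) powr \<theta> * (B * D powr r) powr (1 - \<theta>)"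
    using assms by (intro mult_mono powr_mono2) auto
  also have "\<dots> = (A powr \<theta> * B powr (1 - \<theta>)) * D powr (\<theta> + r * (1 - \<theta>))"
    using assms by (simp add: powr_mult powr_powr powr_add)
  finally show ?thesis using assms(3) by linarith
qed

text \<open>The power 1 + beta/(n+1) of D is half the power of u in the integral, as homogeneity in
  u demands. It remains to write the integrand as a product of powers \<theta> and 1 - \<theta> of
  the Hardy integrand and of a second integrand already controlled, and to match the exponents of
  delta and |u|.\<close>

theorem hardy_sobolev:
  fixes \<Omega> :: "((real ^ 'n) \<times> real) set" and \<beta> :: real
  assumes dom: "is_domain \<Omega>" "bounded \<Omega>" and lip: "lipschitz_boundary \<Omega>"
    and \<beta>: "0 \<le> \<beta>" "CARD('n) \<ge> 2 \<Longrightarrow> \<beta> \<le> 2 * (real CARD('n) + 1) / (real CARD('n) - 1)"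
  defines "n \<equiv> real CARD('n)"
  shows "\<exists>C>0. \<forall>u\<in>test_functions \<Omega>.
    (LINT x|lborel. bdist \<Omega> x powr (-2 + (n - 1) / (n + 1) * \<beta>) * \<bar>u x\<bar> powr (2 + 2 * \<beta> / (n + 1))) \<le>
    C * (LINT x|lborel. (norm (grad u x))\<^sup>2) powr (1 + \<beta> / (n + 1))"
proof -
  note fr = bounded_domain_frontier[OF dom]
  define D where "D u = (LINT x|lborel. (norm (grad u x))\<^sup>2)" for u :: "(real ^ 'n) \<times> real \<Rightarrow> real"
  define a where "a = -2 + (n - 1) / (n + 1) * \<beta>"
  define q where "q = 2 + 2 * \<beta> / (n + 1)"
  define H where "H u = (LINT x|lborel. bdist \<Omega> x powr a * \<bar>u x\<bar> powr q)" for u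
  define F where "F u = (LINT x|lborel. (u x)\<^sup>2 / (bdist \<Omega> x)\<^sup>2)" for u
  have n1: "n \<ge> 1" unfolding n_def using zero_less_card_finite[where 'a='n] by (simp add: Suc_le_eq)
  have Dn: "0 \<le> D u" for u by (simp add: D_def)
  have Fn: "0 \<le> F u" for u by (simp add: F_def)
  obtain C where C: "C > 0" "\<And>u. u \<in> test_functions \<Omega> \<Longrightarrow> F u \<le> C * D u"
    unfolding F_def D_def by (rule hardy[OF dom lip]) blast
  have dp: "0 < bdist \<Omega> x" if "u \<in> test_functions \<Omega>" "u x \<noteq> 0" for u x
    using that zero_outside_support[of x u] support_subset[of u \<Omega>] infdist_frontier_pos[OF fr(1,2), of x] by auto
  have iF: "integrable lborel (\<lambda>x. (u x)\<^sup>2 / (bdist \<Omega> x)\<^sup>2)" if "u \<in> test_functions \<Omega>" for u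
    using integrable_power_quotient(1)[OF that fr(1,2), of 2 2] by simp
  have dim: "DIM((real ^ 'n) \<times> real) = CARD('n) + 1" by simp
  have "\<exists>C>0. \<forall>u\<in>test_functions \<Omega>. H u \<le> C * D u powr (1 + \<beta> / (n + 1))"
  proof -
    have "CARD('n) \<ge> 1" by (simp add: Suc_le_eq)
    then have "\<beta> = 0 \<or> (\<beta> > 0 \<and> CARD('n) = 1) \<or> (\<beta> > 0 \<and> CARD('n) \<ge> 2)"
      using \<beta>(1) by linarith
    then consider "\<beta> = 0" | "\<beta> > 0" "CARD('n) = 1" | "\<beta> > 0" "CARD('n) \<ge> 2" by blast
    then show ?thesis
    proof cases
      case 1
      have "H u = F u" if u: "u \<in> test_functions \<Omega>" for u
        unfolding H_def F_def
      proof (rule Bochner_Integration.integral_cong[OF refl])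
        fix x
        show "bdist \<Omega> x powr a * \<bar>u x\<bar> powr q = (u x)\<^sup>2 / (bdist \<Omega> x)\<^sup>2"
          using 1 dp[OF u, of x] by (cases "u x = 0") (auto simp: a_def q_def powr_minus divide_inverse)
      qed
      then show ?thesis using C 1 Dn by (intro exI[of _ C]) auto
    next
      case 2
      then have n: "n = 1" by (simp add: n_def)
      obtain k :: nat where k: "k \<ge> 2" "real k > q" using reals_Archimedean2[of "max 2 q"] by (metis less_imp_le max_less_iff_conj numeral_less_real_of_nat_iff)
      \<comment> \<open>Both integrands carry delta^(-2), so only the power of |u| has to match: 2
        \<theta> + 2 k (1 - \<theta>) = q. It lies strictly between 0 and 1 because 2 < q < 2
        k.\<close>
      define \<theta> where "\<theta> = (2 * real k - q) / (2 * real k - 2)"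
      have q2: "q > 2" using 2 n by (simp add: q_def)
      have \<theta>: "0 < \<theta>" "\<theta> < 1" using k q2 by (auto simp: \<theta>_def field_simps)
      have e1: "2 * \<theta> + 2 * real k * (1 - \<theta>) = q"
      proof -
        have "\<theta> * (2 * real k - 2) = 2 * real k - q" using k by (simp add: \<theta>_def)
        then show ?thesis by (simp add: algebra_simps)
      qed
      have e2: "\<theta> + real k * (1 - \<theta>) = 1 + \<beta> / (n + 1)" using e1 by (simp add: q_def n)
      have "DIM((real ^ 'n) \<times> real) = 2" using dim 2 by simp
      then obtain K where K: "K > 0" "\<And>u. u \<in> test_functions \<Omega> \<Longrightarrow>
          (LINT x|lborel. \<bar>u x\<bar> ^ (2 * k) / (bdist \<Omega> x)\<^sup>2) \<le> K * D u ^ k"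
        using planar_powers[OF fr(1,2) _ C(1), of k] C(2) k unfolding F_def D_def by auto
      have "H u \<le> (C powr \<theta> * K powr (1 - \<theta>)) * D u powr (1 + \<beta> / (n + 1))" if u: "u \<in> test_functions \<Omega>" for u
        unfolding e2[symmetric]
      proof (rule interpolation_bound[where F="F u" and G="LINT x|lborel. \<bar>u x\<bar> ^ (2 * k) / (bdist \<Omega> x)\<^sup>2"])
        have "H u = (LINT x|lborel. ((u x)\<^sup>2 / (bdist \<Omega> x)\<^sup>2) powr \<theta> * (\<bar>u x\<bar> ^ (2 * k) / (bdist \<Omega> x)\<^sup>2) powr (1 - \<theta>))"
          unfolding H_def
        proof (rule Bochner_Integration.integral_cong[OF refl])
          fix x
          show "bdist \<Omega> x powr a * \<bar>u x\<bar> powr q = ((u x)\<^sup>2 / (bdist \<Omega> x)\<^sup>2) powr \<theta> * (\<bar>u x\<bar> ^ (2 * k) / (bdist \<Omega> x)\<^sup>2) powr (1 - \<theta>)"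
          proof (cases "u x = 0")
            case False
            define d where "d = bdist \<Omega> x"
            define v where "v = \<bar>u x\<bar>"
            have pos: "d > 0" "v > 0" using dp[OF u False] False by (auto simp: d_def v_def)
            have s: "(u x)\<^sup>2 / d\<^sup>2 = v powr 2 * d powr (-2)" "v ^ (2 * k) / d\<^sup>2 = v powr (2 * real k) * d powr (-2)"
              using pos powr_realpow[of v "2 * k"] by (auto simp: v_def powr_minus divide_inverse)
            have "(v powr 2 * d powr (-2)) powr \<theta> * (v powr (2 * real k) * d powr (-2)) powr (1 - \<theta>) =
                v powr (2 * \<theta> + 2 * real k * (1 - \<theta>)) * d powr ((-2) * \<theta> + (-2) * (1 - \<theta>))"
              using pos by (simp only: powr_mult powr_powr powr_add powr_ge_zero mult_ac)
            also have "(-2) * \<theta> + (-2) * (1 - \<theta>) = a" by (simp add: a_def n algebra_simps)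
            finally show ?thesis unfolding d_def[symmetric] v_def[symmetric] s e1 by (simp add: mult.commute)
          qed (use q2 k in auto)
        qed
        also have "\<dots> \<le> F u powr \<theta> * (LINT x|lborel. \<bar>u x\<bar> ^ (2 * k) / (bdist \<Omega> x)\<^sup>2) powr (1 - \<theta>)"
          unfolding F_def
          by (rule integral_Holder) (use iF[OF u] integrable_power_quotient(1)[OF u fr(1,2), of "2 * k" 2] k \<theta> in auto)
        finally show "H u \<le> F u powr \<theta> * (LINT x|lborel. \<bar>u x\<bar> ^ (2 * k) / (bdist \<Omega> x)\<^sup>2) powr (1 - \<theta>)" .
        have "D u ^ k = D u powr real k" using Dn[of u] k by (cases "D u = 0") (auto simp: powr_realpow)
        then show "(LINT x|lborel. \<bar>u x\<bar> ^ (2 * k) / (bdist \<Omega> x)\<^sup>2) \<le> K * D u powr real k"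
          using K(2)[OF u] by simp
      qed (use C K Dn Fn u \<theta> in \<open>auto intro!: integral_nonneg_AE\<close>)
      then show ?thesis using C K by (intro exI[of _ "C powr \<theta> * K powr (1 - \<theta>)"]) auto
    next
      case 3
      then have n2: "n \<ge> 2" by (simp add: n_def)
      define N where "N = n + 1"
      have NN: "N = real DIM((real ^ 'n) \<times> real)" by (simp add: N_def n_def)
      define s where "s = 2 * N / (N - 2)"
      define K where "K = (2 * (N - 1) / (N - 2)) powr s"
      have K: "K > 0" using n2 by (auto simp: K_def N_def)
      define G where "G u = (LINT x|lborel. \<bar>u x\<bar> powr s)" for u :: "(real ^ 'n) \<times> real \<Rightarrow> real"
      have Gn: "0 \<le> G u" for u by (simp add: G_def)
      have GK: "G u \<le> K * D u powr (N / (N - 2))" if u: "u \<in> test_functions \<Omega>" for u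
        using sobolev[OF u] 3 unfolding G_def K_def D_def s_def NN by simp
      \<comment> \<open>The weight comes from the Hardy factor alone, so -2 \<theta> = a is forced;
        then s (1 - \<theta>) = \<beta> and the powers of |u| match as well. The upper bound on
        \<beta> says precisely that \<theta> >= 0.\<close>
      define \<theta> where "\<theta> = 1 - (N - 2) * \<beta> / (2 * N)"
      have N3: "N \<ge> 3" using n2 by (simp add: N_def)
      have "\<beta> \<le> 2 * N / (N - 2)" using \<beta>(2) 3 by (simp add: N_def n_def)
      then have "(N - 2) * \<beta> \<le> 2 * N" using N3 by (simp add: field_simps)
      then have \<theta>: "0 \<le> \<theta>" "\<theta> < 1" using N3 3 by (auto simp: \<theta>_def field_simps)
      have s\<theta>: "s * (1 - \<theta>) = \<beta>" using N3 by (simp add: s_def \<theta>_def field_simps)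
      have a\<theta>: "a = -2 * \<theta>" using N3 by (simp add: a_def \<theta>_def N_def field_simps)
      have "2 * \<theta> + \<beta> = 2 + 2 * \<beta> / N" using N3 by (simp add: \<theta>_def field_simps)
      then have q\<theta>: "q = 2 * \<theta> + s * (1 - \<theta>)" unfolding s\<theta> by (simp add: q_def N_def)
      have r\<theta>: "\<theta> + N / (N - 2) * (1 - \<theta>) = 1 + \<beta> / (n + 1)"
      proof -
        have e: "N / (N - 2) = s / 2" "1 + \<beta> / (n + 1) = q / 2" using N3 by (simp_all add: s_def q_def field_simps)
        show ?thesis unfolding e using q\<theta> by (simp add: field_simps)
      qed
      have spos: "s > 0" using N3 by (simp add: s_def)
      show ?thesis
      \<comment> \<open>At the largest \<beta> the weight disappears and the Sobolev inequality is
        the claim itself; Hoelder's inequality is available only for 0 < \<theta> < 1.\<close>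
      proof (cases "\<theta> = 0")
        case True
        have "H u = G u" if u: "u \<in> test_functions \<Omega>" for u
          unfolding H_def G_def
        proof (rule Bochner_Integration.integral_cong[OF refl])
          fix x
          show "bdist \<Omega> x powr a * \<bar>u x\<bar> powr q = \<bar>u x\<bar> powr s"
            using a\<theta> q\<theta> True dp[OF u, of x] by (cases "u x = 0") auto
        qed
        then show ?thesis using GK K r\<theta> True by (intro exI[of _ K]) auto
      next
        case False
        with \<theta> have \<theta>: "0 < \<theta>" "\<theta> < 1" by auto
        have "H u \<le> (C powr \<theta> * K powr (1 - \<theta>)) * D u powr (1 + \<beta> / (n + 1))" if u: "u \<in> test_functions \<Omega>" for u
          unfolding r\<theta>[symmetric]
        proof (rule interpolation_bound[where F="F u" and G="G u"])
          have "H u = (LINT x|lborel. ((u x)\<^sup>2 / (bdist \<Omega> x)\<^sup>2) powr \<theta> * (\<bar>u x\<bar> powr s) powr (1 - \<theta>))"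
            unfolding H_def
          proof (rule Bochner_Integration.integral_cong[OF refl])
            fix x
            show "bdist \<Omega> x powr a * \<bar>u x\<bar> powr q = ((u x)\<^sup>2 / (bdist \<Omega> x)\<^sup>2) powr \<theta> * (\<bar>u x\<bar> powr s) powr (1 - \<theta>)"
            proof (cases "u x = 0")
              case False
              define d where "d = bdist \<Omega> x"
              define v where "v = \<bar>u x\<bar>"
              have pos: "d > 0" "v > 0" using dp[OF u False] False by (auto simp: d_def v_def)
              have s: "(u x)\<^sup>2 / d\<^sup>2 = v powr 2 * d powr (-2)"
                using pos by (auto simp: v_def powr_minus divide_inverse)
              have "(v powr 2 * d powr (-2)) powr \<theta> * (v powr s) powr (1 - \<theta>) =
                  v powr (2 * \<theta> + s * (1 - \<theta>)) * d powr ((-2) * \<theta>)"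
                using pos by (simp only: powr_mult powr_powr powr_add powr_ge_zero mult_ac)
              then show ?thesis unfolding d_def[symmetric] v_def[symmetric] s q\<theta> a\<theta> by (simp add: mult.commute)
            qed auto
          qed
          also have "\<dots> \<le> F u powr \<theta> * G u powr (1 - \<theta>)"
            unfolding F_def G_def
          proof (rule integral_Holder)
            show "integrable lborel (\<lambda>x. \<bar>u x\<bar> powr s)"
              by (rule integrable_compact_support[OF _ compact_support[OF u]])
                (use zero_outside_support[of _ u] spos in \<open>auto intro!: continuous_abs_powr continuous_test_function[OF u]\<close>)
          qed (use iF[OF u] \<theta> in auto)
          finally show "H u \<le> F u powr \<theta> * G u powr (1 - \<theta>)" .
        qed (use C K Dn Fn Gn GK u \<theta> in auto)
        then show ?thesis using C K by (intro exI[of _ "C powr \<theta> * K powr (1 - \<theta>)"]) auto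
      qed
    qed
  qed
  then show ?thesis unfolding H_def D_def a_def q_def .
qed

section \<open>Similarities and smooth functions\<close>

text \<open>The uniqueness argument for Haar measure: both sides are compared by applying Fubini's theorem to
  \<open>f y * indicator (ball 0 1) (y - T x)\<close>.\<close>

lemma nn_integral_orthogonal:
  fixes T :: "'a::euclidean_space \<Rightarrow> 'a" and f :: "'a \<Rightarrow> ennreal"
  assumes T: "orthogonal_transformation T" and [measurable]: "f \<in> borel_measurable borel"
  shows "(\<integral>\<^sup>+x. f (T x) \<partial>lborel) = (\<integral>\<^sup>+x. f x \<partial>lborel)"
proof -
  let ?B = "ball (0::'a) 1"
  define c where "c = emeasure lborel ?B"
  define g :: "'a \<Rightarrow> ennreal" where "g = indicator ?B"
  have gm[measurable]: "g \<in> borel_measurable borel" unfolding g_def by (rule borel_measurable_indicator) (simp add: borel_open)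
  have lT: "linear T" using T by (rule orthogonal_transformation_linear)
  then have cT: "continuous_on UNIV T" by (simp add: linear_continuous_on linear_linear)
  then have [measurable]: "T \<in> borel_measurable borel" by (rule borel_measurable_continuous_onI)
  have c: "c \<noteq> 0" "c \<noteq> \<infinity>" using emeasure_bounded_finite[of ?B] open_not_negligible[of ?B]
    by (auto simp: c_def negligible_iff_null_sets null_sets_def)
  have tr: "(\<integral>\<^sup>+x. h (x + a) \<partial>lborel) = (\<integral>\<^sup>+x. h x \<partial>lborel)"
    if [measurable]: "h \<in> borel_measurable borel" for h :: "'a \<Rightarrow> ennreal" and a
  proof -
    have "(\<integral>\<^sup>+x. h x \<partial>distr lborel borel ((+) a)) = (\<integral>\<^sup>+x. h (a + x) \<partial>lborel)"
      by (rule nn_integral_distr) auto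
    then show ?thesis by (simp add: lborel_distr_plus add.commute)
  qed
  \<comment> \<open>As T is onto, y = T y', and |y - T x| = |y' - x|: the integrand is the indicator
    of a translated unit ball, whose measure c is positive and finite and can be cancelled at the
    end.\<close>
  have ball: "(\<integral>\<^sup>+x. g (y - T x) \<partial>lborel) = c" for y
  proof -
    obtain y' where y': "y = T y'" using orthogonal_transformation_surj[OF T] by (metis surjD)
    have "g (y - T x) = g (x + - y')" for x
      using orthogonal_transformation_norm[OF T, of "y' - x"] lT
      by (auto simp: y' g_def indicator_def linear_diff norm_minus_commute)
    then show ?thesis using tr[of "g" "- y'", OF gm] by (simp add: c_def g_def)
  qed
  have "c * (\<integral>\<^sup>+y. f y \<partial>lborel) = (\<integral>\<^sup>+y. f y * (\<integral>\<^sup>+x. g (y - T x) \<partial>lborel) \<partial>lborel)"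
    unfolding ball by (simp add: nn_integral_cmult mult.commute)
  also have "\<dots> = (\<integral>\<^sup>+y. \<integral>\<^sup>+x. f y * g (y - T x) \<partial>lborel \<partial>lborel)"
    by (intro nn_integral_cong nn_integral_cmult[symmetric]) measurable
  also have "\<dots> = (\<integral>\<^sup>+x. \<integral>\<^sup>+y. f y * g (y - T x) \<partial>lborel \<partial>lborel)"
    by (rule lborel_pair.Fubini') measurable
  also have "\<dots> = (\<integral>\<^sup>+x. \<integral>\<^sup>+y. f (y + T x) * g y \<partial>lborel \<partial>lborel)"
  proof (rule nn_integral_cong)
    fix x
    have [measurable]: "(\<lambda>y. f y * g (y - T x)) \<in> borel_measurable borel" by measurable
    show "(\<integral>\<^sup>+y. f y * g (y - T x) \<partial>lborel) = (\<integral>\<^sup>+y. f (y + T x) * g y \<partial>lborel)"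
      using tr[of "\<lambda>y. f y * g (y - T x)" "T x"] by simp
  qed
  also have "\<dots> = (\<integral>\<^sup>+y. \<integral>\<^sup>+x. f (y + T x) * g y \<partial>lborel \<partial>lborel)"
    by (rule lborel_pair.Fubini') measurable
  also have "\<dots> = (\<integral>\<^sup>+y. (\<integral>\<^sup>+x. f (T x) \<partial>lborel) * g y \<partial>lborel)"
  proof (rule nn_integral_cong)
    fix y
    obtain y' where y': "y = T y'" using orthogonal_transformation_surj[OF T] by (metis surjD)
    have "(\<integral>\<^sup>+x. f (y + T x) * g y \<partial>lborel) = (\<integral>\<^sup>+x. f (y + T x) \<partial>lborel) * g y"
      by (rule nn_integral_multc) measurable
    moreover have "(\<integral>\<^sup>+x. f (y + T x) \<partial>lborel) = (\<integral>\<^sup>+x. f (T x) \<partial>lborel)"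
      using tr[of "\<lambda>x. f (T x)" y'] lT by (simp add: y' linear_add add.commute)
    ultimately show "(\<integral>\<^sup>+x. f (y + T x) * g y \<partial>lborel) = (\<integral>\<^sup>+x. f (T x) \<partial>lborel) * g y"
      by simp
  qed
  also have "\<dots> = (\<integral>\<^sup>+x. f (T x) \<partial>lborel) * (\<integral>\<^sup>+y. g y \<partial>lborel)"
    by (rule nn_integral_cmult) simp
  also have "(\<integral>\<^sup>+y. g y \<partial>lborel) = c" by (simp add: g_def c_def)
  finally show ?thesis using c by (simp add: ennreal_mult_cancel_left mult.commute[of _ c])
qed

lemma distr_orthogonal:
  fixes T :: "'a::euclidean_space \<Rightarrow> 'a"
  assumes T: "orthogonal_transformation T"
  shows "distr lborel borel T = lborel"
proof (rule measure_eqI)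
  have "linear T" using T by (rule orthogonal_transformation_linear)
  then have "continuous_on UNIV T" by (simp add: linear_continuous_on linear_linear)
  then have [measurable]: "T \<in> borel_measurable borel" by (rule borel_measurable_continuous_onI)
  fix A assume "A \<in> sets (distr lborel borel T)"
  then have [measurable]: "A \<in> sets borel" by simp
  have "emeasure (distr lborel borel T) A = (\<integral>\<^sup>+x. indicator A x \<partial>distr lborel borel T)" by simp
  also have "\<dots> = (\<integral>\<^sup>+x. indicator A (T x) \<partial>lborel)" by (rule nn_integral_distr) auto
  also have "\<dots> = (\<integral>\<^sup>+x. indicator A x \<partial>lborel)" by (rule nn_integral_orthogonal[OF T]) auto
  finally show "emeasure (distr lborel borel T) A = emeasure lborel A" by simp
qed simp

lemma integral_similarity:
  fixes T :: "'a::euclidean_space \<Rightarrow> 'a" and f :: "'a \<Rightarrow> real"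
  assumes T: "orthogonal_transformation T" and s: "s > 0" and [measurable]: "f \<in> borel_measurable borel"
  shows "(LINT x|lborel. f (s *\<^sub>R T (x - a))) = (LINT x|lborel. f x) / s ^ DIM('a)"
proof -
  have "linear T" using T by (rule orthogonal_transformation_linear)
  then have "continuous_on UNIV T" by (simp add: linear_continuous_on linear_linear)
  then have [measurable]: "T \<in> borel_measurable borel" by (rule borel_measurable_continuous_onI)
  have "(LINT x|lborel. f (s *\<^sub>R T (x + - a))) = (LINT x|lborel. f (s *\<^sub>R T x))"
    by (rule lborel_integral_translate) measurable
  moreover have "(LINT x|distr lborel borel T. f (s *\<^sub>R x)) = (LINT x|lborel. f (s *\<^sub>R T x))"
    by (rule integral_distr) measurable
  moreover have "(LINT x|lborel. f x) = s ^ DIM('a) * (LINT x|lborel. f (s *\<^sub>R x))"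
  proof -
    have "(LINT x|lborel. f x) = (LINT x|density (distr lborel borel (\<lambda>x. 0 + s *\<^sub>R x)) (\<lambda>_. \<bar>s\<bar>^DIM('a)). f x)"
      using s by (subst lborel_affine[of s 0]) auto
    also have "\<dots> = (LINT x|distr lborel borel (\<lambda>x. 0 + s *\<^sub>R x). \<bar>s\<bar>^DIM('a) *\<^sub>R f x)"
      using s by (subst integral_density) auto
    also have "\<dots> = (LINT x|lborel. \<bar>s\<bar>^DIM('a) *\<^sub>R f (0 + s *\<^sub>R x))"
      by (rule integral_distr) measurable
    finally show ?thesis using s by simp
  qed
  ultimately show ?thesis using s by (simp add: distr_orthogonal[OF T])
qed

section \<open>Calculus of smooth functions and bump functions\<close>

lemma Ck_SucI:
  assumes "\<And>x. (f has_derivative f' x) (at x)" "\<And>b. b \<in> Basis \<Longrightarrow> Ck k (\<lambda>x. f' x b)"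
  shows "Ck (Suc k) f"
proof -
  have "frechet_derivative f (at x) = f' x" for x
    using frechet_derivative_at[OF assms(1)] by simp
  then show ?thesis using assms by (auto simp: differentiable_def)
qed

lemma Ck_SucD:
  assumes "Ck (Suc k) f"
  shows "(f has_derivative frechet_derivative f (at x)) (at x)"
    and "b \<in> Basis \<Longrightarrow> Ck k (\<lambda>x. frechet_derivative f (at x) b)"
  using assms frechet_derivative_works by auto

text \<open>The recursion asks for continuity only of the top-order partial derivatives. At the
  bottom of the induction, continuity of f comes from its differentiability.\<close>

lemma Ck_Suc_imp: "Ck (Suc k) f \<Longrightarrow> Ck k f"
proof (induction k arbitrary: f)
  case 0
  then show ?case
    by (auto intro!: continuous_at_imp_continuous_on differentiable_imp_continuous_within)
next
  case (Suc k)
  show ?case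
    by (rule Ck_SucI[where f'="\<lambda>x. frechet_derivative f (at x)"])
       (use Ck_SucD[OF Suc.prems] Suc.IH in blast)+
qed

lemma Ck_const: "Ck k (\<lambda>_. c)"
proof (induction k arbitrary: c)
  case (Suc k)
  show ?case by (rule Ck_SucI[where f'="\<lambda>_ _. 0"]) (use Suc in auto)
qed simp

lemma Ck_add: "Ck k f \<Longrightarrow> Ck k g \<Longrightarrow> Ck k (\<lambda>x. f x + g x)"
proof (induction k arbitrary: f g)
  case (Suc k)
  show ?case
    by (rule Ck_SucI[where f'="\<lambda>x h. frechet_derivative f (at x) h + frechet_derivative g (at x) h"])
       (use Ck_SucD[OF Suc.prems(1)] Ck_SucD[OF Suc.prems(2)] Suc.IH in \<open>blast intro: has_derivative_add\<close>)+
qed (auto intro: continuous_on_add)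

lemma Ck_mult: "Ck k f \<Longrightarrow> Ck k g \<Longrightarrow> Ck k (\<lambda>x. f x * g x)"
proof (induction k arbitrary: f g)
  case (Suc k)
  show ?case
  proof (rule Ck_SucI[where f'="\<lambda>x h. f x * frechet_derivative g (at x) h + frechet_derivative f (at x) h * g x"])
    show "((\<lambda>x. f x * g x) has_derivative (\<lambda>h. f x * frechet_derivative g (at x) h + frechet_derivative f (at x) h * g x)) (at x)" for x
      using Ck_SucD(1)[OF Suc.prems(1)] Ck_SucD(1)[OF Suc.prems(2)] by (rule has_derivative_mult)
    show "Ck k (\<lambda>x. f x * frechet_derivative g (at x) b + frechet_derivative f (at x) b * g x)" if "b \<in> Basis" for b
      using Ck_SucD(2)[OF Suc.prems(1) that] Ck_SucD(2)[OF Suc.prems(2) that] Suc.prems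
      by (intro Ck_add Suc.IH) (auto intro: Ck_Suc_imp simp del: Ck.simps)
  qed
qed (auto intro: continuous_on_mult)

lemma Ck_sum: "(\<And>i. i \<in> I \<Longrightarrow> Ck k (f i)) \<Longrightarrow> Ck k (\<lambda>x. \<Sum>i\<in>I. f i x)"
  by (induction I rule: infinite_finite_induct) (auto intro: Ck_const Ck_add)

text \<open>By the chain rule each partial derivative of the composition is a combination, with
  constant coefficients, of partial derivatives of f composed with the same affine map, so the
  induction hypothesis applies to every term.\<close>

lemma Ck_compose_affine:
  fixes f :: "'a::euclidean_space \<Rightarrow> real" and A :: "'a \<Rightarrow> 'a"
  assumes "linear A"
  shows "Ck k f \<Longrightarrow> Ck k (\<lambda>x. f (A x + c))"
proof (induction k arbitrary: f)
  case 0
  have "continuous_on UNIV (\<lambda>x. A x + c)" using assms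
    by (intro continuous_intros linear_continuous_on) (simp add: linear_linear)
  then have "continuous_on UNIV (\<lambda>x. f (A x + c))"
    using 0 by (auto intro: continuous_on_compose2[of UNIV f])
  then show ?case by simp
next
  case (Suc k)
  let ?F = "\<lambda>x. frechet_derivative f (at x)"
  have lin: "linear (?F x)" for x using Ck_SucD(1)[OF Suc.prems] by (rule has_derivative_linear)
  have "?F x v = (\<Sum>b\<in>Basis. (v \<bullet> b) * ?F x b)" for x v
  proof -
    have "?F x v = ?F x (\<Sum>b\<in>Basis. (v \<bullet> b) *\<^sub>R b)" by (simp add: euclidean_representation)
    also have "\<dots> = (\<Sum>b\<in>Basis. (v \<bullet> b) * ?F x b)" using lin by (simp add: linear_sum linear_scale)
    finally show ?thesis .
  qed
  then have eq: "?F (A x + c) (A b) = (\<Sum>b'\<in>Basis. (A b \<bullet> b') * ?F (A x + c) b')" for x b .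
  show ?case
  proof (rule Ck_SucI[where f'="\<lambda>x h. ?F (A x + c) (A h)"])
    fix x
    have "((\<lambda>x. A x + c) has_derivative A) (at x)"
      using assms by (intro has_derivative_add_const) (simp add: linear_imp_has_derivative)
    then show "((\<lambda>x. f (A x + c)) has_derivative (\<lambda>h. ?F (A x + c) (A h))) (at x)"
      by (rule has_derivative_compose) (rule Ck_SucD(1)[OF Suc.prems])
  next
    fix b :: 'a assume "b \<in> Basis"
    show "Ck k (\<lambda>x. ?F (A x + c) (A b))"
      unfolding eq by (intro Ck_sum Ck_mult Ck_const Suc.IH Ck_SucD(2)[OF Suc.prems])
  qed
qed

lemma test_functionI:
  assumes "\<And>k. Ck k v" "compact K" "K \<subseteq> \<Omega>" "\<And>x. x \<notin> K \<Longrightarrow> v x = 0"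
  shows "v \<in> test_functions \<Omega>"
proof -
  have "closure {x. v x \<noteq> 0} \<subseteq> K"
    using assms(4) by (intro closure_minimal compact_imp_closed[OF assms(2)]) auto
  moreover from this have "compact (closure {x. v x \<noteq> 0})"
    using assms(2) compact_Int_closed[of K "closure {x. v x \<noteq> 0}"] by (simp add: inf.absorb2)
  ultimately show ?thesis using assms unfolding test_functions_def by auto
qed

text \<open>For m = 0 this is the classical smooth function exp(-1/s), flat at 0. The powers of 1/s
  make the family closed under differentiation up to linear combinations, so smoothness of all
  members can be proved by one induction.\<close>

definition flat_exp :: "nat \<Rightarrow> real \<Rightarrow> real" where
  "flat_exp m s = (if s > 0 then (1 / s) ^ m * exp (- (1 / s)) else 0)"

lemma flat_exp_tendsto_0: "(flat_exp m \<longlongrightarrow> 0) (at 0)"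
proof -
  have "((\<lambda>s. (inverse s) ^ m / exp (inverse s)) \<longlongrightarrow> 0) (at_right (0::real))"
    by (rule filterlim_compose[OF tendsto_power_div_exp_0 filterlim_inverse_at_top_right])
  moreover have "eventually (\<lambda>s. (inverse s) ^ m / exp (inverse s) = flat_exp m s) (at_right (0::real))"
    by (auto simp: eventually_at_right_field flat_exp_def exp_minus divide_inverse intro!: exI[of _ 1])
  ultimately have "(flat_exp m \<longlongrightarrow> 0) (at_right 0)" by (rule Lim_transform_eventually)
  moreover have "(flat_exp m \<longlongrightarrow> 0) (at_left 0)"
  proof (rule Lim_transform_eventually)
    show "eventually (\<lambda>s. 0 = flat_exp m s) (at_left (0::real))"
      by (auto simp: eventually_at_left_field flat_exp_def intro!: exI[of _ "-1"])
  qed simp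
  ultimately show ?thesis by (simp add: filterlim_at_split)
qed

text \<open>The only delicate point is s = 0, where the difference quotient is
  \<open>flat_exp (m + 1)\<close>, again a member of the family, and tends to 0.\<close>

lemma flat_exp_derivative:
  "(flat_exp m has_real_derivative flat_exp (m + 2) s - real m * flat_exp (m + 1) s) (at s)"
proof -
  consider "s < 0" | "s = 0" | "s > 0" by linarith
  then show ?thesis
  proof cases
    case 1
    have "((\<lambda>_. 0) has_real_derivative flat_exp (m + 2) s - real m * flat_exp (m + 1) s) (at s)"
      using 1 by (simp add: flat_exp_def)
    then show ?thesis
      by (rule has_field_derivative_transform_within_open[where S="{..<0}"]) (use 1 in \<open>auto simp: flat_exp_def\<close>)
  next
    case 2
    have "eventually (\<lambda>h. flat_exp (m + 1) h = flat_exp m h / h) (at (0::real))"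
      by (rule always_eventually) (auto simp: flat_exp_def)
    with flat_exp_tendsto_0[of "m + 1"] have "((\<lambda>h. flat_exp m h / h) \<longlongrightarrow> 0) (at 0)"
      by (rule Lim_transform_eventually)
    then show ?thesis using 2 by (simp add: DERIV_def flat_exp_def)
  next
    case 3
    have "((\<lambda>s. (1 / s) ^ m * exp (- (1 / s))) has_real_derivative
        (real m * (1 / s) ^ (m - 1) * (- (1 / s\<^sup>2))) * exp (- (1 / s)) + (1 / s) ^ m * (exp (- (1 / s)) * (1 / s\<^sup>2))) (at s)"
      using 3 by (auto intro!: derivative_eq_intros simp: power2_eq_square)
    moreover have "(real m * (1 / s) ^ (m - 1) * (- (1 / s\<^sup>2))) * exp (- (1 / s)) + (1 / s) ^ m * (exp (- (1 / s)) * (1 / s\<^sup>2))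
        = flat_exp (m + 2) s - real m * flat_exp (m + 1) s"
      using 3 by (cases m) (auto simp: flat_exp_def power2_eq_square power_add algebra_simps add_divide_distrib)
    ultimately have "((\<lambda>s. (1 / s) ^ m * exp (- (1 / s))) has_real_derivative
        flat_exp (m + 2) s - real m * flat_exp (m + 1) s) (at s)" by simp
    then show ?thesis
      by (rule has_field_derivative_transform_within_open[where S="{0<..}"]) (use 3 in \<open>auto simp: flat_exp_def\<close>)
  qed
qed

lemma Ck_bump:
  fixes c :: "'a::euclidean_space"
  shows "Ck k (\<lambda>x. flat_exp m (r\<^sup>2 - (norm (x - c))\<^sup>2))"
proof (induction k arbitrary: m)
  case 0
  have "continuous_on UNIV (flat_exp m)"
    using flat_exp_derivative DERIV_isCont by (blast intro: continuous_at_imp_continuous_on)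
  then show ?case by (auto intro!: continuous_on_compose2[of UNIV "flat_exp m"] continuous_intros)
next
  case (Suc k)
  have linear_part: "Ck k (\<lambda>x::'a. -2 * ((x - c) \<bullet> b))" for b k
  proof (cases k)
    case (Suc j)
    show ?thesis unfolding Suc
      by (rule Ck_SucI[where f'="\<lambda>x h. -2 * (h \<bullet> b)"])
         (auto intro!: derivative_eq_intros Ck_const)
  qed (auto intro!: continuous_intros)
  show ?case
  proof (rule Ck_SucI[where f'="\<lambda>x h. (flat_exp (m + 2) (r\<^sup>2 - (norm (x - c))\<^sup>2) - real m * flat_exp (m + 1) (r\<^sup>2 - (norm (x - c))\<^sup>2)) * (-2 * ((x - c) \<bullet> h))"])
    fix x
    have "((\<lambda>x. r\<^sup>2 - (norm (x - c))\<^sup>2) has_derivative (\<lambda>h. -2 * ((x - c) \<bullet> h))) (at x)"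
      unfolding power2_norm_eq_inner
      by (auto intro!: derivative_eq_intros simp: inner_commute)
    from has_derivative_compose[OF this flat_exp_derivative[unfolded has_field_derivative_def]]
    show "((\<lambda>x. flat_exp m (r\<^sup>2 - (norm (x - c))\<^sup>2)) has_derivative
      (\<lambda>h. (flat_exp (m + 2) (r\<^sup>2 - (norm (x - c))\<^sup>2) - real m * flat_exp (m + 1) (r\<^sup>2 - (norm (x - c))\<^sup>2)) * (-2 * ((x - c) \<bullet> h)))) (at x)" .
  next
    fix b :: 'a assume "b \<in> Basis"
    have "Ck k (\<lambda>x. (flat_exp (m + 2) (r\<^sup>2 - (norm (x - c))\<^sup>2) + (- real m) * flat_exp (m + 1) (r\<^sup>2 - (norm (x - c))\<^sup>2)) * (-2 * ((x - c) \<bullet> b)))"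
      by (rule Ck_mult[OF Ck_add[OF Suc.IH Ck_mult[OF Ck_const Suc.IH]] linear_part])
    then show "Ck k (\<lambda>x. (flat_exp (m + 2) (r\<^sup>2 - (norm (x - c))\<^sup>2) - real m * flat_exp (m + 1) (r\<^sup>2 - (norm (x - c))\<^sup>2)) * (-2 * ((x - c) \<bullet> b)))"
      by simp
  qed
qed

lemma nonzero_test_function_exists:
  fixes \<Omega> :: "'a::euclidean_space set"
  assumes "open \<Omega>" "\<Omega> \<noteq> {}"
  shows "test_functions \<Omega> - {\<lambda>x. 0} \<noteq> {}"
proof -
  obtain c where "c \<in> \<Omega>" using assms by auto
  then obtain r where r: "r > 0" "cball c r \<subseteq> \<Omega>" using assms(1) open_contains_cball by blast
  define v where "v x = flat_exp 0 (r\<^sup>2 - (norm (x - c))\<^sup>2)" for x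
  have "v \<in> test_functions \<Omega>"
  proof (rule test_functionI)
    show "Ck k v" for k unfolding v_def[abs_def] by (rule Ck_bump)
    fix x assume "x \<notin> cball c r"
    then have "r \<le> norm (x - c)" by (simp add: dist_norm norm_minus_commute)
    then have "r\<^sup>2 \<le> (norm (x - c))\<^sup>2" using r by (intro power_mono) auto
    then show "v x = 0" by (simp add: v_def flat_exp_def)
  qed (use r in auto)
  moreover have "v c \<noteq> 0" using r by (simp add: v_def flat_exp_def)
  ultimately show ?thesis by fastforce
qed

section \<open>Flat boundary points\<close>

text \<open>If the difference quotient over the segment from \<open>c - \<tau> e\<close> to \<open>c + \<tau> e\<close> is almost the
  supremum \<open>\<Lambda>\<close>, then \<open>\<phi>\<close> is squeezed between two cones with vertices at the end points, which near \<open>c\<close>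
  differ from the affine function of slope \<open>\<Lambda> e\<close> only by \<open>\<Lambda> (norm h)\<^sup>2 / (2 \<tau>)\<close>.\<close>

lemma lipschitz_nearly_affine:
  fixes \<phi> :: "'a::euclidean_space \<Rightarrow> real"
  assumes lip: "L-lipschitz_on UNIV \<phi>" and r0: "r0 > 0" and \<eta>: "\<eta> > 0"
  obtains y \<rho> a where "0 < \<rho>" "\<rho> \<le> r0" "y \<in> ball y0 r0"
    "\<And>z. z \<in> ball y \<rho> \<Longrightarrow> \<bar>\<phi> z - \<phi> y - a \<bullet> (z - y)\<bar> \<le> \<eta> * \<rho>"
proof -
  let ?U = "ball y0 r0"
  have L: "L \<ge> 0" using lip by (rule lipschitz_on_nonneg)
  define Q where "Q = {(\<phi> y - \<phi> x) / norm (y - x) | x y. x \<in> ?U \<and> y \<in> ?U \<and> x \<noteq> y}"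
  have QL: "q \<le> L" if q: "q \<in> Q" for q
  proof -
    obtain x y where xy: "q = (\<phi> y - \<phi> x) / norm (y - x)" "x \<noteq> y" using q unfolding Q_def by blast
    have "\<phi> y - \<phi> x \<le> L * norm (y - x)"
      using lipschitz_onD[OF lip, of y x] by (simp add: dist_norm dist_real_def)
    then show ?thesis using xy by (simp add: divide_le_eq)
  qed
  obtain b :: 'a where b: "b \<in> Basis" using nonempty_Basis by blast
  define y1 where "y1 = y0 + (r0 / 2) *\<^sub>R b"
  have y1: "y1 \<in> ?U" "y0 \<in> ?U" "y1 \<noteq> y0" using b r0 by (auto simp: y1_def dist_norm)
  \<comment> \<open>Exchanging the two points changes the sign of a difference quotient. With q0 and
    -q0 both in Q, the supremum is nonnegative.\<close>
  define q0 where "q0 = (\<phi> y1 - \<phi> y0) / norm (y1 - y0)"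
  have "- q0 = (\<phi> y0 - \<phi> y1) / norm (y0 - y1)"
    by (simp add: q0_def norm_minus_commute minus_divide_left)
  then have q0: "q0 \<in> Q" "- q0 \<in> Q"
    unfolding Q_def using y1 q0_def by blast+
  define \<Lambda> where "\<Lambda> = Sup Q"
  have bdd: "bdd_above Q" using QL by (auto simp: bdd_above_def)
  have Q\<Lambda>: "q \<le> \<Lambda>" if "q \<in> Q" for q unfolding \<Lambda>_def by (rule cSup_upper[OF that bdd])
  have \<Lambda>0: "\<Lambda> \<ge> 0" using Q\<Lambda>[OF q0(1)] Q\<Lambda>[OF q0(2)] by linarith
  have slope: "\<phi> y - \<phi> x \<le> \<Lambda> * norm (y - x)" if "x \<in> ?U" "y \<in> ?U" for x y
  proof (cases "x = y")
    case False
    then have "(\<phi> y - \<phi> x) / norm (y - x) \<le> \<Lambda>" using that by (intro Q\<Lambda>) (auto simp: Q_def)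
    then show ?thesis using False by (simp add: divide_le_eq)
  qed simp
  \<comment> \<open>\<kappa> will be the ratio of the radius \<rho> to the half-length \<tau> of the
    segment, and \<epsilon> the permitted defect of its slope. They are set so that the curvature of
    the cones, \<Lambda> \<kappa> \<rho> / 2, and the defect, 2 \<epsilon> \<tau>, each contribute
    at most \<eta> \<rho> / 2.\<close>
  define \<kappa> where "\<kappa> = \<eta> / (\<Lambda> + 1)"
  have \<kappa>: "\<kappa> > 0" using \<eta> \<Lambda>0 by (simp add: \<kappa>_def)
  define \<epsilon> where "\<epsilon> = \<eta> * \<kappa> / 4"
  have \<epsilon>: "\<epsilon> > 0" using \<eta> \<kappa> by (simp add: \<epsilon>_def)
  obtain q where "q \<in> Q" "\<Lambda> - \<epsilon> < q"
    using less_cSupE[of "\<Lambda> - \<epsilon>" Q] \<epsilon> q0 unfolding \<Lambda>_def by auto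
  then obtain x y where xy: "x \<in> ?U" "y \<in> ?U" "x \<noteq> y" "(\<Lambda> - \<epsilon>) * norm (y - x) < \<phi> y - \<phi> x"
    by (auto simp: Q_def less_divide_eq)
  define r1 where "r1 = max (dist y0 x) (dist y0 y)"
  have r1: "r1 < r0" "x \<in> cball y0 r1" "y \<in> cball y0 r1" "0 \<le> r1" using xy by (auto simp: r1_def le_max_iff_disj)
  define l where "l = norm (y - x)"
  have l: "l > 0" using xy by (simp add: l_def)
  \<comment> \<open>The segment is cut into M equal pieces, so many that a ball of radius \<rho> =
    \<kappa> l / (2 M) around a point of the segment stays inside the ball in which the supremum was
    taken.\<close>
  obtain M :: nat where M: "M > 0" "\<kappa> * l / 2 < real M * (r0 - r1)"
  proof -
    obtain M :: nat where M': "\<kappa> * l / 2 / (r0 - r1) < real M" using reals_Archimedean2 by blast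
    then have "0 < real M" if "0 < \<kappa> * l / 2 / (r0 - r1)" using that by (rule less_trans[rotated])
    moreover have "0 < \<kappa> * l / 2 / (r0 - r1)" using \<kappa> l r1 by simp
    ultimately have "0 < real M" by blast
    moreover have "\<kappa> * l / 2 < real M * (r0 - r1)"
      using M' r1(1) by (subst (asm) pos_divide_less_eq) auto
    ultimately show ?thesis by (intro that) auto
  qed
  define e where "e = (1 / l) *\<^sub>R (y - x)"
  have e: "norm e = 1" "l *\<^sub>R e = y - x" using l by (auto simp: e_def l_def)
  define \<tau> where "\<tau> = l / (2 * real M)"
  have \<tau>: "\<tau> > 0" using l M by (simp add: \<tau>_def)
  define P where "P i = x + (2 * \<tau> * real i) *\<^sub>R e" for i
  have PM: "P M = y" "P 0 = x" using e M by (auto simp: P_def \<tau>_def)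
  \<comment> \<open>If every piece had slope at most \<Lambda> - \<epsilon>, so would the whole
    segment; hence some short piece is as steep as the long one.\<close>
  obtain i where i: "i < M" "(\<Lambda> - \<epsilon>) * (2 * \<tau>) < \<phi> (P (Suc i)) - \<phi> (P i)"
  proof (rule ccontr)
    assume "\<not> thesis"
    then have "(\<Sum>i<M. \<phi> (P (Suc i)) - \<phi> (P i)) \<le> (\<Sum>i<M. (\<Lambda> - \<epsilon>) * (2 * \<tau>))"
      using that by (intro sum_mono) (meson lessThan_iff not_less)
    moreover have "(\<Sum>i<M. \<phi> (P (Suc i)) - \<phi> (P i)) = \<phi> y - \<phi> x"
      by (subst sum_lessThan_telescope) (simp add: PM)
    moreover have "(\<Sum>i<M. (\<Lambda> - \<epsilon>) * (2 * \<tau>)) = (\<Lambda> - \<epsilon>) * l"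
    proof -
      have Ml: "real M * (2 * \<tau>) = l" using M by (simp add: \<tau>_def)
      have "(\<Sum>i<M. (\<Lambda> - \<epsilon>) * (2 * \<tau>)) = (\<Lambda> - \<epsilon>) * (real M * (2 * \<tau>))"
        by (simp only: sum_constant card_lessThan mult.left_commute)
      then show ?thesis unfolding Ml .
    qed
    ultimately show False using xy(4)[folded l_def] by linarith
  qed
  define c where "c = P i + \<tau> *\<^sub>R e"
  have x': "P i = c - \<tau> *\<^sub>R e" by (simp add: c_def)
  have "2 * \<tau> * real (Suc i) = 2 * \<tau> * real i + \<tau> + \<tau>" by (simp add: algebra_simps)
  then have y': "P (Suc i) = c + \<tau> *\<^sub>R e" by (simp only: c_def P_def scaleR_add_left add.assoc)
  have seg: "x + (t * l) *\<^sub>R e \<in> cball y0 r1" if "0 \<le> t" "t \<le> 1" for t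
  proof -
    have y: "y = x + l *\<^sub>R e" using e(2) by simp
    have "x + (t * l) *\<^sub>R e = (1 - t) *\<^sub>R x + t *\<^sub>R y" unfolding y by (simp add: algebra_simps)
    then show ?thesis using convexD_alt[OF convex_cball r1(2,3) that] by simp
  qed
  have cc: "c \<in> cball y0 r1"
  proof -
    have "c = x + (((2 * real i + 1) / (2 * real M)) * l) *\<^sub>R e"
      by (simp add: c_def P_def \<tau>_def scaleR_add_left[symmetric] add_divide_distrib[symmetric] distrib_right)
         (simp add: algebra_simps add_divide_distrib)
    moreover have "(2 * real i + 1) / (2 * real M) \<le> 1" using i(1) by (simp add: divide_le_eq)
    ultimately show ?thesis using seg[of "(2 * real i + 1) / (2 * real M)"] by simp
  qed
  have Pin: "P j \<in> ?U" if "j \<le> M" for j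
  proof -
    have "P j = x + ((real j / real M) * l) *\<^sub>R e" by (simp add: P_def \<tau>_def mult.commute)
    moreover have "real j / real M \<le> 1" using that M by (simp add: divide_le_eq)
    ultimately show ?thesis using seg[of "real j / real M"] r1(1) by auto
  qed
  define \<rho> where "\<rho> = \<kappa> * \<tau>"
  have \<rho>: "\<rho> > 0" "\<rho> < r0 - r1"
    using \<kappa> \<tau> M by (auto simp: \<rho>_def \<tau>_def field_simps)
  have ballU: "z \<in> ?U" if "z \<in> ball c \<rho>" for z
    using that cc \<rho> dist_triangle[of y0 z c] by auto
  \<comment> \<open>The tangent-line bound for the square root at \<tau>^2: it makes the distance to
    an end point affine in h . e up to the quadratic error E.\<close>
  have half: "norm v \<le> (\<tau> + (norm v)\<^sup>2 / \<tau>) / 2" for v :: 'a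
  proof -
    have "0 \<le> (norm v - \<tau>)\<^sup>2" by simp
    then have "2 * \<tau> * norm v \<le> \<tau>\<^sup>2 + (norm v)\<^sup>2" by (simp add: power2_eq_square algebra_simps)
    then show ?thesis using \<tau> by (simp add: field_simps power2_eq_square)
  qed
  show ?thesis
  proof (rule that[of \<rho> c "\<Lambda> *\<^sub>R e"])
    show "0 < \<rho>" "\<rho> \<le> r0" "c \<in> ball y0 r0" using \<rho> r1 cc by auto
    fix z assume z: "z \<in> ball c \<rho>"
    define h where "h = z - c"
    have zc: "z = c + h" by (simp add: h_def)
    have nh: "norm h < \<rho>" using z by (simp add: h_def dist_norm norm_minus_commute)
    define E where "E = (norm h)\<^sup>2 / (2 * \<tau>)"
    have "(norm h)\<^sup>2 \<le> \<rho>\<^sup>2" using nh by (intro power_mono) auto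
    then have "E \<le> \<rho>\<^sup>2 / (2 * \<tau>)" unfolding E_def using \<tau> by (intro divide_right_mono) auto
    then have E: "E \<le> \<kappa> * \<rho> / 2" using \<tau> by (simp add: \<rho>_def power2_eq_square)
    have n1: "norm (h + \<tau> *\<^sub>R e) \<le> \<tau> + h \<bullet> e + E"
    proof -
      have "(norm (h + \<tau> *\<^sub>R e))\<^sup>2 = (norm h)\<^sup>2 + 2 * \<tau> * (h \<bullet> e) + \<tau>\<^sup>2 * (norm e)\<^sup>2"
        unfolding power2_norm_eq_inner by (simp add: inner_add_left inner_add_right inner_commute power2_eq_square)
      then show ?thesis using half[of "h + \<tau> *\<^sub>R e"] e(1) \<tau>
        by (simp add: E_def field_simps power2_eq_square)
    qed
    have n2: "norm (\<tau> *\<^sub>R e - h) \<le> \<tau> - h \<bullet> e + E"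
    proof -
      have "(norm (\<tau> *\<^sub>R e - h))\<^sup>2 = (norm h)\<^sup>2 - 2 * \<tau> * (h \<bullet> e) + \<tau>\<^sup>2 * (norm e)\<^sup>2"
        unfolding power2_norm_eq_inner by (simp add: inner_diff_left inner_diff_right inner_commute power2_eq_square)
      then show ?thesis using half[of "\<tau> *\<^sub>R e - h"] e(1) \<tau>
        by (simp add: E_def field_simps power2_eq_square)
    qed
    have zU: "z \<in> ?U" and cU: "c \<in> ?U" and xU: "P i \<in> ?U" and yU: "P (Suc i) \<in> ?U"
      using ballU[OF z] ballU[of c] \<rho>(1) Pin i(1) by auto
    \<comment> \<open>The lower end point bounds the function at z from above, the upper one from
      below. The almost maximal rise between them leaves its value at the midpoint c a freedom of
      only 2 \<epsilon> \<tau>.\<close>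
    have s1: "\<phi> z - \<phi> (P i) \<le> \<Lambda> * (\<tau> + h \<bullet> e + E)"
      using slope[OF xU zU] mult_left_mono[OF n1 \<Lambda>0] by (simp add: zc x')
    have s2: "\<phi> (P (Suc i)) - \<phi> z \<le> \<Lambda> * (\<tau> - h \<bullet> e + E)"
      using slope[OF zU yU] mult_left_mono[OF n2 \<Lambda>0] by (simp add: zc y')
    have s3: "\<phi> c - \<phi> (P i) \<le> \<Lambda> * \<tau>" using slope[OF xU cU] e(1) \<tau> by (simp add: x')
    have s4: "\<phi> (P (Suc i)) - \<phi> c \<le> \<Lambda> * \<tau>" using slope[OF cU yU] e(1) \<tau> by (simp add: y')
    have "\<bar>\<phi> z - \<phi> c - \<Lambda> * (h \<bullet> e)\<bar> \<le> \<Lambda> * E + 2 * \<epsilon> * \<tau>"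
      using s1 s2 s3 s4 i(2) by (simp add: algebra_simps abs_le_iff)
    also have "\<dots> \<le> \<eta> * \<rho>"
    proof -
      have "\<Lambda> * E \<le> \<Lambda> * (\<kappa> * \<rho> / 2)" using E \<Lambda>0 by (rule mult_left_mono)
      also have "\<dots> = (\<Lambda> * \<kappa>) * (\<rho> / 2)" by simp
      also have "\<dots> \<le> \<eta> * (\<rho> / 2)"
        using \<Lambda>0 \<eta> \<rho> by (intro mult_right_mono) (auto simp: \<kappa>_def field_simps)
      finally have "\<Lambda> * E \<le> \<eta> * \<rho> / 2" by simp
      moreover have "2 * \<epsilon> * \<tau> = \<eta> * \<rho> / 2" by (simp add: \<epsilon>_def \<rho>_def)
      ultimately show ?thesis by linarith
    qed
    finally show "\<bar>\<phi> z - \<phi> c - (\<Lambda> *\<^sub>R e) \<bullet> (z - c)\<bar> \<le> \<eta> * \<rho>"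
      by (simp add: h_def inner_commute)
  qed
qed

text \<open>Around a suitable graph point x0 near p the boundary function deviates from an affine
  one by at most \<eta> \<rho>, by \<open>lipschitz_nearly_affine\<close>. The vector \<nu> is the
  preimage under T of the unit normal (-a, 1)/c, and dividing by c >= 1 does not enlarge the
  error.\<close>

lemma flat_boundary_point:
  fixes \<Omega> :: "((real ^ 'n) \<times> real) set"
  assumes dom: "is_domain \<Omega>" "bounded \<Omega>" and lip: "lipschitz_boundary \<Omega>" and \<eta>: "\<eta> > 0"
  obtains x0 \<rho> \<nu> where "0 < \<rho>" "norm \<nu> = 1"
    "\<And>x. x \<in> ball x0 \<rho> \<Longrightarrow> (x - x0) \<bullet> \<nu> > \<eta> * \<rho> \<Longrightarrow> x \<in> \<Omega>"
    "\<And>x. x \<in> ball x0 \<rho> \<Longrightarrow> (x - x0) \<bullet> \<nu> < - (\<eta> * \<rho>) \<Longrightarrow> x \<notin> \<Omega>"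
proof -
  note fr = bounded_domain_frontier[OF dom]
  obtain p where p: "p \<in> frontier \<Omega>" using fr(2) by blast
  obtain r T \<phi> L where r: "r > 0" and T: "orthogonal_transformation T"
    and \<phi>: "L-lipschitz_on UNIV (\<phi> :: real ^ 'n \<Rightarrow> real)"
    and \<Omega>: "\<Omega> \<inter> ball p r = {x \<in> ball p r. snd (T x) > \<phi> (fst (T x))}"
    using lip p unfolding lipschitz_boundary_def by blast
  have L: "L \<ge> 0" using \<phi> by (rule lipschitz_on_nonneg)
  have lT: "linear T" using T by (rule orthogonal_transformation_linear)
  then have cT: "continuous_on UNIV T" by (simp add: linear_continuous_on linear_linear)
  have mem: "x \<in> \<Omega> \<longleftrightarrow> snd (T x) > \<phi> (fst (T x))" if "x \<in> ball p r" for x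
  proof -
    have "x \<in> \<Omega> \<longleftrightarrow> x \<in> \<Omega> \<inter> ball p r" using that by simp
    also have "\<dots> \<longleftrightarrow> snd (T x) > \<phi> (fst (T x))" unfolding \<Omega> using that by simp
    finally show ?thesis .
  qed
  define h where "h x = snd (T x) - \<phi> (fst (T x))" for x
  have ch: "continuous_on UNIV h" unfolding h_def
    by (intro continuous_intros cT continuous_on_compose2[OF lipschitz_on_continuous_on[OF \<phi>]]) auto
  \<comment> \<open>The boundary point p lies on the graph: it is not in the open set \<Omega>, and
    points near p with h < 0 are not in \<Omega> either, while p is a limit of points of
    \<Omega>.\<close>
  have hp: "h p = 0"
  proof (rule antisym)
    have "p \<notin> \<Omega>" using p fr(1) frontier_disjoint_eq[of \<Omega>] by auto
    then show "h p \<le> 0" using mem[of p] r by (simp add: h_def)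
    show "0 \<le> h p"
    proof (rule ccontr)
      assume "\<not> 0 \<le> h p"
      then have "p \<in> {x. h x < 0} \<inter> ball p r" using r by simp
      moreover have "open ({x. h x < 0} \<inter> ball p r)"
        using ch by (intro open_Int open_Collect_less continuous_intros) auto
      moreover have "p \<in> closure \<Omega>" using p by (simp add: frontier_def)
      ultimately obtain x where "x \<in> \<Omega>" "h x < 0" "x \<in> ball p r"
        unfolding closure_iff_nhds_not_empty by blast
      then show False using mem[of x] by (simp add: h_def)
    qed
  qed
  \<comment> \<open>Graph points over the ball of radius r0 are within (1 + L) r0 = r/2 of p, and
    \<rho> <= r0 <= r/2 then keeps the ball around x0 inside the coordinate patch.\<close>
  define r0 where "r0 = r / (2 * (1 + L))"
  have r0: "r0 > 0" "(1 + L) * r0 = r / 2" "r0 \<le> r / 2"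
    using r L by (auto simp: r0_def field_simps)
  obtain y \<rho> a where y: "0 < \<rho>" "\<rho> \<le> r0" "y \<in> ball (fst (T p)) r0"
    and flat: "\<And>z. z \<in> ball y \<rho> \<Longrightarrow> \<bar>\<phi> z - \<phi> y - a \<bullet> (z - y)\<bar> \<le> \<eta> * \<rho>"
    using lipschitz_nearly_affine[OF \<phi> r0(1) \<eta>] by metis
  obtain x0 where x0: "T x0 = (y, \<phi> y)" using orthogonal_transformation_surj[OF T] by (metis surjD)
  define c where "c = norm (- a, 1::real)"
  have c: "c \<ge> 1" using norm_snd_le[of "1::real" "- a"] by (simp add: c_def)
  obtain \<nu> where \<nu>: "T \<nu> = (1 / c) *\<^sub>R (- a, 1)" using orthogonal_transformation_surj[OF T] by (metis surjD)
  have n\<nu>: "norm \<nu> = 1"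
  proof -
    have "norm \<nu> = norm (T \<nu>)" using orthogonal_transformation_norm[OF T] by simp
    also have "\<dots> = \<bar>1 / c\<bar> * c" unfolding \<nu> norm_scaleR c_def ..
    finally show ?thesis using c by simp
  qed
  have iso: "norm (T u - T v) = norm (u - v)" for u v
    using orthogonal_transformation_norm[OF T, of "u - v"] lT by (simp add: linear_diff)
  have dx0: "norm (x0 - p) < r / 2"
  proof -
    have "T p = (fst (T p), \<phi> (fst (T p)))" using hp by (simp add: h_def prod_eq_iff)
    then have "norm (T x0 - T p) = norm (y - fst (T p), \<phi> y - \<phi> (fst (T p)))"
      unfolding x0 by (metis diff_Pair)
    also have "\<dots> \<le> norm (y - fst (T p)) + norm (\<phi> y - \<phi> (fst (T p)))" by (rule norm_Pair_le)
    also have "\<dots> \<le> norm (y - fst (T p)) + L * norm (y - fst (T p))"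
      using lipschitz_onD[OF \<phi>, of y "fst (T p)"] by (simp add: dist_norm)
    also have "\<dots> = (1 + L) * norm (y - fst (T p))" by (simp add: algebra_simps)
    also have "\<dots> < (1 + L) * r0"
      using y(3) L by (intro mult_strict_left_mono) (auto simp: dist_norm norm_minus_commute)
    finally show ?thesis using r0 iso by simp
  qed
  \<comment> \<open>In the coordinates given by T, the difference of (x - x0) . \<nu> and h x / c is
    exactly the deviation of \<phi> from its affine approximation, divided by c.\<close>
  have key: "x \<in> ball p r" "\<bar>(x - x0) \<bullet> \<nu> - h x / c\<bar> \<le> \<eta> * \<rho> / c" if x: "x \<in> ball x0 \<rho>" for x
  proof -
    have nx: "norm (x - x0) < \<rho>" using x by (simp add: dist_norm norm_minus_commute)
    have "norm (x - p) \<le> norm (x - x0) + norm (x0 - p)"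
      using norm_triangle_ineq[of "x - x0" "x0 - p"] by simp
    then show "x \<in> ball p r" using nx dx0 y r0 by (simp add: dist_norm norm_minus_commute)
    obtain y1 t where Tx: "T x = (y1, t)" by fastforce
    have "norm (y1 - y) \<le> norm (T x - T x0)" using norm_fst_le[of "y1 - y" "t - \<phi> y"] by (simp add: Tx x0)
    then have "y1 \<in> ball y \<rho>" using nx iso by (simp add: dist_norm norm_minus_commute)
    note f = flat[OF this]
    have "(x - x0) \<bullet> \<nu> = T (x - x0) \<bullet> T \<nu>" using T unfolding orthogonal_transformation_def by metis
    also have "\<dots> = (T x - T x0) \<bullet> ((1 / c) *\<^sub>R (- a, 1))" using lT by (simp add: linear_diff \<nu>)
    also have "\<dots> = ((t - \<phi> y) - a \<bullet> (y1 - y)) / c"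
      by (simp only: Tx x0 diff_Pair inner_scaleR_right inner_Pair) (simp add: inner_commute)
    also have "\<dots> - h x / c = (\<phi> y1 - \<phi> y - a \<bullet> (y1 - y)) / c"
      by (simp add: h_def Tx diff_divide_distrib)
    finally have "\<bar>(x - x0) \<bullet> \<nu> - h x / c\<bar> = \<bar>\<phi> y1 - \<phi> y - a \<bullet> (y1 - y)\<bar> / c" using c by simp
    then show "\<bar>(x - x0) \<bullet> \<nu> - h x / c\<bar> \<le> \<eta> * \<rho> / c" using f c by (simp add: divide_right_mono)
  qed
  have c2: "\<eta> * \<rho> / c \<le> \<eta> * \<rho>" using divide_left_mono[of 1 c "\<eta> * \<rho>"] c \<eta> y(1) by simp
  show ?thesis
  proof (rule that[OF y(1) n\<nu>])
    fix x assume x: "x \<in> ball x0 \<rho>"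
    { assume "(x - x0) \<bullet> \<nu> > \<eta> * \<rho>"
      then have "h x / c > 0" using key(2)[OF x] c2 by linarith
      then have "h x > 0" using c by (simp add: zero_less_divide_iff)
      then show "x \<in> \<Omega>" using mem[OF key(1)[OF x]] by (simp add: h_def) }
    { assume "(x - x0) \<bullet> \<nu> < - (\<eta> * \<rho>)"
      then have "h x / c < 0" using key(2)[OF x] c2 by linarith
      then have "h x < 0" using c by (simp add: divide_less_0_iff)
      then show "x \<notin> \<Omega>" using mem[OF key(1)[OF x]] by (simp add: h_def) }
  qed
qed

text \<open>The reflection in the hyperplane orthogonal to a - b; it sends a to b because both have
  the same norm.\<close>

lemma orthogonal_transformation_exists:
  fixes a b :: "'a::euclidean_space"
  assumes "norm a = 1" "norm b = 1"
  obtains T where "orthogonal_transformation T" "T a = b"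
proof (cases "a = b")
  case True
  then show ?thesis using that[of "\<lambda>x. x"] by simp
next
  case False
  define w where "w = a - b"
  define T where "T x = x - (2 * (x \<bullet> w) / (w \<bullet> w)) *\<^sub>R w" for x
  have ww: "w \<bullet> w \<noteq> 0" using False by (simp add: w_def)
  have "a \<bullet> a = 1" "b \<bullet> b = 1" using assms by (simp_all add: norm_eq_1)
  then have aw: "2 * (a \<bullet> w) = w \<bullet> w" by (simp add: w_def inner_diff_left inner_diff_right inner_commute)
  have "linear T" unfolding T_def
    by (rule linearI) (auto simp: inner_add_left add_divide_distrib algebra_simps)
  moreover have "T x \<bullet> T y = x \<bullet> y" for x y
    using ww by (simp add: T_def inner_diff_left inner_diff_right inner_commute field_simps)
  ultimately have "orthogonal_transformation T" by (simp add: orthogonal_transformation_def)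
  moreover have "T a = b" using ww aw by (simp add: T_def) (simp add: w_def)
  ultimately show ?thesis by (rule that)
qed

text \<open>The segment from x to y has to cross the boundary. So a single point outside \<Omega> is
  enough to bound the distance from above.\<close>

lemma bdist_le_dist:
  fixes \<Omega> :: "'a::euclidean_space set"
  assumes "x \<in> \<Omega>" "y \<notin> \<Omega>"
  shows "bdist \<Omega> x \<le> dist x y"
proof -
  have "closed_segment x y \<inter> frontier \<Omega> \<noteq> {}"
    by (rule connected_Int_frontier) (use assms in auto)
  then obtain z where z: "z \<in> closed_segment x y" "z \<in> frontier \<Omega>" by auto
  then have "bdist \<Omega> x \<le> dist x z" unfolding bdist_def by (intro infdist_le)
  also have "\<dots> \<le> dist x y" using z(1) by (metis dist_commute dist_in_closed_segment(1))
  finally show ?thesis .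
qed

lemma upper_half_space_props:
  shows "open (upper_half_space :: ((real ^ 'n) \<times> real) set)"
    and "frontier (upper_half_space :: ((real ^ 'n) \<times> real) set) \<noteq> {}"
    and "(x :: (real ^ 'n) \<times> real) \<in> upper_half_space \<Longrightarrow> snd x \<le> bdist upper_half_space x"
    and "(x :: (real ^ 'n) \<times> real) \<in> upper_half_space \<longleftrightarrow> snd x > 0"
    and "(upper_half_space :: ((real ^ 'n) \<times> real) set) \<noteq> {}"
proof -
  let ?H = "upper_half_space :: ((real ^ 'n) \<times> real) set"
  show mem: "x \<in> ?H \<longleftrightarrow> snd x > 0" for x by (auto simp: upper_half_space_def split: prod.splits)
  have H: "?H = {x. snd x > 0}" using mem by auto
  show op: "open ?H" unfolding H by (intro open_Collect_less continuous_intros)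
  have "(0, 1) \<in> ?H" "(0, 0) \<notin> ?H" by (auto simp: mem)
  then show "?H \<noteq> {}" by blast
  have "?H \<noteq> UNIV" using \<open>(0, 0) \<notin> ?H\<close> by blast
  then show fr: "frontier ?H \<noteq> {}" using \<open>?H \<noteq> {}\<close> by (intro frontier_not_empty)
  show "snd x \<le> bdist ?H x" if "x \<in> ?H" for x
    unfolding bdist_def infdist_notempty[OF fr]
  proof (rule cINF_greatest[OF fr])
    fix z assume "z \<in> frontier ?H"
    then have "z \<notin> ?H" using op frontier_disjoint_eq[of ?H] by blast
    then have "snd z \<le> 0" by (simp add: mem)
    moreover have "\<bar>snd x - snd z\<bar> \<le> dist x z" using dist_snd_le[of x z] by (simp add: dist_real_def)
    ultimately show "snd x \<le> dist x z" by linarith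
  qed
qed

section \<open>Bounds for the infimum\<close>

lemma set_integral_eq_integral:
  fixes f :: "'a \<Rightarrow> real"
  assumes "\<And>x. x \<notin> \<Omega> \<Longrightarrow> f x = 0"
  shows "(LINT x:\<Omega>|M. f x) = (LINT x|M. f x)"
  unfolding set_lebesgue_integral_def
  by (rule Bochner_Integration.integral_cong) (use assms in \<open>auto simp: indicator_def\<close>)

lemma J_eq:
  fixes \<Omega> :: "((real ^ 'n) \<times> real) set"
  assumes u: "u \<in> test_functions \<Omega>"
  defines "n \<equiv> real CARD('n)"
  shows "J \<beta> \<Omega> u = (LINT x|lborel. (norm (grad u x))\<^sup>2) /
    (LINT x|lborel. bdist \<Omega> x powr (-2 + (n - 1) / (n + 1) * \<beta>) * \<bar>u x\<bar> powr (2 + 2 * \<beta> / (n + 1)))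
      powr ((n + 1) / (n + \<beta> + 1))"
proof -
  have out: "x \<notin> support u" if "x \<notin> \<Omega>" for x using that support_subset[OF u] by blast
  have 1: "(LINT x:\<Omega>|lborel. (norm (grad u x))\<^sup>2) = (LINT x|lborel. (norm (grad u x))\<^sup>2)"
    using grad_zero_outside_support[OF u out] by (intro set_integral_eq_integral) simp
  have 2: "(LINT x:\<Omega>|lborel. bdist \<Omega> x powr a * \<bar>u x\<bar> powr b) = (LINT x|lborel. bdist \<Omega> x powr a * \<bar>u x\<bar> powr b)" for a b
    using zero_outside_support[OF out] by (intro set_integral_eq_integral) simp
  show ?thesis unfolding J_def Let_def 1 2 n_def ..
qed

lemma J_nonneg:
  fixes \<Omega> :: "((real ^ 'n) \<times> real) set"
  assumes "u \<in> test_functions \<Omega>"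
  shows "0 \<le> J \<beta> \<Omega> u"
  unfolding J_eq[OF assms] by simp

text \<open>Positivity holds because the set where the continuous integrand is nonzero is open and
  nonempty, hence not a null set. It keeps the quotient \<open>J\<close> from taking the default
  value of a division by zero.\<close>

lemma weighted_power_integral:
  fixes \<Omega> :: "'a::euclidean_space set"
  assumes u: "u \<in> test_functions \<Omega>" and \<Omega>: "open \<Omega>" "frontier \<Omega> \<noteq> {}" and q: "q > 0"
  shows "continuous_on UNIV (\<lambda>x. bdist \<Omega> x powr a * \<bar>u x\<bar> powr q)"
    and "integrable lborel (\<lambda>x. bdist \<Omega> x powr a * \<bar>u x\<bar> powr q)"
    and "u \<noteq> (\<lambda>x. 0) \<Longrightarrow> 0 < (LINT x|lborel. bdist \<Omega> x powr a * \<bar>u x\<bar> powr q)"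
proof -
  let ?f = "\<lambda>x. bdist \<Omega> x powr a * \<bar>u x\<bar> powr q"
  have "bdist \<Omega> x \<noteq> 0" if "x \<in> \<Omega>" for x using infdist_frontier_pos[OF \<Omega> that] by simp
  then have c: "continuous_on \<Omega> ?f"
    by (intro continuous_on_mult continuous_abs_powr[OF continuous_test_function[OF u] q] continuous_on_powr continuous_on_bdist continuous_on_const) blast
  have z: "?f x = 0" if "x \<notin> support u" for x using zero_outside_support[OF that] q by simp
  show cf: "continuous_on UNIV ?f" and int: "integrable lborel ?f"
    using integrable_on_support[OF u \<Omega>(1) support_subset[OF u] c z] by blast+
  assume "u \<noteq> (\<lambda>x. 0)"
  then obtain y where y: "u y \<noteq> 0" by auto
  then have "y \<in> \<Omega>" using zero_outside_support[of y u] support_subset[OF u] by blast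
  then have fy: "?f y \<noteq> 0" using y infdist_frontier_pos[OF \<Omega>, of y] by simp
  have "0 \<le> (LINT x|lborel. ?f x)" by simp
  moreover have "(LINT x|lborel. ?f x) \<noteq> 0"
  proof
    assume "(LINT x|lborel. ?f x) = 0"
    then have "AE x in lborel. ?f x = 0"
      by (subst (asm) integral_nonneg_eq_0_iff_AE[OF int]) auto
    moreover have op: "open {x. ?f x \<noteq> 0}" by (intro open_Collect_neq cf continuous_on_const)
    moreover have "{x. ?f x \<noteq> 0} \<in> sets lborel" using borel_open[OF op] by simp
    ultimately have "{x. ?f x \<noteq> 0} \<in> null_sets lborel" by (simp add: AE_iff_null_sets)
    then have "negligible {x. ?f x \<noteq> 0}"
      by (simp add: negligible_iff_null_sets null_sets_completionI)
    then show False using open_not_negligible[OF op] fy by blast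
  qed
  ultimately show "0 < (LINT x|lborel. ?f x)" by linarith
qed

text \<open>The power \<kappa> is the reciprocal of 1 + \<beta>/(n+1), so raising
  \<open>hardy_sobolev\<close> to it makes the right-hand side linear in the Dirichlet integral, and
  C^(-\<kappa>) is a lower bound for every quotient. A nonzero test function must exist, as the
  infimum of an empty set carries no information.\<close>

lemma \<mu>_pos:
  fixes \<Omega> :: "((real ^ 'n) \<times> real) set" and \<beta> :: real
  assumes dom: "is_domain \<Omega>" "bounded \<Omega>" and lip: "lipschitz_boundary \<Omega>"
    and \<beta>: "0 \<le> \<beta>" "CARD('n) \<ge> 2 \<Longrightarrow> \<beta> \<le> 2 * (real CARD('n) + 1) / (real CARD('n) - 1)"
  shows "0 < \<mu> \<beta> \<Omega>"
proof -
  note fr = bounded_domain_frontier[OF dom]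
  define n where "n = real CARD('n)"
  have n: "n \<ge> 0" by (simp add: n_def)
  define a where "a = -2 + (n - 1) / (n + 1) * \<beta>"
  define q where "q = 2 + 2 * \<beta> / (n + 1)"
  define \<kappa> where "\<kappa> = (n + 1) / (n + \<beta> + 1)"
  have q: "q > 0" using n \<beta> by (simp add: q_def add_pos_nonneg)
  have \<kappa>: "\<kappa> > 0" "(1 + \<beta> / (n + 1)) * \<kappa> = 1" using n \<beta>(1) by (auto simp: \<kappa>_def field_simps add_nonneg_eq_0_iff)
  obtain C where C: "C > 0" "\<And>u. u \<in> test_functions \<Omega> \<Longrightarrow>
    (LINT x|lborel. bdist \<Omega> x powr a * \<bar>u x\<bar> powr q) \<le> C * (LINT x|lborel. (norm (grad u x))\<^sup>2) powr (1 + \<beta> / (n + 1))"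
    using hardy_sobolev[OF dom lip \<beta>] unfolding n_def[symmetric] a_def[symmetric] q_def[symmetric] by blast
  have "1 / C powr \<kappa> \<le> \<mu> \<beta> \<Omega>"
    unfolding \<mu>_def
  proof (rule cINF_greatest)
    show "test_functions \<Omega> - {\<lambda>x. 0} \<noteq> {}"
      using nonzero_test_function_exists dom(1) unfolding is_domain_def by blast
    fix u assume "u \<in> test_functions \<Omega> - {\<lambda>x. 0}"
    then have u: "u \<in> test_functions \<Omega>" "u \<noteq> (\<lambda>x. 0)" by auto
    define B where "B = (LINT x|lborel. bdist \<Omega> x powr a * \<bar>u x\<bar> powr q)"
    define D where "D = (LINT x|lborel. (norm (grad u x))\<^sup>2)"
    have B: "B > 0" unfolding B_def by (rule weighted_power_integral(3)[OF u(1) fr(1,2) q u(2)])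
    have D: "D \<ge> 0" by (simp add: D_def)
    have "B powr \<kappa> \<le> (C * D powr (1 + \<beta> / (n + 1))) powr \<kappa>"
      using C(2)[OF u(1)] B \<kappa> by (intro powr_mono2) (auto simp: B_def D_def)
    also have "\<dots> = C powr \<kappa> * D"
      using C D \<kappa> by (simp add: powr_mult powr_powr)
    finally have "1 / C powr \<kappa> \<le> D / B powr \<kappa>" using B C by (simp add: field_simps)
    moreover have "J \<beta> \<Omega> u = D / B powr \<kappa>"
      unfolding J_eq[OF u(1)] by (simp add: B_def D_def a_def q_def \<kappa>_def n_def)
    ultimately show "1 / C powr \<kappa> \<le> J \<beta> \<Omega> u" by simp
  qed
  moreover have "1 / C powr \<kappa> > 0" using C by simp
  ultimately show ?thesis by linarith
qed

lemma similarity_test_function: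
  fixes u :: "'a::euclidean_space \<Rightarrow> real" and T :: "'a \<Rightarrow> 'a"
  assumes u: "u \<in> test_functions \<Omega>'" and T: "orthogonal_transformation T" and s: "s > 0"
    and sub: "\<And>x. s *\<^sub>R T (x - x0) \<in> support u \<Longrightarrow> x \<in> \<Omega>"
  defines "v \<equiv> \<lambda>x. u (s *\<^sub>R T (x - x0))"
  shows "v \<in> test_functions \<Omega>" "norm (grad v x) = s * norm (grad u (s *\<^sub>R T (x - x0)))"
proof -
  have lT: "linear T" using T by (rule orthogonal_transformation_linear)
  have cT: "continuous_on UNIV T" using lT by (simp add: linear_continuous_on linear_linear)
  define A where "A x = s *\<^sub>R T x" for x
  have lA: "linear A" unfolding A_def using lT by (rule linear_compose_scale_right)
  have e: "s *\<^sub>R T (x - x0) = A x + (- A x0)" for x using lT by (simp add: A_def linear_diff algebra_simps)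
  have v: "v = (\<lambda>x. u (A x + (- A x0)))" unfolding v_def e ..
  show "v \<in> test_functions \<Omega>"
  proof (rule test_functionI)
    fix k
    have "Ck k u" using u unfolding test_functions_def by blast
    then show "Ck k v" unfolding v by (rule Ck_compose_affine[OF lA])
  next
    let ?K = "{x. s *\<^sub>R T (x - x0) \<in> support u}"
    have "continuous_on UNIV (\<lambda>x. s *\<^sub>R T (x - x0))"
      by (intro continuous_intros continuous_on_compose2[OF cT]) auto
    then have "closed ((\<lambda>x. s *\<^sub>R T (x - x0)) -` support u)"
      using compact_support[OF u] by (intro closed_vimage compact_imp_closed)
    moreover have "(\<lambda>x. s *\<^sub>R T (x - x0)) -` support u = ?K" by auto
    ultimately have "closed ?K" by simp
    moreover have "bounded ?K"
    proof -
      obtain R where R: "\<And>y. y \<in> support u \<Longrightarrow> norm y \<le> R"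
        using compact_imp_bounded[OF compact_support[OF u]] by (auto simp: bounded_iff)
      have "dist x0 x \<le> R / s" if "x \<in> ?K" for x
      proof -
        have "s * norm (x - x0) \<le> R"
          using R[of "s *\<^sub>R T (x - x0)"] that s orthogonal_transformation_norm[OF T, of "x - x0"] by simp
        then show ?thesis using s by (simp add: dist_norm norm_minus_commute field_simps)
      qed
      then have "?K \<subseteq> cball x0 (R / s)" by auto
      then show ?thesis using bounded_cball bounded_subset by blast
    qed
    ultimately show "compact ?K" by (simp add: compact_eq_bounded_closed)
    show "?K \<subseteq> \<Omega>" using sub by auto
    show "v x = 0" if "x \<notin> ?K" for x unfolding v_def by (rule zero_outside_support) (use that in simp)
  qed
  \<comment> \<open>Orthogonality gives T w . T h = w . h, so s w is read off as the gradient of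
    v.\<close>
  obtain w where w: "T w = grad u (s *\<^sub>R T (x - x0))" using orthogonal_transformation_surj[OF T] by (metis surjD)
  have dA: "((\<lambda>x. A x + (- A x0)) has_derivative A) (at x)"
    using lA by (intro has_derivative_add_const) (simp add: linear_imp_has_derivative)
  have "(v has_derivative (\<lambda>h. grad u (A x + (- A x0)) \<bullet> A h)) (at x)"
    unfolding v by (rule has_derivative_compose[OF dA test_function_has_derivative[OF u]])
  moreover have "grad u (A x + (- A x0)) \<bullet> A h = (s *\<^sub>R w) \<bullet> h" for h
  proof -
    have "T w \<bullet> T h = w \<bullet> h" using T unfolding orthogonal_transformation_def by metis
    then show ?thesis unfolding e[symmetric] w[symmetric] by (simp add: A_def)
  qed
  ultimately have "(v has_derivative (\<lambda>h. (s *\<^sub>R w) \<bullet> h)) (at x)" by simp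
  then have "grad v x = s *\<^sub>R w" by (rule grad_eqI)
  then show "norm (grad v x) = s * norm (grad u (s *\<^sub>R T (x - x0)))"
    using s orthogonal_transformation_norm[OF T, of w] w by simp
qed

text \<open>The competitor is u composed with a similarity that magnifies a flat patch of the
  boundary by s. On its support s delta is at most (1 + \<epsilon>) times the distance in the half
  space; with a <= 0 the weight loses at most the factor (1 + \<epsilon>)^a, and after the power
  \<kappa> this is (1 + \<epsilon>)^(-E).\<close>

lemma \<mu>_le_perturbed:
  fixes \<Omega> :: "((real ^ 'n) \<times> real) set" and \<beta> :: real
  assumes dom: "is_domain \<Omega>" "bounded \<Omega>" and lip: "lipschitz_boundary \<Omega>"
    and \<beta>: "0 \<le> \<beta>" "CARD('n) \<ge> 2 \<Longrightarrow> \<beta> \<le> 2 * (real CARD('n) + 1) / (real CARD('n) - 1)"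
    and u: "u \<in> test_functions (upper_half_space :: ((real ^ 'n) \<times> real) set)" "u \<noteq> (\<lambda>x. 0)"
    and \<epsilon>: "\<epsilon> > 0"
  defines "n \<equiv> real CARD('n)"
  defines "E \<equiv> - ((-2 + (n - 1) / (n + 1) * \<beta>) * ((n + 1) / (n + \<beta> + 1)))"
  shows "\<mu> \<beta> \<Omega> \<le> (1 + \<epsilon>) powr E * J \<beta> upper_half_space u"
proof -
  note fr = bounded_domain_frontier[OF dom]
  let ?H = "upper_half_space :: ((real ^ 'n) \<times> real) set"
  note H = upper_half_space_props[where 'n='n]
  have n1: "n \<ge> 1" unfolding n_def by (simp add: Suc_le_eq)
  define N where "N = n + 1"
  have NN: "N = real DIM((real ^ 'n) \<times> real)" and N2: "N \<ge> 2" using n1 by (simp_all add: N_def n_def)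
  define a where "a = -2 + (n - 1) / (n + 1) * \<beta>"
  define q where "q = 2 + 2 * \<beta> / (n + 1)"
  define \<kappa> where "\<kappa> = (n + 1) / (n + \<beta> + 1)"
  have q: "q > 0" using n1 \<beta> by (simp add: q_def add_pos_nonneg)
  have \<kappa>: "\<kappa> > 0" using n1 \<beta>(1) by (simp add: \<kappa>_def)
  have aN: "a + N = (N - 2) * (N + \<beta>) / N" using N2 by (simp add: a_def N_def field_simps)
  have \<kappa>N: "\<kappa> = N / (N + \<beta>)" by (simp add: \<kappa>_def N_def algebra_simps)
  \<comment> \<open>This is the scale invariance of the quotient: the denominator scales like
    s^(-(N-2)), just as the Dirichlet integral does, so the uncontrolled magnification s
    cancels.\<close>
  have scal: "(a + N) * \<kappa> = N - 2" unfolding aN \<kappa>N using N2 \<beta>(1) by simp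
  have a0: "a \<le> 0"
  proof (cases "CARD('n) \<ge> 2")
    case True
    then have "n \<ge> 2" by (simp add: n_def)
    then show ?thesis using \<beta>(2)[OF True] unfolding n_def[symmetric] a_def by (simp add: field_simps)
  next
    case False
    moreover have "CARD('n) \<ge> 1" by (simp add: Suc_le_eq)
    ultimately have "CARD('n) = 1" by linarith
    then have "n = 1" by (simp add: n_def)
    then show ?thesis by (simp add: a_def)
  qed
  define S where "S = support u"
  have S: "compact S" "S \<subseteq> ?H" unfolding S_def using compact_support[OF u(1)] support_subset[OF u(1)] by auto
  have Sne: "S \<noteq> {}" using u(2) zero_outside_support[of _ u] unfolding S_def by auto
  obtain R where "\<And>y. y \<in> S \<Longrightarrow> norm y \<le> R" using compact_imp_bounded[OF S(1)] by (auto simp: bounded_iff)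
  then have R: "R' > 0 \<and> (\<forall>y\<in>S. norm y \<le> R')" if "R' = \<bar>R\<bar> + 1" for R' using that by force
  define R' where "R' = \<bar>R\<bar> + 1"
  note R = R[OF R'_def]
  obtain y0 where y0: "y0 \<in> S" "\<And>y. y \<in> S \<Longrightarrow> snd y0 \<le> snd y"
    using continuous_attains_inf[OF S(1) Sne continuous_on_snd[OF continuous_on_id]] by auto
  define t0 where "t0 = snd y0"
  have t0: "t0 > 0" using y0(1) S(2) H(4)[of y0] by (auto simp: t0_def)
  \<comment> \<open>In magnified coordinates the slab has half-width s \<eta> \<rho> = 4 \<eta> R'.
    It must stay below the support, 4 \<eta> R' < t0; the detour through it must be a small part of
    every height, 8 \<eta> R' <= \<epsilon> t0; and \<eta> <= 1/8 keeps a point just below the slab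
    in the ball of radius \<rho>.\<close>
  define \<eta> where "\<eta> = min (1 / 8) (min \<epsilon> 1 * t0 / (8 * R'))"
  have \<eta>: "\<eta> > 0" "\<eta> \<le> 1 / 8" "8 * \<eta> * R' \<le> \<epsilon> * t0" "4 * \<eta> * R' < t0"
  proof -
    have R0: "R' > 0" using R by simp
    show "\<eta> > 0" "\<eta> \<le> 1 / 8" using R0 t0 \<epsilon> by (auto simp: \<eta>_def)
    have "\<eta> \<le> min \<epsilon> 1 * t0 / (8 * R')" by (simp add: \<eta>_def)
    then have *: "8 * \<eta> * R' \<le> min \<epsilon> 1 * t0" using R0 by (simp add: field_simps)
    also have "\<dots> \<le> \<epsilon> * t0" using t0 by (intro mult_right_mono) auto
    finally show "8 * \<eta> * R' \<le> \<epsilon> * t0" .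
    have "min \<epsilon> 1 * t0 \<le> 1 * t0" using t0 by (intro mult_right_mono) auto
    with * t0 show "4 * \<eta> * R' < t0" by linarith
  qed
  obtain x0 \<rho> \<nu> where \<rho>: "0 < \<rho>" and n\<nu>: "norm \<nu> = 1"
    and inside: "\<And>x. x \<in> ball x0 \<rho> \<Longrightarrow> (x - x0) \<bullet> \<nu> > \<eta> * \<rho> \<Longrightarrow> x \<in> \<Omega>"
    and outside: "\<And>x. x \<in> ball x0 \<rho> \<Longrightarrow> (x - x0) \<bullet> \<nu> < - (\<eta> * \<rho>) \<Longrightarrow> x \<notin> \<Omega>"
    using flat_boundary_point[OF dom lip \<eta>(1)] by metis
  obtain T :: "(real ^ 'n) \<times> real \<Rightarrow> (real ^ 'n) \<times> real" where T: "orthogonal_transformation T" "T \<nu> = (0, 1)"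
    using orthogonal_transformation_exists[OF n\<nu>, of "(0, 1)"] by (auto simp: norm_Pair)
  \<comment> \<open>The factor 4 places the preimage of the support within \<rho>/4 of x0, which
    leaves room in the ball to go down through the slab.\<close>
  define s where "s = 4 * R' / \<rho>"
  have s: "s > 0" "s * \<rho> = 4 * R'" using R \<rho> by (auto simp: s_def)
  define \<Phi> where "\<Phi> x = s *\<^sub>R T (x - x0)" for x
  have snd\<Phi>: "snd (\<Phi> x) = s * ((x - x0) \<bullet> \<nu>)" for x
  proof -
    have "(x - x0) \<bullet> \<nu> = T (x - x0) \<bullet> T \<nu>" using T(1) unfolding orthogonal_transformation_def by metis
    also have "\<dots> = snd (T (x - x0))" unfolding T(2) by (simp add: inner_prod_def)
    finally show ?thesis by (simp add: \<Phi>_def)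
  qed
  have n\<Phi>: "norm (\<Phi> x) = s * norm (x - x0)" for x
    using s orthogonal_transformation_norm[OF T(1)] by (simp add: \<Phi>_def)
  have near: "norm (x - x0) \<le> \<rho> / 4" if "\<Phi> x \<in> S" for x
  proof -
    have "s * norm (x - x0) \<le> s * (\<rho> / 4)" using R that s n\<Phi>[of x] by auto
    then show ?thesis using s(1) by simp
  qed
  have in\<Omega>: "x \<in> \<Omega>" if x: "\<Phi> x \<in> S" for x
  proof (rule inside)
    show "x \<in> ball x0 \<rho>" using near[OF x] \<rho> by (simp add: dist_norm norm_minus_commute)
    have "s * (\<eta> * \<rho>) = 4 * \<eta> * R'" using s(2) by (simp add: mult_ac)
    also have "\<dots> < s * ((x - x0) \<bullet> \<nu>)" using \<eta>(4) y0(2)[OF x] snd\<Phi>[of x] by (simp add: t0_def)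
    finally show "\<eta> * \<rho> < (x - x0) \<bullet> \<nu>" using s(1) by simp
  qed
  have bd: "s * bdist \<Omega> x \<le> (1 + \<epsilon>) * bdist ?H (\<Phi> x)" if x: "\<Phi> x \<in> S" for x
  proof -
    define t where "t = (x - x0) \<bullet> \<nu>"
    \<comment> \<open>Moving from x by \<tau> against \<nu> ends at height -2 \<eta> \<rho>, below
      the slab and so outside \<Omega>; the length of this move bounds delta at x.\<close>
    define \<tau> where "\<tau> = t + 2 * \<eta> * \<rho>"
    have st: "t0 \<le> s * t" using y0(2)[OF x] snd\<Phi>[of x] by (simp add: t0_def t_def)
    then have t: "t > 0" using t0 s(1) by (smt (verit) zero_less_mult_pos)
    have "t \<le> norm (x - x0)" unfolding t_def using Cauchy_Schwarz_ineq2[of "x - x0" \<nu>] n\<nu> by simp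
    moreover have "\<eta> * \<rho> \<le> 1 / 8 * \<rho>" using \<eta>(2) \<rho> by (intro mult_right_mono) auto
    moreover have "0 < \<eta> * \<rho>" using \<eta> \<rho> by simp
    ultimately have \<tau>: "0 < \<tau>" "\<tau> \<le> \<rho> / 2" using near[OF x] t unfolding \<tau>_def by linarith+
    have "x - \<tau> *\<^sub>R \<nu> \<notin> \<Omega>"
    proof (rule outside)
      have "norm ((x - x0) - \<tau> *\<^sub>R \<nu>) \<le> norm (x - x0) + norm (\<tau> *\<^sub>R \<nu>)" by (rule norm_triangle_ineq4)
      then have "norm (x - \<tau> *\<^sub>R \<nu> - x0) < \<rho>" using near[OF x] \<tau> n\<nu> \<rho> by (simp add: algebra_simps)
      then show "x - \<tau> *\<^sub>R \<nu> \<in> ball x0 \<rho>" by (simp add: dist_norm norm_minus_commute)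
      have "\<nu> \<bullet> \<nu> = 1" using n\<nu> by (simp add: norm_eq_1)
      then have "(x - \<tau> *\<^sub>R \<nu> - x0) \<bullet> \<nu> = t - \<tau>" by (simp add: t_def inner_diff_left)
      then show "(x - \<tau> *\<^sub>R \<nu> - x0) \<bullet> \<nu> < - (\<eta> * \<rho>)" using \<open>0 < \<eta> * \<rho>\<close> by (simp add: \<tau>_def)
    qed
    from bdist_le_dist[OF in\<Omega>[OF x] this] have "bdist \<Omega> x \<le> \<tau>" using n\<nu> \<tau>(1) by (simp add: dist_norm)
    then have "s * bdist \<Omega> x \<le> s * \<tau>" using s(1) by simp
    also have "s * \<tau> = s * t + 8 * \<eta> * R'" using s(2) by (simp add: \<tau>_def algebra_simps)
    also have "\<dots> \<le> s * t + \<epsilon> * (s * t)"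
      using \<eta>(3) mult_left_mono[OF st less_imp_le[OF \<epsilon>]] by linarith
    also have "\<dots> = (1 + \<epsilon>) * snd (\<Phi> x)" by (simp add: snd\<Phi> t_def algebra_simps)
    also have "\<dots> \<le> (1 + \<epsilon>) * bdist ?H (\<Phi> x)"
      using \<epsilon> H(3)[of "\<Phi> x"] x S(2) by (intro mult_left_mono) auto
    finally show ?thesis .
  qed
  define v where "v x = u (\<Phi> x)" for x
  have v: "v \<in> test_functions \<Omega>" and gv: "norm (grad v x) = s * norm (grad u (\<Phi> x))" for x
    using similarity_test_function[OF u(1) T(1) s(1), of x0 \<Omega>] in\<Omega> unfolding \<Phi>_def v_def[abs_def] S_def by auto
  define F where "F y = bdist ?H y powr a * \<bar>u y\<bar> powr q" for y
  have F: "continuous_on UNIV F" "integrable lborel F" "0 < (LINT y|lborel. F y)"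
    unfolding F_def[abs_def] using weighted_power_integral[OF u(1) H(1,2) q] u(2) by auto
  define A where "A = (LINT y|lborel. (norm (grad u y))\<^sup>2)"
  define B where "B = (LINT y|lborel. F y)"
  define B' where "B' = (LINT x|lborel. bdist \<Omega> x powr a * \<bar>v x\<bar> powr q)"
  have A: "A \<ge> 0" and B: "B > 0" using F by (simp_all add: A_def B_def)
  have spow: "s ^ DIM((real ^ 'n) \<times> real) = s powr N" unfolding NN by (rule powr_realpow[OF s(1), symmetric])
  have A': "(LINT x|lborel. (norm (grad v x))\<^sup>2) = s\<^sup>2 * A / s powr N"
  proof -
    have "(\<lambda>y. (norm (grad u y))\<^sup>2) \<in> borel_measurable borel"
      by (intro borel_measurable_continuous_onI continuous_intros continuous_grad[OF u(1)])
    from integral_similarity[OF T(1) s(1) this, of x0]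
    have "(LINT x|lborel. (norm (grad u (\<Phi> x)))\<^sup>2) = A / s powr N"
      unfolding \<Phi>_def A_def spow .
    moreover have "(LINT x|lborel. (norm (grad v x))\<^sup>2) = s\<^sup>2 * (LINT x|lborel. (norm (grad u (\<Phi> x)))\<^sup>2)"
      by (simp add: gv power_mult_distrib)
    ultimately show ?thesis by simp
  qed
  have pt: "((1 + \<epsilon>) / s) powr a * F (\<Phi> x) \<le> bdist \<Omega> x powr a * \<bar>v x\<bar> powr q" for x
  proof (cases "\<Phi> x \<in> S")
    case True
    have d: "bdist \<Omega> x > 0" by (rule infdist_frontier_pos[OF fr(1,2) in\<Omega>[OF True]])
    have "bdist \<Omega> x \<le> (1 + \<epsilon>) / s * bdist ?H (\<Phi> x)" using bd[OF True] s(1) by (simp add: field_simps)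
    then have "((1 + \<epsilon>) / s * bdist ?H (\<Phi> x)) powr a \<le> bdist \<Omega> x powr a"
      using d a0 by (intro powr_mono2') auto
    then have "((1 + \<epsilon>) / s) powr a * bdist ?H (\<Phi> x) powr a \<le> bdist \<Omega> x powr a"
      using s(1) \<epsilon> by (subst (asm) powr_mult) (auto simp: bdist_def infdist_nonneg)
    then have "((1 + \<epsilon>) / s) powr a * bdist ?H (\<Phi> x) powr a * \<bar>u (\<Phi> x)\<bar> powr q \<le> bdist \<Omega> x powr a * \<bar>u (\<Phi> x)\<bar> powr q"
      by (rule mult_right_mono) simp
    then show ?thesis by (simp add: F_def v_def mult.assoc)
  next
    case False
    then have "u (\<Phi> x) = 0" unfolding S_def by (rule zero_outside_support)
    then show ?thesis by (simp add: F_def v_def)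
  qed
  have Fm: "F \<in> borel_measurable borel" using F(1) by (rule borel_measurable_continuous_onI)
  have IF: "(LINT x|lborel. F (\<Phi> x)) = B / s powr N"
    using integral_similarity[OF T(1) s(1) Fm, of x0] unfolding \<Phi>_def B_def spow .
  have "((1 + \<epsilon>) / s) powr a * (B / s powr N) = (LINT x|lborel. ((1 + \<epsilon>) / s) powr a * F (\<Phi> x))"
    by (simp add: IF)
  also have "\<dots> \<le> B'"
    unfolding B'_def
  proof (rule integral_mono[OF _ _ pt])
    \<comment> \<open>The integral of a nonintegrable function is 0 by convention, so a nonzero
      value already proves integrability.\<close>
    have "(LINT x|lborel. F (\<Phi> x)) \<noteq> 0" using IF B s(1) by simp
    then have "integrable lborel (\<lambda>x. F (\<Phi> x))" using not_integrable_integral_eq by blast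
    then show "integrable lborel (\<lambda>x. ((1 + \<epsilon>) / s) powr a * F (\<Phi> x))" by simp
    show "integrable lborel (\<lambda>x. bdist \<Omega> x powr a * \<bar>v x\<bar> powr q)"
      by (rule weighted_power_integral(2)[OF v fr(1,2) q])
  qed
  finally have "((1 + \<epsilon>) / s) powr a * (B / s powr N) \<le> B'" .
  moreover have "((1 + \<epsilon>) / s) powr a * (B / s powr N) = (1 + \<epsilon>) powr a * s powr (- (a + N)) * B"
  proof -
    have "s powr (- (a + N)) = 1 / (s powr a * s powr N)" unfolding powr_minus_divide powr_add ..
    moreover have "((1 + \<epsilon>) / s) powr a = (1 + \<epsilon>) powr a / s powr a"
      by (rule powr_divide)
    ultimately show ?thesis by simp
  qed
  ultimately have BB: "(1 + \<epsilon>) powr a * s powr (- (a + N)) * B \<le> B'" by simp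
  have pos: "(1 + \<epsilon>) powr a * s powr (- (a + N)) * B > 0" using B s(1) \<epsilon> by simp
  have "(1 + \<epsilon>) powr (- E) * s powr (- (N - 2)) * B powr \<kappa> = ((1 + \<epsilon>) powr a * s powr (- (a + N)) * B) powr \<kappa>"
  proof -
    have "- (a + N) * \<kappa> = - (N - 2)" using scal by linarith
    then have e1: "(s powr (- (a + N))) powr \<kappa> = s powr (- (N - 2))" by (simp only: powr_powr)
    have "a * \<kappa> = - E" by (simp add: E_def a_def \<kappa>_def)
    then have e2: "((1 + \<epsilon>) powr a) powr \<kappa> = (1 + \<epsilon>) powr (- E)" by (simp only: powr_powr)
    show ?thesis using B by (simp only: powr_mult e1 e2 powr_ge_zero mult_nonneg_nonneg less_imp_le)
  qed
  also have "\<dots> \<le> B' powr \<kappa>" using BB pos \<kappa> by (intro powr_mono2) auto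
  finally have Bk: "(1 + \<epsilon>) powr (- E) * s powr (- (N - 2)) * B powr \<kappa> \<le> B' powr \<kappa>" .
  have "v \<noteq> (\<lambda>x. 0)"
  proof
    assume "v = (\<lambda>x. 0)"
    then have "B' = 0" using q by (simp add: B'_def)
    then show False using BB pos by linarith
  qed
  then have "\<mu> \<beta> \<Omega> \<le> J \<beta> \<Omega> v"
    unfolding \<mu>_def using v J_nonneg[of _ \<Omega> \<beta>]
    by (intro cINF_lower bdd_belowI2[of _ 0]) auto
  also have "\<dots> = (s\<^sup>2 * A / s powr N) / B' powr \<kappa>"
    unfolding J_eq[OF v] A' by (simp add: B'_def a_def q_def \<kappa>_def n_def)
  also have "\<dots> \<le> (s\<^sup>2 * A / s powr N) / ((1 + \<epsilon>) powr (- E) * s powr (- (N - 2)) * B powr \<kappa>)"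
  proof (rule divide_left_mono[OF Bk])
    have "B' > 0" using BB pos by linarith
    then show "0 < B' powr \<kappa> * ((1 + \<epsilon>) powr (- E) * s powr (- (N - 2)) * B powr \<kappa>)"
      using B s(1) \<epsilon> by simp
  qed (use A in simp)
  also have "\<dots> = (1 + \<epsilon>) powr E * (A / B powr \<kappa>)"
  proof -
    have "- (N - 2) = 2 - N" by simp
    then have "s powr (- (N - 2)) = s powr 2 / s powr N" by (simp only: powr_diff)
    then have "s powr (- (N - 2)) = s\<^sup>2 / s powr N" using s(1) by simp
    moreover have "(1 + \<epsilon>) powr (- E) = 1 / (1 + \<epsilon>) powr E" by (rule powr_minus_divide)
    moreover have "(1 + \<epsilon>) powr E > 0" "s\<^sup>2 > 0" "s powr N > 0" using s(1) \<epsilon> by auto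
    moreover have "(x * A / y) / (1 / z * (x / y) * w) = z * (A / w)" if "x > 0" "y > 0" "z > 0" for x y z w :: real
      using that by (simp add: field_simps)
    ultimately show ?thesis by (simp only:)
  qed
  also have "A / B powr \<kappa> = J \<beta> ?H u"
    unfolding J_eq[OF u(1)] by (simp add: A_def B_def F_def a_def q_def \<kappa>_def n_def)
  finally show ?thesis .
qed

text \<open>The exponent E depends neither on \<epsilon> nor on u, so for a fixed u the factor in
  \<open>\<mu>_le_perturbed\<close> tends to 1 along \<epsilon> = 1/(k+1).\<close>

lemma \<mu>_le_\<mu>_star:
  fixes \<Omega> :: "((real ^ 'n) \<times> real) set" and \<beta> :: real
  assumes dom: "is_domain \<Omega>" "bounded \<Omega>" and lip: "lipschitz_boundary \<Omega>"
    and \<beta>: "0 \<le> \<beta>" "CARD('n) \<ge> 2 \<Longrightarrow> \<beta> \<le> 2 * (real CARD('n) + 1) / (real CARD('n) - 1)"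
  shows "\<mu> \<beta> \<Omega> \<le> \<mu>_star TYPE('n) \<beta>"
  unfolding \<mu>_star_def \<mu>_def[of \<beta> upper_half_space]
proof (rule cINF_greatest)
  show "test_functions (upper_half_space :: ((real ^ 'n) \<times> real) set) - {\<lambda>x. 0} \<noteq> {}"
    using upper_half_space_props(1,5) by (rule nonzero_test_function_exists)
  fix u assume u: "u \<in> test_functions (upper_half_space :: ((real ^ 'n) \<times> real) set) - {\<lambda>x. 0}"
  define n where "n = real CARD('n)"
  define E where "E = - ((-2 + (n - 1) / (n + 1) * \<beta>) * ((n + 1) / (n + \<beta> + 1)))"
  show "\<mu> \<beta> \<Omega> \<le> J \<beta> upper_half_space u"
  proof (rule LIMSEQ_le_const)
    have "(\<lambda>k. (1 + 1 / real (Suc k)) powr E * J \<beta> upper_half_space u) \<longlonglongrightarrow> (1 + 0) powr E * J \<beta> upper_half_space u"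
      by (intro tendsto_intros lim_1_over_n[THEN LIMSEQ_Suc]) auto
    then show "(\<lambda>k. (1 + 1 / real (Suc k)) powr E * J \<beta> upper_half_space u) \<longlonglongrightarrow> J \<beta> upper_half_space u"
      by simp
    have "\<mu> \<beta> \<Omega> \<le> (1 + 1 / real (Suc k)) powr E * J \<beta> upper_half_space u" for k
      unfolding E_def n_def by (rule \<mu>_le_perturbed[OF dom lip \<beta>]) (use u in auto)
    then show "\<exists>N. \<forall>k\<ge>N. \<mu> \<beta> \<Omega> \<le> (1 + 1 / real (Suc k)) powr E * J \<beta> upper_half_space u" by blast
  qed
qed

theorem proposition1p3:
  fixes \<Omega> :: "((real ^ 'n) \<times> real) set" and \<beta> :: real
  assumes "is_domain \<Omega>" and "bounded \<Omega>" and "lipschitz_boundary \<Omega>"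
    and "0 \<le> \<beta>"
    and "CARD('n) \<ge> 2 \<Longrightarrow> \<beta> \<le> 2 * (real CARD('n) + 1) / (real CARD('n) - 1)"
  shows "0 < \<mu> \<beta> \<Omega> \<and> \<mu> \<beta> \<Omega> \<le> \<mu>_star TYPE('n) \<beta>"
  using \<mu>_pos[OF assms] \<mu>_le_\<mu>_star[OF assms] by simp

end
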